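(* Let $M$ be a lattice and let $P \subseteq M_{\mathbb{R}}$ be an $n$-dimensional lattice polytope of (normalized) volume $V$ and degree $d$. If $$n \geq (V-1)(2d+1),$$ then $P$ is a lattice pyramid over an $(n-1)$-dimensional lattice polytope.
   Context: A lattice $M$ is a free abelian group of finite rank, and $M_{\mathbb{R}} = M \otimes_{\mathbb{Z}} \mathbb{R}$. A lattice polytope $P \subseteq M_{\mathbb{R}}$ is a polytope all of whose vertices lie in $M$. All lattice notions for $P$ are taken with respect to the affine lattice $\operatorname{aff}(P) \cap M$. The volume of $P$ always means the normalized volume $\operatorname{Vol}(P)$, i.e. $n!$ times the Euclidean volume with respect to this lattice, where $n = \dim(P)$, so that unimodular simplices have volume $1$. For an $n$-dimensional lattice polytope $P$ one has $$\sum_{k \geq 0} |kP \cap M|\, t^k = \frac{h^*_0 + h^*_1 t + \cdots + h^*_n t^n}{(1-t)^{n+1}}$$ with non-negative integers $h^*_i$ (for $k=0$ the number of lattice points is $1$). The numerator is the $h^*$-polynomial of $P$, and the degree $\deg(P)$ of $P$ is the maximal $i$ with $h^*_i \neq 0$. Two lattice polytopes $P \subseteq M_{\mathbb{R}}$ and $P' \subseteq M'_{\mathbb{R}}$ are isomorphic if there is an affine lattice isomorphism $\operatorname{aff}(P)\cap M \cong \operatorname{aff}(P')\cap M'$ mapping the vertices of $P$ onto the vertices of $P'$. For a lattice polytope $B \subseteq \mathbb{R}^k$ with respect to $\mathbb{Z}^k$, the ($1$-fold) standard pyramid over $B$ is $\operatorname{conv}(\{0\} \cup (B \times \{1\}))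 \subseteq \mathbb{R}^{k+1}$, a lattice polytope with respect to $\mathbb{Z}^{k+1}$; the $l$-fold standard pyramid is obtained by iterating this $l$ times, and the $0$-fold standard pyramid over $B$ is $B$ itself. For lattice polytopes $Q \subseteq P$, we say that $P$ is a lattice pyramid over $Q$ if $P$ is isomorphic to the $(\dim(P)-\dim(Q))$-fold standard pyramid over some lattice polytope $B$ by an isomorphism mapping $Q$ onto the copy of $B$ in this standard pyramid. Convention: the empty set counts as a lattice polytope of dimension $-1$, and a single lattice point is a lattice pyramid over it. *)

theory Defs
  imports
    "HOL-Analysis.Analysis"
    "HOL-Analysis.Finite_Function_Topology"
    "HOL-Computational_Algebra.Formal_Power_Series"
begin

text \<open>
  A lattice is realised inside a real vector space as the integer span of finitely many
  \<^emph>\<open>linearly independent\<close> vectors.  It need not span the ambient space: \<open>span M\<close>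
  is the model of the tensor product of \<open>M\<close> with the reals, so every rank (including
  0) is covered by any ambient space of sufficiently large dimension.
\<close>

definition is_lattice :: "'a::real_vector set \<Rightarrow> bool" where
  "is_lattice M \<longleftrightarrow>
     (\<exists>B. finite B \<and> independent B \<and> M = {\<Sum>b\<in>B. of_int (c b) *\<^sub>R b | c :: 'a \<Rightarrow> int. True})"

definition vertices :: "'a::real_vector set \<Rightarrow> 'a set" where
  "vertices P = {x. x extreme_point_of P}"

text \<open>The empty set is a lattice polytope; \<^const>\<open>aff_dim\<close> gives it dimension \<open>-1\<close>.\<close>

definition lattice_polytope :: "'a::real_vector set \<Rightarrow> 'a set \<Rightarrow> bool" where
  "lattice_polytope M P \<longleftrightarrow> polytope P \<and> vertices P \<subseteq> M"

text \<open>
  Affine coordinates on an \<open>n\<close>-dimensional affine lattice \<open>L\<close>: an origin \<open>p\<close> together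
  with a basis \<open>b 0, \<dots>, b (n - 1)\<close> of the lattice of differences.
\<close>

definition lattice_frame :: "'a::real_vector set \<Rightarrow> nat \<Rightarrow> 'a \<Rightarrow> (nat \<Rightarrow> 'a) \<Rightarrow> bool" where
  "lattice_frame L n p b \<longleftrightarrow>
     inj_on b {..<n} \<and> independent (b ` {..<n}) \<and>
     L = {p + (\<Sum>i<n. of_int (z i) *\<^sub>R b i) | z :: nat \<Rightarrow> int. True}"

text \<open>
  Volume is measured in affine lattice coordinates, i.e. in \<open>n\<close>-fold product Lebesgue measure
  after identifying \<open>affine hull P \<inter> M\<close> with the integer points.  The value does
  not depend on the chosen frame, since two frames differ by a unimodular affine map.  For
  \<open>n = 0\<close> the product measure is the unit mass on a single point.
\<close>

definition normalized_volume :: "'a::euclidean_space set \<Rightarrow> 'a set \<Rightarrow> real" where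
  "normalized_volume M P =
     (let n = nat (aff_dim P);
          (p, b) = (SOME (p, b). lattice_frame (affine hull P \<inter> M) n p b);
          N = Pi\<^sub>M {..<n} (\<lambda>_. lborel :: real measure)
      in fact n * measure N {x \<in> space N. p + (\<Sum>i<n. x i *\<^sub>R b i) \<in> P})"

definition ehrhart_series :: "'a::real_vector set \<Rightarrow> 'a set \<Rightarrow> int fps" where
  "ehrhart_series M P = Abs_fps (\<lambda>k. int (card ((\<lambda>x. real k *\<^sub>R x) ` P \<inter> M)))"

text \<open>
  For a nonempty lattice polytope the following series is a polynomial of degree at most
  \<open>aff_dim P\<close>, so the maximum in \<open>lattice_degree\<close> ranges over a finite nonempty set.
\<close>

definition h_star :: "'a::euclidean_space set \<Rightarrow> 'a set \<Rightarrow> int fps" where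
  "h_star M P = (1 - fps_X) ^ (nat (aff_dim P) + 1) * ehrhart_series M P"

definition lattice_degree :: "'a::euclidean_space set \<Rightarrow> 'a set \<Rightarrow> nat" where
  "lattice_degree M P = Max {i. fps_nth (h_star M P) i \<noteq> 0}"

text \<open>
  An affine lattice isomorphism between \<open>affine hull P \<inter> M\<close> and
  \<open>affine hull P' \<inter> M'\<close> is represented by its real affine extension to
  \<open>affine hull P\<close>; outside of it \<open>f\<close> is irrelevant.
\<close>

definition lattice_iso ::
  "'a::real_vector set \<Rightarrow> 'a set \<Rightarrow> 'b::real_vector set \<Rightarrow> 'b set \<Rightarrow> ('a \<Rightarrow> 'b) \<Rightarrow> bool" where
  "lattice_iso M P M' P' f \<longleftrightarrow>
     (\<exists>g c. linear g \<and> (\<forall>x\<in>affine hull P. f x = g x + c)) \<and>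
     bij_betw f (affine hull P \<inter> M) (affine hull P' \<inter> M') \<and>
     f ` vertices P = vertices P'"

text \<open>
  Standard pyramids involve varying dimensions, so all the standard spaces are taken inside
  the finitely supported real sequences: \<open>k\<close>-dimensional space consists of the sequences
  supported on \<open>{..<k}\<close>, and the new coordinate of a pyramid has index \<open>k\<close>.
\<close>

type_synonym vec = "nat \<Rightarrow>\<^sub>0 real"

definition int_lattice :: "nat \<Rightarrow> vec set" where
  "int_lattice k = {x. Poly_Mapping.keys x \<subseteq> {..<k} \<and> (\<forall>i. Poly_Mapping.lookup x i \<in> \<int>)}"

definition std_pyramid :: "nat \<Rightarrow> vec set \<Rightarrow> vec set" where
  "std_pyramid k B = convex hull ({0} \<union> (\<lambda>x. x + Poly_Mapping.single k 1) ` B)"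

primrec iterated_pyramid :: "nat \<Rightarrow> nat \<Rightarrow> vec set \<Rightarrow> vec set" where
  "iterated_pyramid k 0 B = B"
| "iterated_pyramid k (Suc l) B = std_pyramid (k + l) (iterated_pyramid k l B)"

text \<open>The copy of \<open>B\<close> in its \<open>l\<close>-fold pyramid, namely \<open>B \<times> {(1, \<dots>, 1)}\<close>.\<close>

definition base_copy :: "nat \<Rightarrow> nat \<Rightarrow> vec set \<Rightarrow> vec set" where
  "base_copy k l B = (\<lambda>x. x + (\<Sum>i<l. Poly_Mapping.single (k + i) 1)) ` B"

text \<open>
  For \<open>Q = {}\<close> this forces \<open>B = {}\<close>, whose standard pyramid is the single lattice point
  \<open>{0}\<close>; so a single lattice point is a lattice pyramid over the empty set.
\<close>

definition lattice_pyramid :: "'a::euclidean_space set \<Rightarrow> 'a set \<Rightarrow> 'a set \<Rightarrow> bool" where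
  "lattice_pyramid M P Q \<longleftrightarrow>
     lattice_polytope M P \<and> lattice_polytope M Q \<and> Q \<subseteq> P \<and>
     (\<exists>k B f. let l = nat (aff_dim P - aff_dim Q) in
        lattice_polytope (int_lattice k) B \<and>
        lattice_iso M P (int_lattice (k + l)) (iterated_pyramid k l B) f \<and>
        f ` Q = base_copy k l B)"

end

theory Submission
  imports Defs
begin

text \<open>
  Choose \<open>n + 1\<close> affinely independent vertices \<open>S\<close> of \<open>P\<close> and triangulate \<open>P\<close>, with \<open>S\<close> among the
  simplices, using all the vertices.  Decomposing the cone over \<open>P\<close> into half-open simplicial cones
  shows that \<open>h\<^sup>*\<^sub>i\<close> counts the lattice points of height \<open>i\<close> in the half-open fundamental
  parallelepipeds, and counting lattice points in dilates bounds their total number by \<open>V\<close>.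
  The parallelepiped of \<open>S\<close> contributes the group \<open>G\<close> of lattice points modulo \<open>S\<close>, and every
  vertex of \<open>P\<close> outside \<open>S\<close> is itself such a point; hence \<open>|G| - 1 + m \<le> V - 1\<close> for the number
  \<open>m\<close> of these vertices.

  A nonzero element of \<open>G\<close> and its inverse both have height at most \<open>d\<close>, so its barycentric support
  has at most \<open>2 d\<close> elements.  An interior lattice point of \<open>k P\<close> forces \<open>d \<ge> n + 1 - k\<close>; applied
  to the two sides of the affine relation between \<open>S\<close> and a further vertex, this shows that at
  most \<open>2 d + 1\<close> elements of \<open>S\<close> occur in the relation.  Altogether at most
  \<open>(V - 1) (2 d + 1) < n + 1\<close> elements of \<open>S\<close> occur in any of these supports, and one that does not
  occur is an apex.
\<close>

section \<open>Triangulations of cones by linear programming\<close>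

text \<open>The triangulation is never built geometrically. Weights \<omega> on the vertices turn it
  into a linear program: a cell is a basis whose reduced costs are all strictly positive, so weak
  duality separates the cells, and a pivot step of the simplex method finds the cell of a generic
  point. Weights that are zero on \<open>S\<close> and positive elsewhere make \<open>S\<close> a
  cell. Faces shared by several cells are assigned by a generic direction \<open>q\<close>. Choosing
  \<open>q\<close> inside the cone over \<open>S\<close> gives the origin to \<open>S\<close> and
  makes the box of \<open>S\<close> the standard one, with coordinates in \<open>[0, 1)\<close>,
  which is a system of representatives of \<open>G\<close>. The bound on interior points comes from
  using the same decomposition with \<open>- q\<close>. In the relation of a further vertex the two
  sides contain at most \<open>d\<close> and \<open>d + 1\<close> members of \<open>S\<close>; the
  extra one is paid for by the height of the vertex itself. The volume is compared from one side: a
  closed set at which ever finer cubes accumulate has at least their limiting measure.\<close>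

lemma pos_avoiding_linear_forms:
  fixes C :: "('i \<Rightarrow> real) set"
  assumes "finite I" "finite C" "\<And>c. c \<in> C \<Longrightarrow> \<exists>i\<in>I. c i \<noteq> 0"
  shows "\<exists>v. (\<forall>i. v i > 0) \<and> (\<forall>c\<in>C. (\<Sum>i\<in>I. c i * v i) \<noteq> 0)"
  using assms(2,3)
proof (induction C)
  case empty
  show ?case by (intro exI[of _ "\<lambda>_. 1"]) auto
next
  case (insert c C)
  then obtain v where v: "\<And>i. v i > 0" "\<And>c. c \<in> C \<Longrightarrow> (\<Sum>i\<in>I. c i * v i) \<noteq> 0"
    by auto
  obtain i where i: "i \<in> I" "c i \<noteq> 0"
    using insert.prems by blast
  \<comment> \<open>Raising coordinate \<open>i\<close> by \<open>t\<close> changes exactly the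
    forms with nonzero \<open>c' i\<close>, and each of these excludes a single value of
    \<open>t\<close>. For the others, division by zero merely puts the harmless value 0 into
    \<open>bad\<close>.\<close>
  define bad where "bad = (\<lambda>c'. - (\<Sum>j\<in>I. c' j * v j) / c' i) ` insert c C"
  have "finite bad"
    using insert.hyps by (simp add: bad_def)
  then have "infinite ({0<..} - bad)"
    by (simp add: infinite_Ioi)
  then obtain t where t: "t > 0" "t \<notin> bad"
    by (metis Diff_iff finite.emptyI equals0I greaterThan_iff)
  define w where "w = (\<lambda>j. v j + (if j = i then t else 0))"
  have w: "(\<Sum>j\<in>I. c' j * w j) = (\<Sum>j\<in>I. c' j * v j) + t * c' i" for c'
    using i(1) \<open>finite I\<close>
    by (simp add: w_def distrib_left sum.distrib if_distrib[of "\<lambda>x. _ * x"] sum.delta cong: if_cong)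
  have "(\<Sum>j\<in>I. c' j * w j) \<noteq> 0" if c': "c' \<in> insert c C" for c'
  proof (cases "c' i = 0")
    case True
    with i c' have "c' \<in> C" by auto
    with True show ?thesis using v(2) by (simp add: w)
  next
    case False
    have "t \<noteq> - (\<Sum>j\<in>I. c' j * v j) / c' i"
      using t(2) c' by (auto simp: bad_def)
    with False show ?thesis
      by (simp add: w field_simps)
  qed
  moreover have "w j > 0" for j
    using v(1)[of j] t(1) by (auto simp: w_def)
  ultimately show ?case by blast
qed

definition bases :: "'e::real_vector set \<Rightarrow> 'e set set" where
  "bases A = {B. B \<subseteq> A \<and> independent B \<and> span B = span A}"

definition cone_of :: "'e::real_vector set \<Rightarrow> 'e set" where
  "cone_of A = {\<Sum>a\<in>A. c a *\<^sub>R a | c. \<forall>a\<in>A. c a \<ge> (0::real)}"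

text \<open>\<open>h\<close> is the height in the cone over a polytope. It makes the cone pointed
  and forces the coefficients of every linear relation on \<open>A\<close> to sum to zero, which
  supplies the positive coefficient that the exchange arguments divide by.\<close>

locale point_config =
  fixes A :: "'e::real_vector set" and h :: "'e \<Rightarrow> real"
  assumes finite_A: "finite A"
    and linear_h: "linear h"
    and h_A: "a \<in> A \<Longrightarrow> h a = 1"
begin

abbreviation coord :: "'e set \<Rightarrow> 'e \<Rightarrow> 'e \<Rightarrow> real" where
  "coord \<equiv> representation"

lemma finite_bases: "finite (bases A)"
  by (rule finite_subset[of _ "Pow A"]) (auto simp: bases_def finite_A)

lemma basesD:
  assumes "B \<in> bases A"
  shows "B \<subseteq> A" "independent B" "span B = span A" "finite B"
  using assms finite_A by (auto simp: bases_def intro: finite_subset)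

lemma sum_coord:
  assumes "B \<in> bases A" "x \<in> span A"
  shows "(\<Sum>b\<in>B. coord B x b *\<^sub>R b) = x"
  using basesD[OF assms(1)] assms(2) by (intro real_vector.sum_representation_eq) auto

lemma coord_sum:
  assumes B: "B \<in> bases A" and b: "b \<in> B"
  shows "coord B (\<Sum>b\<in>B. c b *\<^sub>R b) b = c b"
proof -
  have "representation B (\<Sum>b\<in>B. c b *\<^sub>R b) = (\<lambda>b. if b \<in> B then c b else 0)"
  proof (rule real_vector.representation_eqI)
    show "(\<Sum>b\<in>B. c b *\<^sub>R b) \<in> span B"
      by (intro span_sum span_scale span_base)
    show "finite {b. (if b \<in> B then c b else 0) \<noteq> 0}"
      using basesD(4)[OF B] by simp
    have "(\<Sum>b | (if b \<in> B then c b else 0) \<noteq> 0. (if b \<in> B then c b else 0) *\<^sub>R b) = (\<Sum>b\<in>B. c b *\<^sub>R b)"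
      using basesD(4)[OF B] by (intro sum.mono_neutral_cong_left) (auto split: if_splits)
    then show "(\<Sum>b | (if b \<in> B then c b else 0) \<noteq> 0. (if b \<in> B then c b else 0) *\<^sub>R b) = (\<Sum>b\<in>B. c b *\<^sub>R b)" .
  qed (use basesD[OF B] in \<open>auto split: if_splits\<close>)
  then show ?thesis using b by simp
qed

lemma coord_add:
  assumes "B \<in> bases A" "x \<in> span A" "y \<in> span A"
  shows "coord B (x + y) b = coord B x b + coord B y b"
  using basesD[OF assms(1)] assms(2,3) by (subst representation_add) auto

lemma coord_diff:
  assumes "B \<in> bases A" "x \<in> span A" "y \<in> span A"
  shows "coord B (x - y) b = coord B x b - coord B y b"
  using basesD[OF assms(1)] assms(2,3) by (subst representation_diff) auto

lemma coord_neg: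
  assumes "B \<in> bases A" "x \<in> span A"
  shows "coord B (- x) b = - coord B x b"
  using basesD[OF assms(1)] assms(2) by (subst representation_neg) auto

lemma coord_scale:
  assumes "B \<in> bases A" "x \<in> span A"
  shows "coord B (r *\<^sub>R x) b = r * coord B x b"
  using basesD[OF assms(1)] assms(2) by (subst representation_scale) auto

lemma coord_sum_fun:
  assumes "B \<in> bases A" "\<And>i. i \<in> I \<Longrightarrow> f i \<in> span A"
  shows "coord B (\<Sum>i\<in>I. f i) b = (\<Sum>i\<in>I. coord B (f i) b)"
  using basesD[OF assms(1)] assms(2) by (subst representation_sum) auto

lemma coord_basis:
  assumes "B \<in> bases A" "c \<in> B"
  shows "coord B c b = (if b = c then 1 else 0)"
  using basesD[OF assms(1)] assms(2) by (subst representation_basis) auto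

lemma h_sum: "B \<subseteq> A \<Longrightarrow> h (\<Sum>b\<in>B. c b *\<^sub>R b) = (\<Sum>b\<in>B. c b)"
  using h_A by (auto simp: linear_sum[OF linear_h] linear_cmul[OF linear_h] intro!: sum.cong)

lemma h_eq_sum_coord:
  assumes "B \<in> bases A" "x \<in> span A"
  shows "h x = (\<Sum>b\<in>B. coord B x b)"
  using h_sum[OF basesD(1)[OF assms(1)], of "coord B x"] sum_coord[OF assms] by simp

lemma bases_subset_eq:
  assumes "B \<in> bases A" "B' \<in> bases A" "B \<subseteq> B'"
  shows "B = B'"
proof (rule ccontr)
  assume "B \<noteq> B'"
  with assms(3) obtain b where b: "b \<in> B'" "b \<notin> B" by blast
  have "b \<in> span B"
    using b basesD[OF assms(1)] basesD[OF assms(2)] span_base by blast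
  also have "span B \<subseteq> span (B' - {b})"
    using assms(3) b by (intro span_mono) auto
  finally show False
    using b basesD(2)[OF assms(2)] by (auto simp: dependent_def)
qed

lemma cone_of_subset_span: "cone_of A \<subseteq> span A"
  unfolding cone_of_def by (blast intro: span_sum span_scale span_base)

lemma cone_of_subset_sum:
  assumes "B \<subseteq> A" "\<And>b. b \<in> B \<Longrightarrow> c b \<ge> 0"
  shows "(\<Sum>b\<in>B. c b *\<^sub>R b) \<in> cone_of A"
proof -
  have "(\<Sum>b\<in>B. c b *\<^sub>R b) = (\<Sum>a\<in>A. (if a \<in> B then c a else 0) *\<^sub>R a)"
    using assms(1) finite_A by (intro sum.mono_neutral_cong_left) auto
  then show ?thesis
    using assms(2) unfolding cone_of_def mem_Collect_eq by (intro exI[of _ "\<lambda>a. if a \<in> B then c a else 0"]) auto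
qed

lemma cone_of_add:
  assumes "x \<in> cone_of A" "y \<in> cone_of A"
  shows "x + y \<in> cone_of A"
proof -
  obtain c d where "x = (\<Sum>a\<in>A. c a *\<^sub>R a)" "y = (\<Sum>a\<in>A. d a *\<^sub>R a)"
    "\<forall>a\<in>A. c a \<ge> 0" "\<forall>a\<in>A. d a \<ge> (0::real)"
    using assms by (auto simp: cone_of_def)
  then show ?thesis unfolding cone_of_def mem_Collect_eq
    by (intro exI[of _ "\<lambda>a. c a + d a"]) (auto simp: sum.distrib scaleR_add_left)
qed

lemma h_cone_nonneg: "x \<in> cone_of A \<Longrightarrow> h x \<ge> 0"
  by (auto simp: cone_of_def h_sum intro!: sum_nonneg)

text \<open>Conic Caratheodory: a relation among the support of a shortest representation would shorten it.\<close>

lemma cone_of_independent: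
  assumes "y \<in> cone_of A"
  shows "\<exists>S c. S \<subseteq> A \<and> independent S \<and> (\<forall>s\<in>S. c s \<ge> 0) \<and> y = (\<Sum>s\<in>S. c s *\<^sub>R s)"
proof -
  define R where "R S \<longleftrightarrow> S \<subseteq> A \<and> (\<exists>c. (\<forall>s\<in>S. c s \<ge> (0::real)) \<and> y = (\<Sum>s\<in>S. c s *\<^sub>R s))" for S
  have "R A"
    using assms by (auto simp: R_def cone_of_def)
  then obtain S where S: "R S" and min: "\<And>S'. R S' \<Longrightarrow> card S \<le> card S'"
    using ex_has_least_nat[of R A card] by blast
  obtain c where c: "S \<subseteq> A" "\<And>s. s \<in> S \<Longrightarrow> c s \<ge> 0" "y = (\<Sum>s\<in>S. c s *\<^sub>R s)"
    using S by (auto simp: R_def)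
  have finS: "finite S"
    using c(1) finite_A finite_subset by blast
  have "independent S"
  proof
    assume "dependent S"
    then obtain u v where u: "(\<Sum>s\<in>S. u s *\<^sub>R s) = 0" "v \<in> S" "u v \<noteq> 0"
      using dependent_finite[OF finS] by auto
    have "h (\<Sum>s\<in>S. u s *\<^sub>R s) = 0"
      using u(1) linear_0[OF linear_h] by simp
    then have "(\<Sum>s\<in>S. u s) = 0"
      using h_sum[OF c(1)] by simp
    then have "\<exists>s\<in>S. u s > 0"
      using u(2,3) finS sum_nonneg_eq_0_iff[of S "\<lambda>s. - u s"]
      by (force simp: sum_negf linorder_not_less)
    define P where "P = {s\<in>S. u s > 0}"
    define t where "t = Min ((\<lambda>s. c s / u s) ` P)"
    have P: "finite P" "P \<noteq> {}"
      using finS \<open>\<exists>s\<in>S. u s > 0\<close> by (auto simp: P_def)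
    then have "t \<in> (\<lambda>s. c s / u s) ` P"
      unfolding t_def by (intro Min_in) auto
    then obtain r where r: "r \<in> P" "t = c r / u r"
      by blast
    have tle: "t \<le> c s / u s" if "s \<in> P" for s
      using P that by (auto simp: t_def)
    have "t \<ge> 0"
      using r c(2) by (auto simp: P_def)
    define c' where "c' s = c s - t * u s" for s
    have "c' s \<ge> 0" if "s \<in> S" for s
    proof (cases "u s > 0")
      case True
      then show ?thesis using tle[of s] that by (auto simp: P_def c'_def field_simps)
    next
      case False
      then have "t * u s \<le> 0" using \<open>t \<ge> 0\<close> by (simp add: mult_nonneg_nonpos)
      then show ?thesis using c(2)[OF that] by (simp add: c'_def)
    qed
    moreover have "y = (\<Sum>s\<in>S - {r}. c' s *\<^sub>R s)"
    proof -
      have "c' r = 0" using r by (auto simp: c'_def P_def)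
      then have "(\<Sum>s\<in>S - {r}. c' s *\<^sub>R s) = (\<Sum>s\<in>S. c' s *\<^sub>R s)"
        using finS by (intro sum.mono_neutral_left) auto
      also have "\<dots> = y - t *\<^sub>R (\<Sum>s\<in>S. u s *\<^sub>R s)"
        by (simp add: c'_def c(3) scaleR_diff_left sum_subtractf scaleR_sum_right)
      finally show ?thesis using u(1) by simp
    qed
    ultimately have "R (S - {r})"
      using c(1) unfolding R_def by (intro conjI exI[of _ c']) auto
    moreover have "card (S - {r}) < card S"
      using r finS by (simp add: P_def card_Diff1_less del: card_Diff_insert card_Diff_singleton)
    ultimately show False using min by fastforce
  qed
  with c show ?thesis by blast
qed

text \<open>
  Simplicial cones are the optimal bases of the linear program minimising
  \<open>\<Sum>\<omega> a * c a\<close> over all nonnegative representations \<open>y = \<Sum>c a *\<^sub>R a\<close>;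
  the genericity of \<open>\<omega>\<close> makes the optimal basis unique.
\<close>

definition height_ext :: "('e \<Rightarrow> real) \<Rightarrow> 'e set \<Rightarrow> 'e \<Rightarrow> real" where
  "height_ext \<omega> B x = (\<Sum>b\<in>B. coord B x b * \<omega> b)"

definition optimal_bases :: "('e \<Rightarrow> real) \<Rightarrow> 'e set set" where
  "optimal_bases \<omega> = {B \<in> bases A. \<forall>a\<in>A - B. height_ext \<omega> B a < \<omega> a}"

definition in_general_position :: "'e \<Rightarrow> bool" where
  "in_general_position y \<longleftrightarrow> y \<in> span A \<and> (\<forall>B\<in>bases A. \<forall>b\<in>B. coord B y b \<noteq> 0)"

lemma height_ext_sum:
  assumes "B \<in> bases A" "\<And>i. i \<in> I \<Longrightarrow> f i \<in> span A"
  shows "height_ext \<omega> B (\<Sum>i\<in>I. c i *\<^sub>R f i) = (\<Sum>i\<in>I. c i * height_ext \<omega> B (f i))"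
proof -
  have "height_ext \<omega> B (\<Sum>i\<in>I. c i *\<^sub>R f i) = (\<Sum>b\<in>B. \<Sum>i\<in>I. c i * coord B (f i) b * \<omega> b)"
    using assms by (simp add: height_ext_def coord_sum_fun span_scale coord_scale sum_distrib_right)
  also have "\<dots> = (\<Sum>i\<in>I. \<Sum>b\<in>B. c i * coord B (f i) b * \<omega> b)"
    by (rule sum.swap)
  finally show ?thesis
    by (simp add: height_ext_def sum_distrib_left mult.assoc)
qed

lemma height_ext_basis: "B \<in> bases A \<Longrightarrow> b \<in> B \<Longrightarrow> height_ext \<omega> B b = \<omega> b"
  using basesD(4)[of B]
  by (simp add: height_ext_def coord_basis if_distrib[of "\<lambda>x. x * _"] cong: if_cong)

text \<open>Weak duality. \<open>height_ext \<omega> B\<close> is a linear lower bound for \<omega>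
  on \<open>A\<close>, strict off \<open>B\<close>. At a point inside both cones, two different
  bases would each have a strictly smaller objective value than the other.\<close>

lemma optimal_bases_unique:
  assumes B: "B \<in> optimal_bases \<omega>" and B': "B' \<in> optimal_bases \<omega>" and y: "y \<in> span A"
    and pos: "\<And>b. b \<in> B \<Longrightarrow> coord B y b > 0" and pos': "\<And>b. b \<in> B' \<Longrightarrow> coord B' y b > 0"
  shows "B = B'"
proof (rule ccontr)
  assume ne: "B \<noteq> B'"
  have less: "height_ext \<omega> C y < height_ext \<omega> C' y"
    if C: "C \<in> optimal_bases \<omega>" "C' \<in> optimal_bases \<omega>" "C \<noteq> C'" "\<And>b. b \<in> C' \<Longrightarrow> coord C' y b > 0" for C C'
  proof -
    have CB: "C \<in> bases A" "C' \<in> bases A"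
      using C(1,2) by (auto simp: optimal_bases_def)
    then obtain c where c: "c \<in> C'" "c \<notin> C"
      using bases_subset_eq C(3) by blast
    have "height_ext \<omega> C y = height_ext \<omega> C (\<Sum>b\<in>C'. coord C' y b *\<^sub>R b)"
      using sum_coord[OF CB(2) y] by simp
    also have "\<dots> = (\<Sum>b\<in>C'. coord C' y b * height_ext \<omega> C b)"
      using CB basesD(1)[OF CB(2)] by (intro height_ext_sum) (auto intro: span_base)
    also have "\<dots> < (\<Sum>b\<in>C'. coord C' y b * \<omega> b)"
    proof (rule sum_strict_mono_ex1)
      show "finite C'" using basesD(4) CB by blast
      have le: "height_ext \<omega> C b \<le> \<omega> b" if "b \<in> C'" for b
        using height_ext_basis[OF CB(1), of b \<omega>] C(1) that basesD(1)[OF CB(2)]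
        by (cases "b \<in> C") (auto simp: optimal_bases_def intro: less_imp_le)
      show "\<forall>b\<in>C'. coord C' y b * height_ext \<omega> C b \<le> coord C' y b * \<omega> b"
        using le C(4) by (auto intro!: mult_left_mono less_imp_le[OF C(4)])
      have "height_ext \<omega> C c < \<omega> c"
        using c C(1) basesD(1)[OF CB(2)] by (auto simp: optimal_bases_def)
      then show "\<exists>b\<in>C'. coord C' y b * height_ext \<omega> C b < coord C' y b * \<omega> b"
        using c(1) C(4) by auto
    qed
    finally show ?thesis by (simp add: height_ext_def)
  qed
  from less[OF B B' ne pos'] less[OF B' B ne[symmetric] pos] show False by simp
qed

text \<open>Simplex method: a feasible basis of least objective value is optimal, since a vector
  violating optimality could enter it and lower the value. General position of \<open>y\<close>
  keeps all basic coordinates nonzero, so no pivot is degenerate.\<close>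

lemma optimal_bases_exists:
  assumes generic: "\<And>B a. B \<in> bases A \<Longrightarrow> a \<in> A - B \<Longrightarrow> height_ext \<omega> B a \<noteq> \<omega> a"
    and y: "y \<in> cone_of A" "in_general_position y"
  shows "\<exists>B\<in>optimal_bases \<omega>. \<forall>b\<in>B. coord B y b > 0"
proof -
  define F where "F = {B\<in>bases A. \<forall>b\<in>B. coord B y b > 0}"
  \<comment> \<open>Conic Caratheodory gives an independent set carrying \<open>y\<close>. In a
    basis containing it the coordinates are nonnegative, and general position makes them
    positive.\<close>
  have "F \<noteq> {}"
  proof -
    obtain S c where S: "S \<subseteq> A" "independent S" "\<forall>s\<in>S. c s \<ge> 0" "y = (\<Sum>s\<in>S. c s *\<^sub>R s)"
      using cone_of_independent[OF y(1)] by blast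
    obtain B where B: "S \<subseteq> B" "B \<subseteq> A" "independent B" "A \<subseteq> span B"
      using maximal_independent_subset_extend[OF S(1,2)] by blast
    have "span B = span A"
      using B(2,4) by (metis span_mono span_span subset_antisym)
    with B have BB: "B \<in> bases A" by (auto simp: bases_def)
    have yB: "y = (\<Sum>b\<in>B. (if b \<in> S then c b else 0) *\<^sub>R b)"
      unfolding S(4) using B(1) basesD(4)[OF BB] by (intro sum.mono_neutral_cong_left) auto
    have "coord B y b > 0" if "b \<in> B" for b
    proof -
      have "coord B y b = (if b \<in> S then c b else 0)"
        unfolding yB by (rule coord_sum[OF BB that])
      moreover have "coord B y b \<noteq> 0"
        using y(2) BB that by (auto simp: in_general_position_def)
      ultimately show ?thesis
        using S(3) by (auto simp: less_le split: if_splits)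
    qed
    with BB show ?thesis by (auto simp: F_def)
  qed
  moreover have "finite F"
    unfolding F_def using finite_bases by simp
  ultimately obtain B where B: "B \<in> F" and min: "\<And>B'. B' \<in> F \<Longrightarrow> height_ext \<omega> B y \<le> height_ext \<omega> B' y"
    using ex_min_if_finite[of "(\<lambda>B. height_ext \<omega> B y) ` F"] by fastforce
  have BB: "B \<in> bases A" and pos: "\<And>b. b \<in> B \<Longrightarrow> coord B y b > 0"
    using B by (auto simp: F_def)
  have finB: "finite B" using basesD(4)[OF BB] .
  have yspan: "y \<in> span A" using y(2) by (auto simp: in_general_position_def)
  have "height_ext \<omega> B a < \<omega> a" if a: "a \<in> A - B" for a
  proof (rule ccontr)
    assume "\<not> height_ext \<omega> B a < \<omega> a"
    with generic[OF BB a] have gt: "\<omega> a < height_ext \<omega> B a" by simp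
    define \<alpha> where "\<alpha> = coord B a"
    have aspan: "a \<in> span A" using a by (auto intro: span_base)
    have asum: "a = (\<Sum>b\<in>B. \<alpha> b *\<^sub>R b)" using sum_coord[OF BB aspan] by (simp add: \<alpha>_def)
    \<comment> \<open>Heights are 1 on \<open>A\<close>, so the entering vector has coordinates of
      positive sum and the ratio test below has a candidate.\<close>
    have "(\<Sum>b\<in>B. \<alpha> b) = 1"
      using h_eq_sum_coord[OF BB aspan] h_A[of a] a by (simp add: \<alpha>_def)
    then have "\<exists>b\<in>B. \<alpha> b > 0"
      by (metis linorder_not_less sum_nonpos zero_less_one)
    define P where "P = {b\<in>B. \<alpha> b > 0}"
    have P: "finite P" "P \<noteq> {}"
      using finB \<open>\<exists>b\<in>B. \<alpha> b > 0\<close> by (auto simp: P_def)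
    \<comment> \<open>Ratio test: \<open>t\<close> is the largest multiple of \<open>a\<close> that
      can be subtracted from \<open>y\<close> while its coordinates over \<open>B\<close> stay
      nonnegative; \<open>r\<close> is the vector that leaves the basis.\<close>
    define t where "t = Min ((\<lambda>b. coord B y b / \<alpha> b) ` P)"
    have "t \<in> (\<lambda>b. coord B y b / \<alpha> b) ` P"
      unfolding t_def using P by (intro Min_in) auto
    then obtain r where r: "r \<in> P" "t = coord B y r / \<alpha> r" by blast
    have tle: "t \<le> coord B y b / \<alpha> b" if "b \<in> P" for b
      using P that by (auto simp: t_def)
    have rB: "r \<in> B" "\<alpha> r > 0" using r(1) by (auto simp: P_def)
    have "t > 0" using r(2) rB pos by simp
    define c where "c b = coord B y b - t * \<alpha> b" for b
    have cnn: "c b \<ge> 0" if "b \<in> B" for b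
    proof (cases "\<alpha> b > 0")
      case True
      then show ?thesis using tle[of b] that by (auto simp: P_def c_def field_simps)
    next
      case False
      then have "t * \<alpha> b \<le> 0" using \<open>t > 0\<close> by (simp add: mult_nonneg_nonpos)
      then show ?thesis using pos[OF that] by (simp add: c_def)
    qed
    have cr: "c r = 0" using r(2) rB by (simp add: c_def)
    have ysum: "y = t *\<^sub>R a + (\<Sum>b\<in>B - {r}. c b *\<^sub>R b)"
    proof -
      have "(\<Sum>b\<in>B - {r}. c b *\<^sub>R b) = (\<Sum>b\<in>B. c b *\<^sub>R b)"
        using finB cr by (intro sum.mono_neutral_left) auto
      also have "\<dots> = (\<Sum>b\<in>B. coord B y b *\<^sub>R b) - t *\<^sub>R (\<Sum>b\<in>B. \<alpha> b *\<^sub>R b)"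
        by (simp add: c_def scaleR_diff_left sum_subtractf scaleR_sum_right)
      finally show ?thesis using sum_coord[OF BB yspan] asum by simp
    qed
    define B' where "B' = insert a (B - {r})"
    have BB': "B' \<in> bases A"
    proof -
      have notin: "a \<notin> span (B - {r})"
      proof
        assume "a \<in> span (B - {r})"
        then obtain u where "a = (\<Sum>b\<in>B - {r}. u b *\<^sub>R b)"
          using finB by (auto simp: span_finite)
        also have "\<dots> = (\<Sum>b\<in>B. (if b = r then 0 else u b) *\<^sub>R b)"
          using finB by (intro sum.mono_neutral_cong_left) auto
        finally have a: "a = (\<Sum>b\<in>B. (if b = r then 0 else u b) *\<^sub>R b)" .
        have "\<alpha> r = (if r = r then 0 else u r)"
          unfolding \<alpha>_def by (subst a, rule coord_sum[OF BB rB(1)])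
        with rB show False by simp
      qed
      have indep: "independent B'"
        unfolding B'_def using notin basesD(2)[OF BB]
        by (meson Diff_subset independent_insertI independent_mono)
      have "r \<in> span B'"
      proof -
        have "a = \<alpha> r *\<^sub>R r + (\<Sum>b\<in>B - {r}. \<alpha> b *\<^sub>R b)"
          using asum finB rB(1) by (simp add: sum.remove)
        then have "r = (1 / \<alpha> r) *\<^sub>R (a - (\<Sum>b\<in>B - {r}. \<alpha> b *\<^sub>R b))"
          using rB by simp
        also have "\<dots> \<in> span B'"
          unfolding B'_def by (intro span_scale span_diff span_sum) (auto intro: span_base)
        finally show ?thesis .
      qed
      then have "B \<subseteq> span B'"
        by (auto simp: B'_def intro: span_base)
      then have "span B \<subseteq> span B'"
        by (simp add: span_minimal)
      moreover have "B' \<subseteq> A" using a basesD(1)[OF BB] by (auto simp: B'_def)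
      ultimately show ?thesis
        using indep basesD(3)[OF BB] span_mono[of B' A] by (auto simp: bases_def)
    qed
    have anot: "a \<notin> B - {r}" using a by auto
    have ysum': "y = (\<Sum>b\<in>B'. (if b = a then t else c b) *\<^sub>R b)"
    proof -
      have "(\<Sum>b\<in>B - {r}. (if b = a then t else c b) *\<^sub>R b) = (\<Sum>b\<in>B - {r}. c b *\<^sub>R b)"
        using anot by (intro sum.cong) auto
      then show ?thesis
        using anot finB by (simp add: B'_def ysum)
    qed
    have "coord B' y b > 0" if "b \<in> B'" for b
    proof -
      have "coord B' y b = (if b = a then t else c b)"
        unfolding ysum' by (rule coord_sum[OF BB' that])
      moreover have "coord B' y b \<noteq> 0"
        using y(2) BB' that by (auto simp: in_general_position_def)
      ultimately show ?thesis
        using \<open>t > 0\<close> cnn[of b] that by (auto simp: B'_def less_le split: if_splits)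
    qed
    with BB' have "B' \<in> F" by (auto simp: F_def)
    moreover have "height_ext \<omega> B' y < height_ext \<omega> B y"
    proof -
      have "height_ext \<omega> B' y = (\<Sum>b\<in>B'. (if b = a then t else c b) * height_ext \<omega> B' b)"
        unfolding ysum' by (rule height_ext_sum[OF BB']) (use basesD(1)[OF BB'] in \<open>auto intro: span_base\<close>)
      also have "\<dots> = (\<Sum>b\<in>B'. (if b = a then t else c b) * \<omega> b)"
        using height_ext_basis[OF BB'] by simp
      also have "\<dots> = t * \<omega> a + (\<Sum>b\<in>B - {r}. c b * \<omega> b)"
      proof -
        have "(\<Sum>b\<in>B - {r}. (if b = a then t else c b) * \<omega> b) = (\<Sum>b\<in>B - {r}. c b * \<omega> b)"
          using anot by (intro sum.cong) auto
        then show ?thesis using anot finB by (simp add: B'_def)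
      qed
      also have "(\<Sum>b\<in>B - {r}. c b * \<omega> b) = (\<Sum>b\<in>B. c b * \<omega> b)"
        using finB cr by (intro sum.mono_neutral_left) auto
      also have "\<dots> = height_ext \<omega> B y - t * height_ext \<omega> B a"
        by (simp add: c_def height_ext_def \<alpha>_def left_diff_distrib sum_subtractf sum_distrib_left mult.assoc)
      \<comment> \<open>The objective changes by \<open>t\<close> times the reduced cost of
        \<open>a\<close>, which is negative.\<close>
      finally have "height_ext \<omega> B' y = height_ext \<omega> B y - t * (height_ext \<omega> B a - \<omega> a)"
        by (simp add: algebra_simps)
      moreover have "t * (height_ext \<omega> B a - \<omega> a) > 0"
        using \<open>t > 0\<close> gt by simp
      ultimately show ?thesis by linarith
    qed
    ultimately show False using min by fastforce
  qed
  with BB pos show ?thesis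
    by (auto simp: optimal_bases_def)
qed

text \<open>If \<omega> vanishes on \<open>S\<close>, so does its linear extension from
  \<open>S\<close>, and positive weights elsewhere make \<open>S\<close> optimal. Genericity means
  avoiding finitely many circuit forms. None of them is supported in the independent set
  \<open>S\<close>, so the weights off \<open>S\<close> can be chosen to avoid them all.\<close>

lemma generic_heights:
  assumes S: "S \<in> bases A"
  shows "\<exists>\<omega>. S \<in> optimal_bases \<omega> \<and> (\<forall>B\<in>bases A. \<forall>a\<in>A - B. height_ext \<omega> B a \<noteq> \<omega> a)"
proof -
  \<comment> \<open>The circuit of \<open>a\<close> over \<open>B\<close>: evaluated at \<omega> it
    gives \<open>\<omega> a - height_ext \<omega> B a\<close>.\<close>
  define crc where "crc B a i = (if i = a then 1 else if i \<in> B then - coord B a i else 0)" for B a i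
  define C where "C = (\<lambda>(B, a). crc B a) ` (SIGMA B:bases A. A - B)"
  have "finite C"
    unfolding C_def using finite_bases finite_A by (intro finite_imageI finite_SigmaI) auto
  moreover have "\<exists>i\<in>A - S. c i \<noteq> 0" if cC: "c \<in> C" for c
  proof (rule ccontr)
    assume contra: "\<not> (\<exists>i\<in>A - S. c i \<noteq> 0)"
    obtain B a where Ba: "B \<in> bases A" "a \<in> A" "a \<notin> B" "c = crc B a"
      using cC by (auto simp: C_def)
    have "a \<in> S"
      using contra Ba by (force simp: crc_def)
    have "coord B a b = 0" if "b \<in> B - S" for b
    proof -
      have "crc B a b = 0"
        using contra Ba(4) that basesD(1)[OF Ba(1)] by auto
      then show ?thesis using that Ba(3) by (auto simp: crc_def split: if_splits)
    qed
    then have "(\<Sum>b\<in>B \<inter> S. coord B a b *\<^sub>R b) = (\<Sum>b\<in>B. coord B a b *\<^sub>R b)"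
      using basesD(4)[OF Ba(1)] by (intro sum.mono_neutral_left) auto
    then have "a = (\<Sum>b\<in>B \<inter> S. coord B a b *\<^sub>R b)"
      using sum_coord[OF Ba(1) span_base[OF Ba(2)]] by simp
    also have "\<dots> \<in> span (S - {a})"
      using Ba(3) by (intro span_sum span_scale span_base) auto
    finally show False
      using \<open>a \<in> S\<close> basesD(2)[OF S] by (auto simp: dependent_def)
  qed
  ultimately obtain v where v: "\<And>i. v i > 0" "\<And>c. c \<in> C \<Longrightarrow> (\<Sum>i\<in>A - S. c i * v i) \<noteq> 0"
    using pos_avoiding_linear_forms[of "A - S" C] finite_A by auto
  define \<omega> where "\<omega> i = (if i \<in> S then 0 else v i)" for i
  have "height_ext \<omega> B a \<noteq> \<omega> a" if "B \<in> bases A" "a \<in> A - B" for B a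
  proof -
    have "(\<Sum>i\<in>A - S. crc B a i * v i) = (\<Sum>i\<in>A. crc B a i * \<omega> i)"
      using finite_A by (intro sum.mono_neutral_cong_left) (auto simp: \<omega>_def)
    also have "\<dots> = (\<Sum>i\<in>insert a B. crc B a i * \<omega> i)"
      using finite_A that basesD(1)[OF that(1)] by (intro sum.mono_neutral_right) (auto simp: crc_def)
    also have "\<dots> = \<omega> a + (\<Sum>i\<in>B. crc B a i * \<omega> i)"
      using that basesD(4)[OF that(1)] by (simp add: crc_def)
    also have "(\<Sum>i\<in>B. crc B a i * \<omega> i) = - height_ext \<omega> B a"
      unfolding height_ext_def sum_negf[symmetric] using that by (intro sum.cong) (auto simp: crc_def)
    finally show ?thesis
      using v(2)[of "crc B a"] that by (force simp: C_def)
  qed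
  moreover have "S \<in> optimal_bases \<omega>"
    using S v(1) by (auto simp: optimal_bases_def height_ext_def \<omega>_def)
  ultimately show ?thesis by blast
qed

section \<open>Half-open cones in a generic direction\<close>

lemma generic_direction:
  assumes S: "S \<in> bases A"
  shows "\<exists>q. in_general_position q \<and> (\<forall>s\<in>S. coord S q s > 0)"
proof -
  \<comment> \<open>The coordinate functions of all bases, as linear forms in the coordinates over
    \<open>S\<close>. Each is nonzero because it takes the value 1 at its own basis vector.\<close>
  define C where "C = (\<lambda>(B, b) s. coord B s b) ` (SIGMA B:bases A. B)"
  have "finite C"
    unfolding C_def using finite_bases basesD(4) by (intro finite_imageI finite_SigmaI) auto
  have Sspan: "s \<in> span A" if "s \<in> S" for s
    using that basesD(1)[OF S] by (auto intro: span_base)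
  have cS: "coord B x b = (\<Sum>s\<in>S. coord S x s * coord B s b)" if "B \<in> bases A" "x \<in> span A" for B b x
  proof -
    have "coord B x b = coord B (\<Sum>s\<in>S. coord S x s *\<^sub>R s) b"
      using sum_coord[OF S that(2)] by simp
    also have "\<dots> = (\<Sum>s\<in>S. coord S x s * coord B s b)"
      using that Sspan by (subst coord_sum_fun) (auto simp: coord_scale span_scale)
    finally show ?thesis .
  qed
  have "\<exists>s\<in>S. c s \<noteq> 0" if c: "c \<in> C" for c
  proof -
    obtain B b where Bb: "B \<in> bases A" "b \<in> B" "c = (\<lambda>s. coord B s b)"
      using c by (auto simp: C_def)
    have bspan: "b \<in> span A" using Bb basesD(1) by (auto intro: span_base)
    have "(\<Sum>s\<in>S. coord S b s * coord B s b) = 1"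
      using cS[OF Bb(1) bspan, of b] Bb by (simp add: coord_basis)
    then show ?thesis unfolding Bb(3)
      by (metis (no_types, lifting) mult_zero_right sum.neutral zero_neq_one)
  qed
  then obtain v where v: "\<And>i. v i > 0" "\<And>c. c \<in> C \<Longrightarrow> (\<Sum>i\<in>S. c i * v i) \<noteq> 0"
    using pos_avoiding_linear_forms[OF basesD(4)[OF S] \<open>finite C\<close>] by auto
  define q where "q = (\<Sum>s\<in>S. v s *\<^sub>R s)"
  have q: "q \<in> span A"
    unfolding q_def using Sspan by (intro span_sum span_scale) auto
  have coord_q: "coord S q s = v s" if "s \<in> S" for s
    unfolding q_def by (rule coord_sum[OF S that])
  have "coord B q b \<noteq> 0" if "B \<in> bases A" "b \<in> B" for B b
  proof -
    have "coord B q b = (\<Sum>s\<in>S. coord B s b * v s)"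
      using cS[OF that(1) q, of b] coord_q by (simp add: mult.commute)
    moreover have "(\<lambda>s. coord B s b) \<in> C"
      using that by (auto simp: C_def)
    ultimately show ?thesis using v(2) by auto
  qed
  with q coord_q v(1) show ?thesis
    by (auto simp: in_general_position_def intro!: exI[of _ q])
qed

text \<open>The points that an infinitesimal push along \<open>q\<close> moves into the interior of the cone over \<open>B\<close>.\<close>

definition half_open_cone :: "'e \<Rightarrow> 'e set \<Rightarrow> 'e set" where
  "half_open_cone q B = {x \<in> span A. \<forall>b\<in>B. coord B x b > 0 \<or> coord B x b = 0 \<and> coord B q b > 0}"

lemma eventually_coord_sign:
  assumes q: "in_general_position q" and x: "x \<in> span A"
  shows "\<forall>\<^sub>F \<epsilon> in at_right 0. \<forall>B\<in>bases A. \<forall>b\<in>B. coord B (x + \<epsilon> *\<^sub>R q) b \<noteq> 0 \<and>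
    (coord B (x + \<epsilon> *\<^sub>R q) b > 0 \<longleftrightarrow> coord B x b > 0 \<or> coord B x b = 0 \<and> coord B q b > 0)"
proof (intro eventually_ball_finite finite_bases ballI)
  fix B assume B: "B \<in> bases A"
  then show "finite B" by (rule basesD(4))
  fix b assume b: "b \<in> B"
  let ?u = "coord B x b" and ?v = "coord B q b"
  have v: "?v \<noteq> 0" and qs: "q \<in> span A"
    using q B b by (auto simp: in_general_position_def)
  have eq: "coord B (x + \<epsilon> *\<^sub>R q) b = ?u + \<epsilon> * ?v" for \<epsilon>
    using B x qs by (simp add: coord_add coord_scale span_scale)
  have lim: "((\<lambda>\<epsilon>. ?u + \<epsilon> * ?v) \<longlongrightarrow> ?u) (at_right 0)"
    by (rule tendsto_eq_intros refl tendsto_ident_at | simp)+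
  have "\<forall>\<^sub>F \<epsilon> in at_right 0. ?u + \<epsilon> * ?v \<noteq> 0 \<and> (?u + \<epsilon> * ?v > 0 \<longleftrightarrow> ?u > 0 \<or> ?u = 0 \<and> ?v > 0)"
  proof (cases ?u "0::real" rule: linorder_cases)
    case less
    from order_tendstoD(2)[OF lim less] show ?thesis
      by eventually_elim (use less in auto)
  next
    case greater
    from order_tendstoD(1)[OF lim greater] show ?thesis
      by eventually_elim (use greater in auto)
  next
    case equal
    then show ?thesis
      using v by (auto simp: zero_less_mult_iff intro: eventually_mono[OF eventually_at_right_less[of 0]])
  qed
  then show "\<forall>\<^sub>F \<epsilon> in at_right 0. coord B (x + \<epsilon> *\<^sub>R q) b \<noteq> 0 \<and>
    (coord B (x + \<epsilon> *\<^sub>R q) b > 0 \<longleftrightarrow> ?u > 0 \<or> ?u = 0 \<and> ?v > 0)"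
    by (simp add: eq)
qed

text \<open>A slight push along \<open>q\<close> puts \<open>x\<close> in general position, where an
  optimal basis is available; the signs of its coordinates there are those of the half-open
  convention. The cone condition is on the pushed point rather than on \<open>x\<close>, so that the
  lemma also serves for \<open>- q\<close>, which pushes boundary points out.\<close>

lemma half_open_cone_exists:
  assumes generic: "\<And>B a. B \<in> bases A \<Longrightarrow> a \<in> A - B \<Longrightarrow> height_ext \<omega> B a \<noteq> \<omega> a"
    and q: "in_general_position q" and x: "x \<in> span A"
    and ev: "\<forall>\<^sub>F \<epsilon> in at_right 0. x + \<epsilon> *\<^sub>R q \<in> cone_of A"
  shows "\<exists>B\<in>optimal_bases \<omega>. x \<in> half_open_cone q B"
proof -
  obtain \<epsilon> where \<epsilon>: "x + \<epsilon> *\<^sub>R q \<in> cone_of A" "\<forall>B\<in>bases A. \<forall>b\<in>B. coord B (x + \<epsilon> *\<^sub>R q) b \<noteq> 0 \<and>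
    (coord B (x + \<epsilon> *\<^sub>R q) b > 0 \<longleftrightarrow> coord B x b > 0 \<or> coord B x b = 0 \<and> coord B q b > 0)"
    using eventually_happens[OF eventually_conj[OF ev eventually_coord_sign[OF q x]]] by auto
  then have "in_general_position (x + \<epsilon> *\<^sub>R q)"
    using cone_of_subset_span by (auto simp: in_general_position_def)
  then obtain B where B: "B \<in> optimal_bases \<omega>" "\<forall>b\<in>B. coord B (x + \<epsilon> *\<^sub>R q) b > 0"
    using optimal_bases_exists[OF generic \<epsilon>(1)] by blast
  moreover have "B \<in> bases A" using B by (auto simp: optimal_bases_def)
  ultimately show ?thesis using \<epsilon>(2) x by (auto simp: half_open_cone_def)
qed

lemma half_open_cone_unique:
  assumes B: "B \<in> optimal_bases \<omega>" "B' \<in> optimal_bases \<omega>"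
    and q: "in_general_position q" and x: "x \<in> half_open_cone q B" "x \<in> half_open_cone q B'"
  shows "B = B'"
proof -
  have xs: "x \<in> span A" and qs: "q \<in> span A"
    using x q by (auto simp: half_open_cone_def in_general_position_def)
  obtain \<epsilon> where \<epsilon>: "\<forall>B\<in>bases A. \<forall>b\<in>B. coord B (x + \<epsilon> *\<^sub>R q) b \<noteq> 0 \<and>
    (coord B (x + \<epsilon> *\<^sub>R q) b > 0 \<longleftrightarrow> coord B x b > 0 \<or> coord B x b = 0 \<and> coord B q b > 0)"
    using eventually_happens[OF eventually_coord_sign[OF q xs]] by auto
  show ?thesis
  proof (rule optimal_bases_unique[OF B])
    show "x + \<epsilon> *\<^sub>R q \<in> span A" using xs qs by (intro span_add span_scale)
  qed (use \<epsilon> x B in \<open>auto simp: half_open_cone_def optimal_bases_def\<close>)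
qed

lemma half_open_cone_subset: "B \<in> bases A \<Longrightarrow> half_open_cone q B \<subseteq> cone_of A"
proof
  fix x assume B: "B \<in> bases A" and x: "x \<in> half_open_cone q B"
  then have "(\<Sum>b\<in>B. coord B x b *\<^sub>R b) \<in> cone_of A"
    using basesD(1)[OF B] by (intro cone_of_subset_sum) (auto simp: half_open_cone_def)
  then show "x \<in> cone_of A" using sum_coord[OF B] x by (simp add: half_open_cone_def)
qed

text \<open>A strictly positive part over a full basis certifies an interior point: a small multiple
  of any vector of the span is absorbed by the coefficients \<open>c\<close>.\<close>

lemma eventually_in_cone:
  assumes S: "S \<in> bases A" and x: "x = z + (\<Sum>s\<in>S. c s *\<^sub>R s)" "z \<in> cone_of A"
    and c: "\<And>s. s \<in> S \<Longrightarrow> c s > 0" and q: "q \<in> span A"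
  shows "\<forall>\<^sub>F \<epsilon> in at_right 0. x + \<epsilon> *\<^sub>R q \<in> cone_of A"
proof -
  have "\<forall>\<^sub>F \<epsilon> in at_right 0. \<forall>s\<in>S. c s + \<epsilon> * coord S q s > 0"
  proof (intro eventually_ball_finite basesD(4)[OF S] ballI)
    fix s assume "s \<in> S"
    have "((\<lambda>\<epsilon>. c s + \<epsilon> * coord S q s) \<longlongrightarrow> c s) (at_right 0)"
      by (rule tendsto_eq_intros refl tendsto_ident_at | simp)+
    from order_tendstoD(1)[OF this c[OF \<open>s \<in> S\<close>]]
    show "\<forall>\<^sub>F \<epsilon> in at_right 0. c s + \<epsilon> * coord S q s > 0" .
  qed
  then show ?thesis
  proof eventually_elim
    case (elim \<epsilon>)
    have "x + \<epsilon> *\<^sub>R q = z + (\<Sum>s\<in>S. (c s + \<epsilon> * coord S q s) *\<^sub>R s)"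
      using arg_cong[OF sum_coord[OF S q], of "\<lambda>x. \<epsilon> *\<^sub>R x"]
      by (simp add: x(1) scaleR_add_left sum.distrib scaleR_sum_right)
    also have "\<dots> \<in> cone_of A"
      using elim x(2) basesD(1)[OF S] by (intro cone_of_add cone_of_subset_sum) (auto intro: less_imp_le)
    finally show ?case .
  qed
qed

end

section \<open>Box points and the Ehrhart series\<close>

definition compositions :: "'i set \<Rightarrow> nat \<Rightarrow> ('i \<Rightarrow> nat) set" where
  "compositions B j = {n \<in> B \<rightarrow>\<^sub>E UNIV. sum n B = j}"

lemma finite_compositions:
  assumes "finite B" shows "finite (compositions B j)"
proof (rule finite_subset)
  show "compositions B j \<subseteq> B \<rightarrow>\<^sub>E {..j}"
    using assms by (auto simp: compositions_def PiE_iff extensional_def member_le_sum)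
qed (use assms in \<open>auto intro: finite_PiE\<close>)

lemma compositions_empty: "compositions {} j = (if j = 0 then {\<lambda>_. undefined} else {})"
  by (auto simp: compositions_def)

text \<open>The value at \<open>b\<close> is the slack \<open>j - i\<close>. Inserting an element
  thus takes partial sums, which multiplies the generating function by
  \<open>1 / (1 - X)\<close>.\<close>

lemma card_compositions_insert:
  assumes "finite B" "b \<notin> B"
  shows "card (compositions (insert b B) j) = (\<Sum>i\<le>j. card (compositions B i))"
proof -
  have "bij_betw (\<lambda>n. (j - n b, restrict n B)) (compositions (insert b B) j) (SIGMA i:{..j}. compositions B i)"
  proof (rule bij_betw_byWitness[where f' = "\<lambda>(i, f). f(b := j - i)"])
    show "\<forall>n\<in>compositions (insert b B) j. (\<lambda>(i, f). f(b := j - i)) (j - n b, restrict n B) = n"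
      using assms by (auto simp: compositions_def fun_eq_iff PiE_iff extensional_def)
    have eq: "sum (f(b := i)) B = sum f B" for f :: "'a \<Rightarrow> nat" and i
      using assms by (intro sum.cong) auto
    show "\<forall>p\<in>SIGMA i:{..j}. compositions B i. (\<lambda>n. (j - n b, restrict n B)) ((\<lambda>(i, f). f(b := j - i)) p) = p"
      using assms by (auto simp: compositions_def fun_eq_iff PiE_iff extensional_def)
    show "(\<lambda>n. (j - n b, restrict n B)) ` compositions (insert b B) j \<subseteq> (SIGMA i:{..j}. compositions B i)"
      using assms by (auto simp: compositions_def)
    show "(\<lambda>(i, f). f(b := j - i)) ` (SIGMA i:{..j}. compositions B i) \<subseteq> compositions (insert b B) j"
      using assms eq by (auto simp: compositions_def PiE_iff extensional_def)
  qed
  then show ?thesis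
    using assms by (simp add: bij_betw_same_card finite_compositions)
qed

lemma fps_compositions:
  assumes "finite B"
  shows "(1 - fps_X) ^ card B * Abs_fps (\<lambda>j. int (card (compositions B j))) = 1"
  using assms
proof (induction B)
  case empty
  show ?case by (auto simp: fps_eq_iff compositions_empty)
next
  case (insert b B)
  have geo: "(1 - fps_X) * Abs_fps (\<lambda>_. 1 :: int) = 1"
    by (auto simp: fps_eq_iff left_diff_distrib)
  have "Abs_fps (\<lambda>j. int (card (compositions (insert b B) j)))
      = Abs_fps (\<lambda>j. int (card (compositions B j))) * Abs_fps (\<lambda>_. 1)"
    using insert.hyps by (simp add: fps_eq_iff card_compositions_insert fps_mult_nth atLeast0AtMost)
  then have "(1 - fps_X) ^ card (insert b B) * Abs_fps (\<lambda>j. int (card (compositions (insert b B) j)))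
     = ((1 - fps_X) ^ card B * Abs_fps (\<lambda>j. int (card (compositions B j)))) * ((1 - fps_X) * Abs_fps (\<lambda>_. 1))"
    using insert.hyps by (simp add: algebra_simps)
  then show ?case
    using insert.IH geo by simp
qed

lemma card_compositions:
  assumes "finite B" "card B = Suc m"
  shows "card (compositions B j) = (m + j) choose m"
  using assms
proof (induction m arbitrary: B j)
  case 0
  then obtain b where "B = {b}" by (auto simp: card_Suc_eq)
  then show ?case
    using card_compositions_insert[of "{}" b j] by (simp add: compositions_empty if_distrib[of card] cong: if_cong)
next
  case (Suc m)
  then obtain b C where C: "B = insert b C" "b \<notin> C" "card C = Suc m" "finite C"
    by (metis card_Suc_eq finite_insert)
  show ?case
    unfolding C(1) card_compositions_insert[OF C(4,2)] Suc.IH[OF C(4,3)]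
    using choose_rising_sum(1)[where m = j and n = m] by simp
qed

text \<open>The right side is the product of \<open>j + 1, ..., j + m\<close>. The crude bound keeps
  its leading term in \<open>j\<close>, which is what the volume comparison sees.\<close>

lemma power_le_fact_binomial: "j ^ m \<le> fact m * ((m + j) choose m)"
proof (induction m)
  case (Suc m)
  have "j ^ Suc m \<le> Suc (m + j) * (fact m * ((m + j) choose m))"
    unfolding power_Suc by (intro mult_le_mono Suc) simp
  also have "\<dots> = fact m * (Suc m * (Suc (m + j) choose Suc m))"
    by (simp only: Suc_times_binomial mult.left_commute)
  finally show ?case by (simp add: algebra_simps del: binomial_Suc_Suc)
qed simp

section \<open>Lattice points in half-open simplicial cones\<close>

locale additive_subgroup =
  fixes H :: "'a::real_vector set"
  assumes zero_mem: "0 \<in> H" and diff_mem: "x \<in> H \<Longrightarrow> y \<in> H \<Longrightarrow> x - y \<in> H"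
begin

lemma neg_mem: "x \<in> H \<Longrightarrow> - x \<in> H"
  using diff_mem[OF zero_mem] by simp

lemma add_mem: "x \<in> H \<Longrightarrow> y \<in> H \<Longrightarrow> x + y \<in> H"
  using diff_mem[of x "- y"] neg_mem by simp

lemma of_nat_mem: "x \<in> H \<Longrightarrow> of_nat m *\<^sub>R x \<in> H"
  by (induction m) (auto simp: zero_mem scaleR_add_left intro: add_mem)

lemma of_int_mem: "x \<in> H \<Longrightarrow> of_int k *\<^sub>R x \<in> H"
proof (cases k rule: int_cases2)
  case (nonpos m)
  assume "x \<in> H"
  then show ?thesis using of_nat_mem[of "- x" m] neg_mem nonpos by simp
qed (auto simp: of_nat_mem)

lemma sum_mem: "(\<And>i. i \<in> I \<Longrightarrow> f i \<in> H) \<Longrightarrow> sum f I \<in> H"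
  by (induction I rule: infinite_finite_induct) (auto simp: zero_mem add_mem)

end

locale lattice_config = point_config A h + additive_subgroup L
    for A :: "'e::real_vector set" and h L +
  assumes A_subset_L: "A \<subseteq> L"
    and L_subset_span: "L \<subseteq> span A"
    and h_L: "x \<in> L \<Longrightarrow> h x \<in> \<int>"
    and discrete_L: "B \<in> bases A \<Longrightarrow> finite {x \<in> L. \<forall>b\<in>B. \<bar>representation B x b\<bar> \<le> 1}"
begin

lemma spanL: "x \<in> L \<Longrightarrow> x \<in> span A"
  using L_subset_span by blast

text \<open>The half-open fundamental parallelepiped. A facet through the origin is kept where
  \<open>q\<close> points inwards and is otherwise exchanged for the opposite facet; then the
  translates by nonnegative integer combinations of \<open>B\<close> fill exactly the half-open
  cone.\<close>

definition box_points :: "'e \<Rightarrow> 'e set \<Rightarrow> 'e set" where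
  "box_points q B = {x \<in> L. \<forall>b\<in>B. if coord B q b > 0 then 0 \<le> coord B x b \<and> coord B x b < 1
                                           else 0 < coord B x b \<and> coord B x b \<le> 1}"

lemma finite_box_points: "B \<in> bases A \<Longrightarrow> finite (box_points q B)"
  by (rule finite_subset[OF _ discrete_L[of B]]) (force simp: box_points_def split: if_splits)

lemma box_subset: "in_general_position q \<Longrightarrow> B \<in> bases A \<Longrightarrow> box_points q B \<subseteq> half_open_cone q B"
  using L_subset_span by (force simp: box_points_def half_open_cone_def in_general_position_def split: if_splits)

lemma span_basis: "B \<in> bases A \<Longrightarrow> b \<in> B \<Longrightarrow> b \<in> span A"
  using basesD(1) by (blast intro: span_base)

lemma coord_add_basis_sum:
  assumes "B \<in> bases A" "y \<in> span A" "b \<in> B"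
  shows "coord B (y + (\<Sum>b\<in>B. c b *\<^sub>R b)) b = coord B y b + c b"
  using assms coord_sum[OF assms(1,3), of c]
  by (subst coord_add) (auto intro!: span_sum span_scale span_basis)

lemma bij_box_half_open_cone:
  assumes B: "B \<in> bases A" and q: "in_general_position q"
  shows "bij_betw (\<lambda>(y, n). y + (\<Sum>b\<in>B. real (n b) *\<^sub>R b)) (box_points q B \<times> (B \<rightarrow>\<^sub>E UNIV)) (L \<inter> half_open_cone q B)"
proof -
  let ?f = "\<lambda>(y, n). y + (\<Sum>b\<in>B. real (n b) *\<^sub>R b)"
  have co: "coord B (?f (y, n)) b = coord B y b + n b" if "y \<in> L" "b \<in> B" for y n b
    using coord_add_basis_sum[OF B spanL[OF that(1)] that(2)] by simp
  have nz: "coord B q b \<noteq> 0" if "b \<in> B" for b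
    using q B that by (auto simp: in_general_position_def)
  have "inj_on ?f (box_points q B \<times> (B \<rightarrow>\<^sub>E UNIV))"
  proof (rule inj_onI, clarsimp)
    fix y n y' n'
    assume y: "y \<in> box_points q B" "y' \<in> box_points q B" and n: "n \<in> B \<rightarrow>\<^sub>E UNIV" "n' \<in> B \<rightarrow>\<^sub>E (UNIV :: nat set)"
      and eq: "y + (\<Sum>b\<in>B. real (n b) *\<^sub>R b) = y' + (\<Sum>b\<in>B. real (n' b) *\<^sub>R b)"
    have yL: "y \<in> L" "y' \<in> L" using y by (auto simp: box_points_def)
    have "n b = n' b" if "b \<in> B" for b
    proof -
      have "coord B y b + n b = coord B y' b + n' b"
        using co[OF yL(1) that, of n] co[OF yL(2) that, of n'] eq by simp
      moreover have "\<bar>coord B y b - coord B y' b\<bar> < 1"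
        using y that by (force simp: box_points_def split: if_splits)
      ultimately show ?thesis by linarith
    qed
    then have "n = n'" using n by (intro PiE_ext) auto
    with eq show "y = y' \<and> n = n'" by simp
  qed
  moreover have "?f p \<in> L \<inter> half_open_cone q B" if p: "p \<in> box_points q B \<times> (B \<rightarrow>\<^sub>E UNIV)" for p
  proof -
    obtain y n where p: "p = (y, n)" "y \<in> box_points q B" using p by auto
    have yL: "y \<in> L" using p by (auto simp: box_points_def)
    have "?f p \<in> L"
      unfolding p using yL basesD(1)[OF B] A_subset_L by (auto intro!: add_mem sum_mem of_nat_mem)
    moreover have "coord B (?f p) b > 0 \<or> coord B (?f p) b = 0 \<and> coord B q b > 0" if "b \<in> B" for b
      unfolding p co[OF yL that] using p(2) nz[OF that] that
      by (auto simp: box_points_def split: if_splits)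
    ultimately show ?thesis using spanL by (auto simp: half_open_cone_def)
  qed
  moreover have "x \<in> ?f ` (box_points q B \<times> (B \<rightarrow>\<^sub>E UNIV))" if x: "x \<in> L \<inter> half_open_cone q B" for x
  proof -
    \<comment> \<open>The integer part that matches the box convention: the floor leaves a remainder
      in \<open>[0, 1)\<close>, the ceiling minus 1 leaves one in \<open>(0, 1]\<close>.\<close>
    define n where "n = restrict (\<lambda>b. nat (if coord B q b > 0 then \<lfloor>coord B x b\<rfloor> else \<lceil>coord B x b\<rceil> - 1)) B"
    define y where "y = x - (\<Sum>b\<in>B. real (n b) *\<^sub>R b)"
    have yL: "y \<in> L"
      unfolding y_def using x basesD(1)[OF B] A_subset_L by (auto intro!: diff_mem sum_mem of_nat_mem)
    have xe: "x = ?f (y, n)" by (simp add: y_def)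
    have "if coord B q b > 0 then 0 \<le> coord B y b \<and> coord B y b < 1
                             else 0 < coord B y b \<and> coord B y b \<le> 1" if "b \<in> B" for b
    proof -
      have "coord B x b = coord B y b + n b"
        using co[OF yL that, of n] xe by simp
      moreover have "coord B x b \<ge> 0" "coord B q b \<le> 0 \<Longrightarrow> coord B x b > 0"
        using x that by (auto simp: half_open_cone_def)
      ultimately show ?thesis
        using that by (auto simp: n_def) linarith+
    qed
    with yL have "y \<in> box_points q B" by (auto simp: box_points_def)
    moreover have "n \<in> B \<rightarrow>\<^sub>E UNIV" by (auto simp: n_def)
    ultimately show ?thesis using xe by blast
  qed
  ultimately show ?thesis by (auto simp: bij_betw_def)
qed

end

text \<open>\<open>q_pos\<close> makes the box of \<open>S\<close> consist of the lattice points
  with all coordinates in \<open>[0, 1)\<close>, one for each class of \<open>L\<close> modulo the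
  group generated by \<open>S\<close>.\<close>

locale tiling = lattice_config A h L for A :: "'e::real_vector set" and h L +
  fixes S :: "'e set" and \<omega> :: "'e \<Rightarrow> real" and q :: 'e
  assumes S_optimal: "S \<in> optimal_bases \<omega>"
    and generic: "B \<in> bases A \<Longrightarrow> a \<in> A - B \<Longrightarrow> height_ext \<omega> B a \<noteq> \<omega> a"
    and q: "in_general_position q"
    and q_pos: "s \<in> S \<Longrightarrow> coord S q s > 0"
begin

definition tiles :: "('e set \<times> 'e) set" where
  "tiles = (SIGMA B:optimal_bases \<omega>. box_points q B)"

definition ht :: "'e set \<times> 'e \<Rightarrow> nat" where
  "ht t = nat \<lfloor>h (snd t)\<rfloor>"

lemma optimal_is_basis: "B \<in> optimal_bases \<omega> \<Longrightarrow> B \<in> bases A"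
  by (auto simp: optimal_bases_def)

lemma S_basis: "S \<in> bases A"
  using S_optimal by (rule optimal_is_basis)

lemma q_span: "q \<in> span A"
  using q by (simp add: in_general_position_def)

lemma finite_optimal: "finite (optimal_bases \<omega>)"
  using finite_bases by (rule finite_subset[rotated]) (auto simp: optimal_bases_def)

lemma finite_tiles: "finite tiles"
  unfolding tiles_def using finite_optimal finite_box_points optimal_is_basis by (intro finite_SigmaI) auto

lemma q_cone: "q \<in> cone_of A"
proof -
  have "(\<Sum>s\<in>S. coord S q s *\<^sub>R s) \<in> cone_of A"
    using basesD(1)[OF S_basis] q_pos by (intro cone_of_subset_sum) (auto intro: less_imp_le)
  then show ?thesis using sum_coord[OF S_basis q_span] by simp
qed

lemma card_bases_eq: "B \<in> bases A \<Longrightarrow> card B = card S"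
  using basesD[of B] basesD[OF S_basis] by (metis dim_eq_card_independent dim_span)

lemma tilesD:
  assumes "(B, y) \<in> tiles"
  shows "B \<in> optimal_bases \<omega>" "B \<in> bases A" "y \<in> box_points q B" "y \<in> L" "h y = real (ht (B, y))"
proof -
  show B: "B \<in> optimal_bases \<omega>" "B \<in> bases A" and y: "y \<in> box_points q B" "y \<in> L"
    using assms by (auto simp: tiles_def optimal_is_basis box_points_def)
  have "h y \<ge> 0"
    using y(1) box_subset[OF q B(2)] half_open_cone_subset[OF B(2)] h_cone_nonneg by blast
  with h_L[OF y(2)] show "h y = real (ht (B, y))"
    by (auto simp: ht_def Ints_def)
qed

lemma cone_of_scale: "x \<in> cone_of A \<Longrightarrow> r \<ge> 0 \<Longrightarrow> r *\<^sub>R x \<in> cone_of A"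
  by (clarsimp simp: cone_of_def scaleR_sum_right) (metis mult_nonneg_nonneg)

lemma cone_half_open:
  assumes "x \<in> cone_of A"
  shows "\<exists>B\<in>optimal_bases \<omega>. x \<in> half_open_cone q B"
proof (rule half_open_cone_exists[OF generic q])
  show "\<forall>\<^sub>F \<epsilon> in at_right 0. x + \<epsilon> *\<^sub>R q \<in> cone_of A"
    using assms q_cone by (auto intro!: cone_of_add cone_of_scale eventually_mono[OF eventually_at_right_less[of 0]])
qed (use assms cone_of_subset_span in auto)

text \<open>A lattice point of the cone lies in exactly one half-open cone, and there it splits
  uniquely into a box point and a nonnegative integer combination of the basis. Basis vectors have
  height 1, so the coefficients form a composition of the remaining height
  \<open>k - ht t\<close>.\<close>

lemma card_slice:
  "card {x \<in> L \<inter> cone_of A. h x = real k}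
    = (\<Sum>t\<in>tiles. if ht t \<le> k then card (compositions (fst t) (k - ht t)) else 0)"
proof -
  define N where "N t = (if ht t \<le> k then compositions (fst t) (k - ht t) else {})" for t
  let ?f = "\<lambda>((B, y), n). y + (\<Sum>b\<in>B. real (n b) *\<^sub>R b)"
  have hf: "h (y + (\<Sum>b\<in>B. real (n b) *\<^sub>R b)) = real (ht (B, y) + sum n B)" if "(B, y) \<in> tiles" for B y n
    using tilesD(5)[OF that] h_sum[OF basesD(1)[OF tilesD(2)[OF that]], of "\<lambda>b. real (n b)"]
    by (simp add: linear_add[OF linear_h])
  have bij: "bij_betw (\<lambda>(y, n). y + (\<Sum>b\<in>B. real (n b) *\<^sub>R b)) (box_points q B \<times> (B \<rightarrow>\<^sub>E UNIV)) (L \<inter> half_open_cone q B)"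
    if "B \<in> optimal_bases \<omega>" for B
    using bij_box_half_open_cone[OF optimal_is_basis[OF that] q] .
  have NE: "n \<in> B \<rightarrow>\<^sub>E UNIV \<and> ht (B, y) + sum n B = k" if "n \<in> N (B, y)" for n B y
    using that by (auto simp: N_def compositions_def split: if_splits)
  have "bij_betw ?f (SIGMA t:tiles. N t) {x \<in> L \<inter> cone_of A. h x = real k}"
    unfolding bij_betw_def
  proof
    show "inj_on ?f (SIGMA t:tiles. N t)"
    proof (rule inj_onI)
      fix p p' assume p: "p \<in> (SIGMA t:tiles. N t)" "p' \<in> (SIGMA t:tiles. N t)" and eq: "?f p = ?f p'"
      obtain B y n B' y' n' where pp: "p = ((B, y), n)" "p' = ((B', y'), n')"
        by (metis surj_pair)
      have t: "(B, y) \<in> tiles" "(B', y') \<in> tiles" and "n \<in> N (B, y)" "n' \<in> N (B', y')"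
        using p by (auto simp: pp)
      then have n: "n \<in> B \<rightarrow>\<^sub>E UNIV" "n' \<in> B' \<rightarrow>\<^sub>E UNIV"
        using NE by blast+
      have "?f p \<in> half_open_cone q B" "?f p' \<in> half_open_cone q B'"
        using bij_betwE[OF bij[OF tilesD(1)[OF t(1)]]] bij_betwE[OF bij[OF tilesD(1)[OF t(2)]]]
          tilesD(3)[OF t(1)] tilesD(3)[OF t(2)] n by (auto simp: pp)
      then have BB: "B = B'"
        using half_open_cone_unique[OF tilesD(1)[OF t(1)] tilesD(1)[OF t(2)] q] eq by simp
      have "(y, n) = (y', n')"
        using bij_betw_imp_inj_on[OF bij[OF tilesD(1)[OF t(1)]]] eq n tilesD(3)[OF t(1)] tilesD(3)[OF t(2)]
        unfolding inj_on_def BB pp by auto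
      then show "p = p'" by (simp add: pp BB)
    qed
    show "?f ` (SIGMA t:tiles. N t) = {x \<in> L \<inter> cone_of A. h x = real k}"
    proof (intro equalityI subsetI)
      fix x assume "x \<in> ?f ` (SIGMA t:tiles. N t)"
      then obtain B y n where x: "x = y + (\<Sum>b\<in>B. real (n b) *\<^sub>R b)" "(B, y) \<in> tiles" "n \<in> N (B, y)"
        by auto
      have "x \<in> L \<inter> half_open_cone q B"
        using bij_betwE[OF bij[OF tilesD(1)[OF x(2)]]] tilesD(3)[OF x(2)] NE[OF x(3)] by (auto simp: x(1))
      moreover have "h x = real k"
        using hf[OF x(2), of n] NE[OF x(3)] by (simp add: x(1))
      ultimately show "x \<in> {x \<in> L \<inter> cone_of A. h x = real k}"
        using half_open_cone_subset[OF tilesD(2)[OF x(2)]] by blast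
    next
      fix x assume x: "x \<in> {x \<in> L \<inter> cone_of A. h x = real k}"
      then obtain B where B: "B \<in> optimal_bases \<omega>" "x \<in> half_open_cone q B"
        using cone_half_open by blast
      then have "x \<in> (\<lambda>(y, n). y + (\<Sum>b\<in>B. real (n b) *\<^sub>R b)) ` (box_points q B \<times> (B \<rightarrow>\<^sub>E UNIV))"
        using bij[OF B(1)] x by (auto simp: bij_betw_def)
      then obtain y n where yn: "x = y + (\<Sum>b\<in>B. real (n b) *\<^sub>R b)" "y \<in> box_points q B" "n \<in> B \<rightarrow>\<^sub>E UNIV"
        by auto
      have t: "(B, y) \<in> tiles" using B yn by (auto simp: tiles_def)
      have "real (ht (B, y) + sum n B) = real k"
        using hf[OF t, of n] x yn(1) by (metis (mono_tags, lifting) mem_Collect_eq)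
      then have "ht (B, y) + sum n B = k"
        by (simp only: of_nat_eq_iff)
      then have "n \<in> N (B, y)"
        using yn(3) by (auto simp: N_def compositions_def)
      then show "x \<in> ?f ` (SIGMA t:tiles. N t)"
        using t yn(1) by force
    qed
  qed
  then have "card {x \<in> L \<inter> cone_of A. h x = real k} = card (SIGMA t:tiles. N t)"
    by (simp add: bij_betw_same_card)
  also have "\<dots> = (\<Sum>t\<in>tiles. card (N t))"
  proof (intro card_SigmaI finite_tiles ballI)
    fix t assume "t \<in> tiles"
    then have "finite (fst t)"
      using tilesD(2) basesD(4) by (cases t) auto
    then show "finite (N t)" by (simp add: N_def finite_compositions)
  qed
  finally show ?thesis by (simp add: N_def if_distrib[of card] cong: if_cong)
qed

text \<open>All bases have the same size, so each tile contributes
  \<open>X ^ ht t / (1 - X) ^ card S\<close>. For the cone over a polytope the left side is its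
  \<open>h_star\<close> series.\<close>

lemma fps_slices:
  "(1 - fps_X) ^ card S * Abs_fps (\<lambda>k. int (card {x \<in> L \<inter> cone_of A. h x = real k}))
    = Abs_fps (\<lambda>i. int (card {t \<in> tiles. ht t = i}))"
proof -
  let ?G = "\<lambda>B. Abs_fps (\<lambda>j. int (card (compositions B j)))"
  have "Abs_fps (\<lambda>k. int (card {x \<in> L \<inter> cone_of A. h x = real k})) = (\<Sum>t\<in>tiles. fps_X ^ ht t * ?G (fst t))"
    unfolding card_slice
    by (auto simp: fps_eq_iff fps_sum_nth fps_X_power_mult_nth intro!: sum.cong)
  then have "(1 - fps_X) ^ card S * Abs_fps (\<lambda>k. int (card {x \<in> L \<inter> cone_of A. h x = real k}))
      = (\<Sum>t\<in>tiles. fps_X ^ ht t * ((1 - fps_X) ^ card S * ?G (fst t)))"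
    by (simp add: sum_distrib_left mult.left_commute)
  also have "\<dots> = (\<Sum>t\<in>tiles. fps_X ^ ht t)"
  proof (intro sum.cong refl)
    fix t assume "t \<in> tiles"
    then have "card S = card (fst t)" "finite (fst t)"
      using tilesD(2) card_bases_eq basesD(4) by (cases t, fastforce)+
    then show "fps_X ^ ht t * ((1 - fps_X) ^ card S * ?G (fst t)) = fps_X ^ ht t"
      using fps_compositions[of "fst t"] by simp
  qed
  also have "\<dots> = Abs_fps (\<lambda>i. int (card {t \<in> tiles. ht t = i}))"
  proof (rule fps_ext)
    fix i
    have "fps_nth (\<Sum>t\<in>tiles. fps_X ^ ht t) i = (\<Sum>t\<in>tiles. if i = ht t then 1 else (0::int))"
      by (simp add: fps_sum_nth)
    also have "\<dots> = int (card {t \<in> tiles. ht t = i})"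
      using finite_tiles by (subst sum.If_cases) (auto intro!: arg_cong[of _ _ card])
    finally show "fps_nth (\<Sum>t\<in>tiles. fps_X ^ ht t) i = fps_nth (Abs_fps (\<lambda>i. int (card {t \<in> tiles. ht t = i}))) i"
      by simp
  qed
  finally show ?thesis .
qed

text \<open>
  One half of Ehrhart--Macdonald reciprocity: pushing \<open>x\<close> towards \<open>- q\<close> selects a half-open
  cone with all the opposite faces removed, and reflecting \<open>x\<close> into its box complements the height.
\<close>

lemma reflected_tile:
  assumes x: "x \<in> L" and ev: "\<forall>\<^sub>F \<epsilon> in at_right 0. x + \<epsilon> *\<^sub>R (- q) \<in> cone_of A"
  shows "\<exists>t\<in>tiles. real (ht t) \<ge> real (card S) - h x"
proof -
  have q': "in_general_position (- q)"
    using q by (auto simp: in_general_position_def coord_neg span_neg)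
  obtain B where B: "B \<in> optimal_bases \<omega>" "x \<in> half_open_cone (- q) B"
    using half_open_cone_exists[OF generic q' spanL[OF x] ev] by blast
  have BB: "B \<in> bases A" using B(1) by (rule optimal_is_basis)
  \<comment> \<open>The least integer for which \<open>k b - coord B x b\<close> obeys the box
    convention of \<open>q\<close>. It is at least 1 in both cases because \<open>x\<close> lies in
    the half-open cone for \<open>- q\<close>.\<close>
  define k where "k b = (if coord B q b > 0 then \<lceil>coord B x b\<rceil> else \<lfloor>coord B x b\<rfloor> + 1)" for b
  define y where "y = - x + (\<Sum>b\<in>B. of_int (k b) *\<^sub>R b)"
  have bs: "coord B x b > 0 \<or> coord B x b = 0 \<and> coord B q b < 0" if "b \<in> B" for b
    using B(2) that by (auto simp: half_open_cone_def coord_neg[OF BB q_span])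
  have k1: "k b \<ge> 1" if "b \<in> B" for b
    using bs[OF that] by (auto simp: k_def)
  have yL: "y \<in> L"
    unfolding y_def using basesD(1)[OF BB] A_subset_L by (intro add_mem neg_mem sum_mem of_int_mem x) blast
  have "coord B y b = of_int (k b) - coord B x b" if "b \<in> B" for b
    unfolding y_def using coord_add_basis_sum[OF BB span_neg[OF spanL[OF x]] that]
    by (simp add: coord_neg[OF BB spanL[OF x]])
  then have "y \<in> box_points q B"
    using yL bs unfolding box_points_def k_def by (auto; linarith)
  then have t: "(B, y) \<in> tiles" using B(1) by (auto simp: tiles_def)
  have "h y = (\<Sum>b\<in>B. of_int (k b)) - h x"
    unfolding y_def using h_sum[OF basesD(1)[OF BB], of "\<lambda>b. of_int (k b)"]
    by (simp add: linear_add[OF linear_h] linear_neg[OF linear_h] linear_diff[OF linear_h])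
  moreover have "(\<Sum>b\<in>B. 1) \<le> (\<Sum>b\<in>B. real_of_int (k b))"
    using k1 by (intro sum_mono) fastforce
  ultimately have "h y \<ge> real (card S) - h x"
    using card_bases_eq[OF BB] by simp
  then show ?thesis using t tilesD(5)[OF t] by fastforce
qed

end

section \<open>Counting supports\<close>

locale tiling_of_degree = tiling A h L S \<omega> q for A :: "'e::real_vector set" and h L S \<omega> q +
  fixes d :: nat
  assumes ht_le: "t \<in> tiles \<Longrightarrow> ht t \<le> d"
begin

lemma S_subset_L: "s \<in> S \<Longrightarrow> s \<in> L"
  using basesD(1)[OF S_basis] A_subset_L by blast

lemma box_S: "box_points q S = {x \<in> L. \<forall>s\<in>S. 0 \<le> coord S x s \<and> coord S x s < 1}"
  using q_pos by (auto simp: box_points_def)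

lemma box_tile: "g \<in> box_points q S \<Longrightarrow> (S, g) \<in> tiles"
  using S_optimal by (auto simp: tiles_def)

text \<open>The hypotheses on \<open>z\<close> and \<open>c\<close> certify that \<open>x\<close> is
  interior, so it survives a small push along \<open>- q\<close> and its reflection into a box is a
  tile of height at most \<open>d\<close>.\<close>

lemma card_S_le_height:
  assumes x: "x \<in> L" "x = z + (\<Sum>s\<in>S. c s *\<^sub>R s)" "z \<in> cone_of A" and c: "\<And>s. s \<in> S \<Longrightarrow> c s > 0"
  shows "real (card S) \<le> h x + real d"
proof -
  obtain t where "t \<in> tiles" "real (ht t) \<ge> real (card S) - h x"
    using reflected_tile[OF x(1) eventually_in_cone[OF S_basis x(2,3) c span_neg[OF q_span]]] by blast
  then show ?thesis using ht_le[of t] by simp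
qed

text \<open>
  In the relation \<open>a = \<Sum>coord S a s *\<^sub>R s\<close> the sum of the vectors on either side, completed by the
  vectors of \<open>S\<close> that do not occur, is an interior lattice point of \<open>cone_of A\<close>.
\<close>

lemma card_negative_coords:
  assumes a: "a \<in> A"
  shows "card {s\<in>S. coord S a s < 0} \<le> d"
proof -
  let ?c = "coord S a"
  have finS: "finite S" using basesD(4)[OF S_basis] .
  \<comment> \<open>Small enough that \<eta> times \<open>a\<close> can be split off from
    \<open>x\<close> below with every coefficient over \<open>S\<close> still positive. At the
    vectors missing from \<open>x\<close>, positivity comes from the negative coordinates of
    \<open>a\<close>.\<close>
  define \<eta> where "\<eta> = 1 / (1 + (\<Sum>s\<in>S. \<bar>?c s\<bar>))"
  have pos: "1 + (\<Sum>s\<in>S. \<bar>?c s\<bar>) > 0" by (intro add_pos_nonneg sum_nonneg) auto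
  then have \<eta>: "\<eta> > 0" by (simp add: \<eta>_def)
  have small: "\<eta> * ?c s < 1" if "s \<in> S" for s
  proof -
    have "\<bar>?c s\<bar> \<le> (\<Sum>s\<in>S. \<bar>?c s\<bar>)"
      using finS that by (intro member_le_sum) auto
    then have "?c s \<le> (\<Sum>s\<in>S. \<bar>?c s\<bar>)" by linarith
    then show ?thesis using pos by (simp add: \<eta>_def divide_less_eq)
  qed
  define x where "x = (\<Sum>s\<in>S. (if ?c s < 0 then 0 else 1) *\<^sub>R s)"
  have xeq: "x = \<eta> *\<^sub>R a + (\<Sum>s\<in>S. ((if ?c s < 0 then 0 else 1) - \<eta> * ?c s) *\<^sub>R s)"
  proof -
    have "(\<Sum>s\<in>S. ((if ?c s < 0 then 0 else 1) - \<eta> * ?c s) *\<^sub>R s) = x - \<eta> *\<^sub>R (\<Sum>s\<in>S. ?c s *\<^sub>R s)"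
      by (simp add: x_def scaleR_diff_left sum_subtractf scaleR_sum_right)
    then show ?thesis using sum_coord[OF S_basis span_base[OF a]] by simp
  qed
  have "real (card S) \<le> h x + real d"
  proof (rule card_S_le_height[OF _ xeq])
    show "x \<in> L"
      unfolding x_def using S_subset_L zero_mem by (intro sum_mem) auto
    show "\<eta> *\<^sub>R a \<in> cone_of A"
      using cone_of_subset_sum[of "{a}" "\<lambda>_. \<eta>"] a \<eta> by simp
    show "(if ?c s < 0 then 0 else 1) - \<eta> * ?c s > 0" if "s \<in> S" for s
      using small[OF that] \<eta> by (auto simp: mult_less_0_iff)
  qed
  moreover have "h x = real (card {s\<in>S. \<not> ?c s < 0})"
    unfolding x_def h_sum[OF basesD(1)[OF S_basis]] using finS by (simp add: sum.If_cases Int_def)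
  moreover have "card S = card {s\<in>S. ?c s < 0} + card {s\<in>S. \<not> ?c s < 0}"
    using finS by (subst card_Un_disjoint[symmetric]) (auto intro: arg_cong[of _ _ card])
  ultimately show ?thesis by linarith
qed

text \<open>This side of the relation contains \<open>a\<close> itself. The interior point is
  \<open>a\<close> plus the vectors of \<open>S\<close> with nonpositive coordinate, and the height
  1 of \<open>a\<close> is the source of \<open>Suc d\<close>.\<close>

lemma card_positive_coords:
  assumes a: "a \<in> A"
  shows "card {s\<in>S. coord S a s > 0} \<le> Suc d"
proof -
  let ?c = "coord S a"
  have finS: "finite S" using basesD(4)[OF S_basis] .
  \<comment> \<open>The summand 2 keeps \<eta> below 1, so that a positive multiple of
    \<open>a\<close> is left as the cone part of \<open>x\<close>.\<close>
  define \<eta> where "\<eta> = 1 / (2 + (\<Sum>s\<in>S. \<bar>?c s\<bar>))"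
  have nn: "(\<Sum>s\<in>S. \<bar>?c s\<bar>) \<ge> 0" by (intro sum_nonneg) auto
  then have "2 + (\<Sum>s\<in>S. \<bar>?c s\<bar>) > 0" "1 + (\<Sum>s\<in>S. \<bar>?c s\<bar>) > 0" by linarith+
  then have \<eta>: "\<eta> > 0" "\<eta> < 1" by (simp_all add: \<eta>_def divide_less_eq)
  have small: "- (\<eta> * ?c s) < 1" if "s \<in> S" for s
  proof -
    have "\<bar>?c s\<bar> \<le> (\<Sum>s\<in>S. \<bar>?c s\<bar>)"
      using finS that by (intro member_le_sum) auto
    then have "- ?c s < 2 + (\<Sum>s\<in>S. \<bar>?c s\<bar>)" by linarith
    then have "(- ?c s) / (2 + (\<Sum>s\<in>S. \<bar>?c s\<bar>)) < 1"
      using nn by (subst pos_divide_less_eq, linarith, simp)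
    then show ?thesis by (simp add: \<eta>_def)
  qed
  define x where "x = a + (\<Sum>s\<in>S. (if ?c s > 0 then 0 else 1) *\<^sub>R s)"
  have xeq: "x = (1 - \<eta>) *\<^sub>R a + (\<Sum>s\<in>S. ((if ?c s > 0 then 0 else 1) + \<eta> * ?c s) *\<^sub>R s)"
  proof -
    have "(\<Sum>s\<in>S. ((if ?c s > 0 then 0 else 1) + \<eta> * ?c s) *\<^sub>R s) = (x - a) + \<eta> *\<^sub>R (\<Sum>s\<in>S. ?c s *\<^sub>R s)"
      by (simp add: x_def scaleR_add_left sum.distrib scaleR_sum_right)
    then show ?thesis using sum_coord[OF S_basis span_base[OF a]] by (simp add: algebra_simps)
  qed
  have "real (card S) \<le> h x + real d"
  proof (rule card_S_le_height[OF _ xeq])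
    show "x \<in> L"
      unfolding x_def using S_subset_L zero_mem a A_subset_L by (intro add_mem sum_mem) auto
    show "(1 - \<eta>) *\<^sub>R a \<in> cone_of A"
      using cone_of_subset_sum[of "{a}" "\<lambda>_. 1 - \<eta>"] a \<eta> by simp
    show "(if ?c s > 0 then 0 else 1) + \<eta> * ?c s > 0" if "s \<in> S" for s
      using small[OF that] \<eta> by auto
  qed
  moreover have "h x = 1 + real (card {s\<in>S. \<not> ?c s > 0})"
    unfolding x_def linear_add[OF linear_h] h_A[OF a] h_sum[OF basesD(1)[OF S_basis]]
    using finS by (simp add: sum.If_cases Int_def)
  moreover have "card S = card {s\<in>S. ?c s > 0} + card {s\<in>S. \<not> ?c s > 0}"
    using finS by (subst card_Un_disjoint[symmetric]) (auto intro: arg_cong[of _ _ card])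
  ultimately show ?thesis by linarith
qed

lemma card_circuit_support:
  assumes a: "a \<in> A"
  shows "card {s\<in>S. coord S a s \<noteq> 0} \<le> 2 * d + 1"
proof -
  have "{s\<in>S. coord S a s \<noteq> 0} = {s\<in>S. coord S a s < 0} \<union> {s\<in>S. coord S a s > 0}"
    by auto
  then have "card {s\<in>S. coord S a s \<noteq> 0} \<le> card {s\<in>S. coord S a s < 0} + card {s\<in>S. coord S a s > 0}"
    by (simp add: card_Un_le)
  then show ?thesis using card_negative_coords[OF a] card_positive_coords[OF a] by simp
qed

text \<open>\<open>g'\<close> represents the inverse of \<open>g\<close> modulo \<open>S\<close>:
  its coordinates are complementary to 1 on the support of \<open>g\<close> and zero elsewhere, so
  the two heights add up to the size of the support.\<close>

lemma card_box_support:
  assumes g: "g \<in> box_points q S"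
  shows "card {s\<in>S. coord S g s \<noteq> 0} \<le> 2 * d"
proof -
  let ?c = "coord S g"
  have finS: "finite S" using basesD(4)[OF S_basis] .
  have gL: "g \<in> L" using g by (auto simp: box_points_def)
  define g' where "g' = - g + (\<Sum>s\<in>S. (if ?c s = 0 then 0 else 1) *\<^sub>R s)"
  have "g' \<in> L"
    unfolding g'_def using S_subset_L zero_mem gL by (intro add_mem neg_mem sum_mem) auto
  moreover have "coord S g' s = (if ?c s = 0 then 0 else 1) - ?c s" if "s \<in> S" for s
    unfolding g'_def using coord_add_basis_sum[OF S_basis span_neg[OF spanL[OF gL]] that]
    by (simp add: coord_neg[OF S_basis spanL[OF gL]])
  ultimately have g': "g' \<in> box_points q S"
    using g unfolding box_S by (auto simp: less_le)
  have "h g' = - h g + real (card {s\<in>S. ?c s \<noteq> 0})"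
    unfolding g'_def linear_add[OF linear_h] linear_neg[OF linear_h] h_sum[OF basesD(1)[OF S_basis]]
    using finS by (simp add: sum.If_cases Int_def Collect_neg_eq[symmetric])
  moreover have "h g \<le> d" "h g' \<le> d"
    using tilesD(5)[OF box_tile[OF g]] tilesD(5)[OF box_tile[OF g']]
      ht_le[OF box_tile[OF g]] ht_le[OF box_tile[OF g']] by auto
  ultimately show ?thesis by linarith
qed

text \<open>A vertex outside \<open>S\<close> has height 1, so it is itself a box point of the half-open cone containing it.\<close>

lemma card_tiles_ge:
  assumes ext: "\<And>a. a \<in> A - S \<Longrightarrow> \<exists>s\<in>S. coord S a s < 0"
  shows "card (box_points q S) + card (A - S) \<le> card tiles"
proof -
  have ex: "\<exists>B. (B, a) \<in> tiles \<and> B \<noteq> S" if a: "a \<in> A - S" for a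
  proof -
    have "a \<in> cone_of A"
      using cone_of_subset_sum[of "{a}" "\<lambda>_. 1"] a by simp
    then obtain B where B: "B \<in> optimal_bases \<omega>" "a \<in> half_open_cone q B"
      using cone_half_open by blast
    have BB: "B \<in> bases A" using B(1) by (rule optimal_is_basis)
    have ne: "B \<noteq> S"
      using B(2) ext[OF a] by (force simp: half_open_cone_def)
    have "a \<in> L \<inter> half_open_cone q B" using a A_subset_L B by auto
    then have "a \<in> (\<lambda>(y, n). y + (\<Sum>b\<in>B. real (n b) *\<^sub>R b)) ` (box_points q B \<times> (B \<rightarrow>\<^sub>E UNIV))"
      using bij_box_half_open_cone[OF BB q] by (auto simp: bij_betw_def)
    then obtain y n where yn: "a = y + (\<Sum>b\<in>B. real (n b) *\<^sub>R b)" "y \<in> box_points q B"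
      by auto
    have t: "(B, y) \<in> tiles" using B yn by (auto simp: tiles_def)
    have "h a = h y + (\<Sum>b\<in>B. real (n b))"
      unfolding yn(1) linear_add[OF linear_h] using h_sum[OF basesD(1)[OF BB]] by simp
    then have "real (ht (B, y) + sum n B) = 1"
      using h_A[of a] a tilesD(5)[OF t] by simp
    then have sum1: "ht (B, y) + sum n B = 1"
      by (simp only: of_nat_eq_1_iff)
    \<comment> \<open>A box point of height zero is the origin. As \<open>q\<close> is positive on
      \<open>S\<close>, the origin belongs to the half-open cone of \<open>S\<close>, hence to that
      of no other optimal basis.\<close>
    have "ht (B, y) \<noteq> 0"
    proof
      assume "ht (B, y) = 0"
      then have "h y = 0" using tilesD(5)[OF t] by simp
      then have "(\<Sum>b\<in>B. coord B y b) = 0"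
        using h_eq_sum_coord[OF BB spanL[OF tilesD(4)[OF t]]] by simp
      moreover have nn: "coord B y b \<ge> 0" if "b \<in> B" for b
        using box_subset[OF q BB] yn(2) that by (force simp: half_open_cone_def)
      ultimately have zero: "coord B y b = 0" if "b \<in> B" for b
        using sum_nonneg_eq_0_iff[OF basesD(4)[OF BB]] that by blast
      then have "y = 0"
        using sum_coord[OF BB spanL[OF tilesD(4)[OF t]]] by simp
      then have "0 \<in> half_open_cone q B"
        using box_subset[OF q BB] yn(2) by auto
      moreover have "0 \<in> half_open_cone q S"
        using q_pos by (auto simp: half_open_cone_def span_zero representation_zero)
      ultimately show False
        using half_open_cone_unique[OF B(1) S_optimal q] ne by blast
    qed
    with sum1 have "sum n B = 0" by simp
    then have "a = y" using yn(1) basesD(4)[OF BB] by simp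
    with t ne show ?thesis by blast
  qed
  then obtain B where B: "\<And>a. a \<in> A - S \<Longrightarrow> (B a, a) \<in> tiles \<and> B a \<noteq> S"
    by metis
  \<comment> \<open>The tiles of the further vertices are disjoint from those of \<open>S\<close>
    because \<open>B a\<close> differs from \<open>S\<close>.\<close>
  have "card (box_points q S) + card (A - S) = card (Pair S ` box_points q S) + card ((\<lambda>a. (B a, a)) ` (A - S))"
    by (simp add: card_image inj_on_def)
  also have "\<dots> = card (Pair S ` box_points q S \<union> (\<lambda>a. (B a, a)) ` (A - S))"
    using B finite_A finite_box_points[OF S_basis] by (subst card_Un_disjoint) force+
  also have "\<dots> \<le> card tiles"
    using B box_tile by (intro card_mono finite_tiles) auto
  finally show ?thesis .
qed

text \<open>Integrality and vanishing together describe a lattice apex: the coordinate at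
  \<open>s\<close> is an integral function on \<open>L\<close> that is 1 at \<open>s\<close> and 0
  on the rest of \<open>A\<close>.\<close>

theorem apex_exists:
  assumes ext: "\<And>a. a \<in> A - S \<Longrightarrow> \<exists>s\<in>S. coord S a s < 0"
    and many: "(card tiles - 1) * (2 * d + 1) < card S"
  shows "\<exists>s\<in>S. (\<forall>x\<in>L. coord S x s \<in> \<int>) \<and> (\<forall>a\<in>A - S. coord S a s = 0)"
proof -
  let ?supp = "\<lambda>x. {s\<in>S. coord S x s \<noteq> 0}"
  have finS: "finite S" and finbox: "finite (box_points q S)"
    using basesD(4)[OF S_basis] finite_box_points[OF S_basis] by auto
  have "0 \<in> box_points q S"
    by (auto simp: box_S zero_mem representation_zero)
  define bad where "bad = (\<Union>g\<in>box_points q S - {0}. ?supp g) \<union> (\<Union>a\<in>A - S. ?supp a)"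
  have "card bad \<le> (\<Sum>g\<in>box_points q S - {0}. card (?supp g)) + (\<Sum>a\<in>A - S. card (?supp a))"
    unfolding bad_def using finbox finite_A
    by (intro order_trans[OF card_Un_le] add_mono card_UN_le) auto
  \<comment> \<open>The bound \<open>2 * d\<close> for box points is relaxed to
    \<open>2 * d + 1\<close>, so that both families are counted with the same weight.\<close>
  also have "\<dots> \<le> (\<Sum>g\<in>box_points q S - {0}. 2 * d + 1) + (\<Sum>a\<in>A - S. 2 * d + 1)"
    using card_box_support card_circuit_support by (intro add_mono sum_mono) (auto simp: le_SucI)
  also have "\<dots> = (card (box_points q S) - 1 + card (A - S)) * (2 * d + 1)"
    using \<open>0 \<in> box_points q S\<close> finbox by (simp add: distrib_right)
  also have "\<dots> \<le> (card tiles - 1) * (2 * d + 1)"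
  proof (rule mult_right_mono)
    have "card (box_points q S) \<noteq> 0" using \<open>0 \<in> box_points q S\<close> finbox by auto
    then show "card (box_points q S) - 1 + card (A - S) \<le> card tiles - 1"
      using card_tiles_ge[OF ext] by linarith
  qed simp
  also note many
  finally have "\<not> S \<subseteq> bad"
    using finS finite_A finbox card_mono[of bad S] by (auto simp: bad_def)
  then obtain s where s: "s \<in> S" "s \<notin> bad" by blast
  have "coord S x s \<in> \<int>" if x: "x \<in> L" for x
  proof -
    \<comment> \<open>The representative of \<open>x\<close> in the box of \<open>S\<close>. Since
      \<open>s\<close> avoids all supports, the coordinate of \<open>g\<close> at \<open>s\<close>,
      which is the fractional part of \<open>coord S x s\<close>, is zero.\<close>
    define g where "g = x + (\<Sum>s\<in>S. of_int (- \<lfloor>coord S x s\<rfloor>) *\<^sub>R s)"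
    have gL: "g \<in> L"
      unfolding g_def using S_subset_L x by (intro add_mem sum_mem of_int_mem)
    have cg: "coord S g r = coord S x r - of_int \<lfloor>coord S x r\<rfloor>" if "r \<in> S" for r
      unfolding g_def
      using coord_add_basis_sum[OF S_basis spanL[OF x] that, of "\<lambda>s. of_int (- \<lfloor>coord S x s\<rfloor>)"] by simp
    then have "g \<in> box_points q S"
      using gL by (auto simp: box_S floor_correct) linarith+
    then have "coord S g s = 0"
      using s by (cases "g = 0") (auto simp: bad_def representation_zero)
    then have "coord S x s = of_int \<lfloor>coord S x s\<rfloor>" using cg[OF s(1)] by simp
    then show ?thesis by (metis Ints_of_int)
  qed
  moreover have "coord S a s = 0" if "a \<in> A - S" for a
    using s that by (auto simp: bad_def)
  ultimately show ?thesis using s(1) by blast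
qed

end

section \<open>Volume and lattice points\<close>

text \<open>The coordinates are values of dual linear functionals, which are bounded in finite
  dimension; summing their bounds gives a common \<open>K\<close>.\<close>

lemma independent_family_coordinate_bound:
  fixes b :: "'i \<Rightarrow> 'a::euclidean_space"
  assumes "finite I" and inj: "inj_on b I" and indep: "independent (b ` I)"
  shows "\<exists>K\<ge>0. \<forall>c. \<forall>i\<in>I. \<bar>c i\<bar> \<le> K * norm (\<Sum>j\<in>I. c j *\<^sub>R b j)"
proof -
  have "\<exists>K\<ge>0. \<forall>c. \<bar>c i\<bar> \<le> K * norm (\<Sum>j\<in>I. c j *\<^sub>R b j)" if i: "i \<in> I" for i
  proof -
    obtain g where g: "linear g" "\<And>x. x \<in> b ` I \<Longrightarrow> g x = (if x = b i then 1 else (0::real))"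
      using linear_independent_extend[OF indep, of "\<lambda>x. if x = b i then 1 else 0"] by auto
    obtain K where K: "K > 0" "\<And>x. norm (g x) \<le> K * norm x"
      using linear_bounded_pos[OF g(1)] by blast
    have "c i = g (\<Sum>j\<in>I. c j *\<^sub>R b j)" for c
    proof -
      have "g (\<Sum>j\<in>I. c j *\<^sub>R b j) = (\<Sum>j\<in>I. c j * (if j = i then 1 else 0))"
        using g(2) inj i by (auto simp: linear_sum[OF g(1)] linear_cmul[OF g(1)] inj_on_eq_iff intro!: sum.cong)
      then show ?thesis using i \<open>finite I\<close> by (simp add: if_distrib cong: if_cong)
    qed
    then show ?thesis using K by (metis less_imp_le real_norm_def)
  qed
  then obtain K where K: "\<And>i. i \<in> I \<Longrightarrow> K i \<ge> 0" "\<And>i c. i \<in> I \<Longrightarrow> \<bar>c i\<bar> \<le> K i * norm (\<Sum>j\<in>I. c j *\<^sub>R b j)"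
    by metis
  have "K i \<le> sum K I" if "i \<in> I" for i
    using \<open>finite I\<close> K(1) that by (intro member_le_sum) auto
  then have "\<bar>c i\<bar> \<le> sum K I * norm (\<Sum>j\<in>I. c j *\<^sub>R b j)" if "i \<in> I" for c i
    using K(2)[OF that, of c] mult_right_mono[OF _ norm_ge_zero] that by (meson order_trans)
  then show ?thesis using K(1) sum_nonneg by blast
qed

text \<open>
  The half-open cubes of side \<open>1 / k\<close> at the points of \<open>Z k\<close> all lie in a fixed box, and a point
  lying in infinitely many of their unions is a limit of points of \<open>P\<close>.
\<close>

lemma measure_ge_lattice_point_density:
  fixes P :: "'a::euclidean_space set" and b :: "nat \<Rightarrow> 'a" and Z :: "nat \<Rightarrow> (nat \<Rightarrow> int) set" and n :: nat
  defines "N \<equiv> Pi\<^sub>M {..<n} (\<lambda>_. lborel :: real measure)"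
  assumes P: "compact P" and inj: "inj_on b {..<n}" and indep: "independent (b ` {..<n})"
    and Z: "\<And>k. Z k \<subseteq> {..<n} \<rightarrow>\<^sub>E UNIV"
    and ZP: "\<And>k z. k > 0 \<Longrightarrow> z \<in> Z k \<Longrightarrow> p + (\<Sum>i<n. (of_int (z i) / real k) *\<^sub>R b i) \<in> P"
    and f: "\<And>k. k > 0 \<Longrightarrow> f k \<le> real (card (Z k)) / real k ^ n" "f \<longlonglongrightarrow> c"
  shows "c \<le> measure N {x \<in> space N. p + (\<Sum>i<n. x i *\<^sub>R b i) \<in> P}"
proof -
  interpret product_sigma_finite "\<lambda>_::nat. lborel :: real measure" by standard
  let ?S = "{x \<in> space N. p + (\<Sum>i<n. x i *\<^sub>R b i) \<in> P}"
  obtain K where K: "K \<ge> 0" "\<And>c i. i < n \<Longrightarrow> \<bar>c i\<bar> \<le> K * norm (\<Sum>j<n. c j *\<^sub>R b j)"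
    using independent_family_coordinate_bound[OF _ inj indep] by auto
  obtain R where R: "\<And>x. x \<in> P \<Longrightarrow> norm x \<le> R"
    using compact_imp_bounded[OF P] by (auto simp: bounded_iff)
  \<comment> \<open>\<open>r\<close> bounds the frame coordinates of points of \<open>P\<close>. The
    bound \<open>r + 1\<close> of the box \<open>Bx\<close> leaves room for the cubes, whose side is
    at most 1.\<close>
  define r where "r = K * (R + norm p)"
  have coord: "\<bar>x i\<bar> \<le> r" if "p + (\<Sum>i<n. x i *\<^sub>R b i) \<in> P" "i < n" for x i
  proof -
    have "norm (\<Sum>i<n. x i *\<^sub>R b i) \<le> R + norm p"
      using R[OF that(1)] norm_triangle_ineq4[of "p + (\<Sum>i<n. x i *\<^sub>R b i)" p] by simp
    then have "K * norm (\<Sum>i<n. x i *\<^sub>R b i) \<le> r"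
      unfolding r_def using K(1) by (intro mult_left_mono)
    with K(2)[OF that(2), of x] show ?thesis by linarith
  qed
  define Bx where "Bx = Pi\<^sub>E {..<n} (\<lambda>_. {-r - 1..r + 1})"
  define cube where "cube k z = Pi\<^sub>E {..<n} (\<lambda>i. {of_int (z i) / real k ..< (of_int (z i) + 1) / real k})" for k and z :: "nat \<Rightarrow> int"
  define D where "D k = (\<Union>z\<in>Z k. cube k z)" for k
  have Bx_sets: "Bx \<in> sets N" and cube_sets: "\<And>k z. cube k z \<in> sets N"
    unfolding Bx_def cube_def N_def by (auto intro!: sets_PiM_I_finite)
  have Bx_fin: "emeasure N Bx \<noteq> \<infinity>"
    unfolding Bx_def N_def by (subst emeasure_PiM) (auto simp: emeasure_lborel_Icc_eq power_eq_top_ennreal)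
  have finZ: "finite (Z k)" if "k > 0" for k
  proof (rule finite_subset)
    show "Z k \<subseteq> {..<n} \<rightarrow>\<^sub>E {- \<lceil>r * k\<rceil> .. \<lceil>r * k\<rceil>}"
    proof (clarsimp simp: PiE_iff, intro conjI ballI)
      fix z assume z: "z \<in> Z k"
      then show "z \<in> extensional {..<n}" using Z[of k] unfolding PiE_def by blast
      fix i assume "i \<in> {..<n}"
      then have "\<bar>of_int (z i) / real k\<bar> \<le> r"
        using coord[OF ZP[OF \<open>k > 0\<close> z]] by auto
      then have "\<bar>of_int (z i)\<bar> \<le> r * k" using \<open>k > 0\<close> by (simp add: field_simps)
      then show "- \<lceil>r * k\<rceil> \<le> z i" "z i \<le> \<lceil>r * k\<rceil>" by linarith+
    qed
  qed (auto intro: finite_PiE)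
  have cube_measure: "measure N (cube k z) = 1 / real k ^ n" "emeasure N (cube k z) \<noteq> \<infinity>" if "k > 0" for k z
  proof -
    have "emeasure N (cube k z) = (\<Prod>i<n. ennreal (1 / real k))"
      unfolding cube_def N_def
      by (subst emeasure_PiM) (auto intro!: prod.cong arg_cong[of _ _ ennreal] simp: add_divide_distrib divide_right_mono)
    also have "\<dots> = ennreal (1 / real k ^ n)"
      by (simp add: ennreal_power power_one_over)
    finally have "emeasure N (cube k z) = ennreal (1 / real k ^ n)" .
    then show "measure N (cube k z) = 1 / real k ^ n" "emeasure N (cube k z) \<noteq> \<infinity>"
      by (auto simp: measure_def)
  qed
  have in_cube: "of_int (z i) / real k \<le> x i" "x i < (of_int (z i) + 1) / real k" if "x \<in> cube k z" "i < n" for x k z i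
    using that by (auto simp: cube_def PiE_iff)
  have disj: "disjoint_family_on (cube k) (Z k)" if "k > 0" for k
    unfolding disjoint_family_on_def
  proof (intro ballI impI, rule ccontr)
    fix z z' assume z: "z \<in> Z k" "z' \<in> Z k" "z \<noteq> z'" and "cube k z \<inter> cube k z' \<noteq> {}"
    then obtain x where x: "x \<in> cube k z" "x \<in> cube k z'" by blast
    have "z i = z' i" if "i < n" for i
    proof -
      have "of_int (z i) < real_of_int (z' i) + 1" "of_int (z' i) < real_of_int (z i) + 1"
        using order_le_less_trans[OF in_cube(1)[OF x(1) that] in_cube(2)[OF x(2) that]]
          order_le_less_trans[OF in_cube(1)[OF x(2) that] in_cube(2)[OF x(1) that]] \<open>k > 0\<close>
        by (auto simp: divide_less_cancel)
      then show ?thesis by linarith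
    qed
    then have "z = z'" using z Z[of k] by (intro PiE_ext[of z "{..<n}" "\<lambda>_. UNIV" z']) auto
    with z show False by simp
  qed
  have D_measure: "measure N (D k) = real (card (Z k)) / real k ^ n" if "k > 0" for k
    unfolding D_def using cube_measure[OF that] cube_sets
    by (subst measure_finite_Union[OF finZ[OF that] _ disj[OF that]]) auto
  have D_sets: "D k \<in> sets N" if "k > 0" for k
    unfolding D_def using cube_sets finZ[OF that] by auto
  have D_Bx: "D k \<subseteq> Bx" if "k > 0" for k
  proof
    fix x assume "x \<in> D k"
    then obtain z where z: "z \<in> Z k" "x \<in> cube k z" by (auto simp: D_def)
    have "- r - 1 \<le> x i \<and> x i \<le> r + 1" if "i < n" for i
    proof -
      have "\<bar>of_int (z i) / real k\<bar> \<le> r"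
        using coord[OF ZP[OF \<open>k > 0\<close> z(1)] that] .
      moreover have "(of_int (z i) + 1) / real k \<le> of_int (z i) / real k + 1"
        using \<open>k > 0\<close> by (simp add: add_divide_distrib)
      ultimately show ?thesis using in_cube[OF z(2) that] by linarith
    qed
    then show "x \<in> Bx" using z(2) by (auto simp: Bx_def cube_def PiE_iff)
  qed
  \<comment> \<open>Tails of the limsup of the sets \<open>D k\<close>. Each tail has measure at
    least \<open>c\<close>, and all lie in a box of finite measure, so continuity from above passes
    the bound to their intersection.\<close>
  define U where "U j = (\<Union>k\<in>{Suc j..}. D k)" for j
  have U_sets: "U j \<in> sets N" for j
    unfolding U_def using D_sets by (auto intro!: sets.countable_UN')
  have U_Bx: "U j \<subseteq> Bx" for j
    unfolding U_def by (intro UN_least D_Bx) auto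
  have U_fin: "emeasure N (U j) \<noteq> \<infinity>" for j
    using emeasure_mono[OF U_Bx Bx_sets, of j] Bx_fin by (auto simp: top_unique)
  have dec: "decseq U"
    unfolding decseq_def U_def by (intro allI impI UN_mono) auto
  have c_le: "c \<le> measure N (U j)" for j
  proof (rule LIMSEQ_le_const2[OF f(2)], intro exI[of _ "Suc j"] allI impI)
    fix k assume k: "Suc j \<le> k"
    then have "f k \<le> measure N (D k)"
      using f(1)[of k] D_measure[of k] by simp
    also have "\<dots> \<le> measure N (U j)"
      using k D_sets[of k] U_fin[of j] U_sets
      by (intro measure_mono_fmeasurable) (auto simp: U_def fmeasurable_def less_top)
    finally show "f k \<le> measure N (U j)" .
  qed
  have "c \<le> measure N (\<Inter>j. U j)"
    using Lim_measure_decseq[of U N] U_sets dec U_fin c_le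
    by (intro LIMSEQ_le_const[of "\<lambda>j. measure N (U j)"]) auto
  also have "\<dots> \<le> measure N ?S"
  proof (rule measure_mono_fmeasurable)
    show "(\<Inter>j. U j) \<in> sets N" using U_sets by auto
    have Ssets: "?S \<in> sets N"
    proof -
      have "(\<lambda>x. p + (\<Sum>i<n. x i *\<^sub>R b i)) \<in> borel_measurable N"
        unfolding N_def by measurable
      then show ?thesis
        using borel_closed[OF compact_imp_closed[OF P]] by (auto dest: measurable_sets simp: vimage_def Int_def conj_commute)
    qed
    have "?S \<subseteq> Bx"
      using coord by (force simp: Bx_def N_def space_PiM PiE_iff abs_le_iff)
    then have "emeasure N ?S \<le> emeasure N Bx" using Bx_sets by (rule emeasure_mono)
    then show "?S \<in> fmeasurable N"
      using Ssets Bx_fin by (auto simp: fmeasurable_def less_top top_unique)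
    show "(\<Inter>j. U j) \<subseteq> ?S"
    proof
      fix x assume x: "x \<in> (\<Inter>j. U j)"
      then have "x \<in> Bx" using U_Bx by blast
      then have "x \<in> space N" using sets.sets_into_space[OF Bx_sets] by blast
      moreover have "p + (\<Sum>i<n. x i *\<^sub>R b i) \<in> closure P"
      proof (subst closure_approachable, intro allI impI)
        fix e :: real assume "e > 0"
        define C where "C = (\<Sum>i<n. norm (b i))"
        have C: "C \<ge> 0" unfolding C_def by (intro sum_nonneg) auto
        \<comment> \<open>Beyond this index, a cube containing \<open>x\<close> has its corner,
          which represents a point of \<open>P\<close>, within \<open>C / k < e\<close> of the point
          represented by \<open>x\<close>.\<close>
        obtain j :: nat where j: "C / e < real j" using reals_Archimedean2 by blast
        obtain k z where k: "k > j" "z \<in> Z k" "x \<in> cube k z"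
          using x unfolding U_def D_def by (fastforce simp: Suc_le_eq)
        have k0: "k > 0" using k by simp
        let ?y = "p + (\<Sum>i<n. (of_int (z i) / real k) *\<^sub>R b i)"
        have "dist ?y (p + (\<Sum>i<n. x i *\<^sub>R b i)) = norm (\<Sum>i<n. (of_int (z i) / real k - x i) *\<^sub>R b i)"
          by (simp add: dist_norm scaleR_diff_left sum_subtractf)
        also have "\<dots> \<le> (\<Sum>i<n. norm (b i) / real k)"
        proof (rule sum_norm_le)
          fix i assume "i \<in> {..<n}"
          then have "\<bar>of_int (z i) / real k - x i\<bar> \<le> 1 / real k"
            using in_cube[OF k(3), of i] by (auto simp: add_divide_distrib)
          then have "\<bar>of_int (z i) / real k - x i\<bar> * norm (b i) \<le> 1 / real k * norm (b i)"
            by (intro mult_right_mono) auto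
          then show "norm ((of_int (z i) / real k - x i) *\<^sub>R b i) \<le> norm (b i) / real k"
            by simp
        qed
        also have "\<dots> = C / real k" by (simp add: C_def sum_divide_distrib)
        also have "\<dots> < e"
        proof -
          have "C / e < real k" using j k(1) by linarith
          then show ?thesis using \<open>e > 0\<close> k0 by (simp add: field_simps)
        qed
        finally show "\<exists>y\<in>P. dist y (p + (\<Sum>i<n. x i *\<^sub>R b i)) < e"
          using ZP[OF k0 k(2)] by blast
      qed
      ultimately show "x \<in> ?S" using compact_imp_closed[OF P] by simp
    qed
  qed
  finally show ?thesis .
qed

section \<open>Subgroups of lattices and adapted frames\<close>

definition int_span :: "'a::real_vector set \<Rightarrow> 'a set" where
  "int_span B = {\<Sum>b\<in>B. of_int (c b) *\<^sub>R b | c :: 'a \<Rightarrow> int. True}"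

lemma is_lattice_iff: "is_lattice M \<longleftrightarrow> (\<exists>B. finite B \<and> independent B \<and> M = int_span B)"
  by (simp add: is_lattice_def int_span_def)

lemma int_spanI: "x = (\<Sum>b\<in>B. of_int (c b) *\<^sub>R b) \<Longrightarrow> x \<in> int_span B"
  by (auto simp: int_span_def)

lemma int_span_zero: "0 \<in> int_span B"
  unfolding int_span_def by (auto intro: exI[of _ "\<lambda>_. 0"])

lemma int_span_diff: "x \<in> int_span B \<Longrightarrow> y \<in> int_span B \<Longrightarrow> x - y \<in> int_span B"
proof -
  assume "x \<in> int_span B" "y \<in> int_span B"
  then obtain c d where "x = (\<Sum>b\<in>B. of_int (c b) *\<^sub>R b)" "y = (\<Sum>b\<in>B. of_int (d b) *\<^sub>R b)"
    by (auto simp: int_span_def)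
  then have "x - y = (\<Sum>b\<in>B. of_int (c b - d b) *\<^sub>R b)"
    by (simp add: scaleR_diff_left sum_subtractf)
  then show ?thesis by (rule int_spanI)
qed

lemma subset_int_span: "finite B \<Longrightarrow> B \<subseteq> int_span B"
proof
  fix b assume "finite B" "b \<in> B"
  then have "b = (\<Sum>x\<in>B. of_int (if x = b then 1 else 0) *\<^sub>R x)"
    by (simp add: if_distrib[of of_int] if_distrib[of "\<lambda>r. r *\<^sub>R _"] cong: if_cong)
  then show "b \<in> int_span B" by (rule int_spanI)
qed

lemma int_span_subset_span: "int_span B \<subseteq> span B"
  unfolding int_span_def by (blast intro: span_sum span_scale span_base)

lemma int_span_insert:
  assumes "finite B" "b \<notin> B"
  shows "int_span (insert b B) = {of_int k *\<^sub>R b + r | k r. r \<in> int_span B}"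
proof (intro equalityI subsetI)
  fix x assume "x \<in> int_span (insert b B)"
  then obtain c where "x = (\<Sum>b\<in>insert b B. of_int (c b) *\<^sub>R b)" by (auto simp: int_span_def)
  then have "x = of_int (c b) *\<^sub>R b + (\<Sum>b\<in>B. of_int (c b) *\<^sub>R b)" using assms by simp
  then show "x \<in> {of_int k *\<^sub>R b + r | k r. r \<in> int_span B}"
    unfolding int_span_def by blast
next
  fix x assume "x \<in> {of_int k *\<^sub>R b + r | k r. r \<in> int_span B}"
  then obtain k c where x: "x = of_int k *\<^sub>R b + (\<Sum>b\<in>B. of_int (c b) *\<^sub>R b)"
    by (auto simp: int_span_def)
  have "(\<Sum>b\<in>B. of_int (c b) *\<^sub>R b) = (\<Sum>x\<in>B. of_int ((c(b := k)) x) *\<^sub>R x)"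
    using assms by (intro sum.cong) auto
  then have "x = (\<Sum>x\<in>insert b B. of_int ((c(b := k)) x) *\<^sub>R x)"
    using assms x by simp
  then show "x \<in> int_span (insert b B)"
    by (rule int_spanI)
qed

lemma (in additive_subgroup) int_span_subset: "B \<subseteq> H \<Longrightarrow> int_span B \<subseteq> H"
  by (auto simp: int_span_def intro!: sum_mem of_int_mem)

lemma additive_subgroup_lattice: "is_lattice M \<Longrightarrow> additive_subgroup M"
  by (auto simp: is_lattice_iff additive_subgroup_def int_span_zero int_span_diff)

text \<open>Induction on the rank. The \<open>b\<close>-coefficients occurring in \<open>H\<close>
  form an ideal \<open>I\<close> of the integers. If \<open>I\<close> is nonzero, an element
  \<open>v\<close> of \<open>H\<close> realising its least positive member completes a basis of
  \<open>H0\<close>, the kernel of the \<open>b\<close>-coefficient.\<close>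

lemma subgroup_of_int_span:
  assumes "finite B" "independent B" "additive_subgroup H" "H \<subseteq> int_span B"
  shows "\<exists>C. finite C \<and> independent C \<and> H = int_span C"
  using assms
proof (induction B arbitrary: H)
  case empty
  then have "H = int_span {}"
    by (auto simp: int_span_def additive_subgroup_def)
  then show ?case by (intro exI[of _ "{}"]) (auto simp: independent_empty)
next
  case (insert b B)
  interpret H: additive_subgroup H by fact
  have indB: "independent B" and bB: "b \<notin> span B"
    using insert.prems(1) insert.hyps by (auto simp: independent_insert)
  define H0 where "H0 = H \<inter> int_span B"
  have "additive_subgroup H0"
    unfolding H0_def by unfold_locales (auto simp: H.zero_mem H.diff_mem int_span_zero int_span_diff)
  then obtain C where C: "finite C" "independent C" "H0 = int_span C"
    using insert.IH[OF indB] by (auto simp: H0_def)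
  define I where "I = {k. \<exists>r\<in>int_span B. of_int k *\<^sub>R b + r \<in> H}"
  interpret BB: additive_subgroup "int_span B"
    by unfold_locales (auto simp: int_span_zero int_span_diff)
  have repr: "\<exists>k r. x = of_int k *\<^sub>R b + r \<and> r \<in> int_span B \<and> k \<in> I" if "x \<in> H" for x
    using insert.prems(3) that unfolding int_span_insert[OF insert.hyps] I_def by blast
  have comb: "of_int (k - m * g) *\<^sub>R b + (r - of_int m *\<^sub>R r') = (of_int k *\<^sub>R b + r) - of_int m *\<^sub>R (of_int g *\<^sub>R b + r')"
    for k m g :: int and r r'
    by (simp add: algebra_simps)
  have I_diff: "k - m * g \<in> I" if k: "k \<in> I" and g: "g \<in> I" for k m g
  proof -
    obtain r r' where r: "r \<in> int_span B" "of_int k *\<^sub>R b + r \<in> H" "r' \<in> int_span B" "of_int g *\<^sub>R b + r' \<in> H"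
      using k g by (auto simp: I_def)
    then have "of_int (k - m * g) *\<^sub>R b + (r - of_int m *\<^sub>R r') \<in> H"
      unfolding comb by (intro H.diff_mem H.of_int_mem)
    moreover have "r - of_int m *\<^sub>R r' \<in> int_span B"
      using r by (intro BB.diff_mem BB.of_int_mem)
    ultimately show ?thesis by (auto simp: I_def)
  qed
  show ?case
  proof (cases "I \<subseteq> {0}")
    case True
    have "H = H0"
      using repr True by (force simp: H0_def)
    with C show ?thesis by auto
  next
    case False
    then obtain k where k: "k \<in> I" "k \<noteq> 0" by auto
    have "0 \<in> I" using I_diff[OF k(1) k(1), of 1] by simp
    then have "- k \<in> I" using I_diff[OF _ k(1), of 0 1] by simp
    then have "\<exists>m. m > 0 \<and> int m \<in> I"
      using k by (cases "k > 0") (auto intro: exI[of _ "nat \<bar>k\<bar>"])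
    then obtain g where g: "g > 0" "int g \<in> I" and least: "\<And>m. m > 0 \<Longrightarrow> int m \<in> I \<Longrightarrow> g \<le> m"
      using exists_least_iff[of "\<lambda>m. m > 0 \<and> int m \<in> I"] by (metis linorder_not_less)
    have dvd: "int g dvd k" if "k \<in> I" for k
    proof (rule ccontr)
      assume "\<not> int g dvd k"
      then have "k mod int g \<noteq> 0" by presburger
      moreover have "k mod int g \<ge> 0" using g(1) by simp
      ultimately have "nat (k mod int g) > 0" by linarith
      moreover have "k mod int g \<in> I"
        using I_diff[OF that g(2), of "k div int g"] by (simp add: minus_div_mult_eq_mod)
      ultimately have "g \<le> nat (k mod int g)"
        using g(1) by (intro least) auto
      then show False using g(1) pos_mod_bound[of "int g" k] by linarith
    qed
    obtain r0 where r0: "r0 \<in> int_span B" "of_int (int g) *\<^sub>R b + r0 \<in> H"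
      using g(2) by (auto simp: I_def)
    define v where "v = of_int (int g) *\<^sub>R b + r0"
    have Cspan: "C \<subseteq> span B"
      using subset_int_span[OF C(1)] C(3) int_span_subset_span by (auto simp: H0_def)
    have "v \<notin> span B"
    proof
      assume "v \<in> span B"
      then have "v - r0 \<in> span B"
        using r0(1) int_span_subset_span by (intro span_diff) auto
      then have "(1 / real g) *\<^sub>R (v - r0) \<in> span B" by (rule span_scale)
      then show False using bB g(1) by (simp add: v_def)
    qed
    then have "v \<notin> span C"
      using Cspan by (metis span_mono span_span subsetD)
    then have vC: "v \<notin> C" "independent (insert v C)"
      using C(2) by (auto simp: independent_insert intro: span_base)
    have "H = int_span (insert v C)"
    proof
      show "int_span (insert v C) \<subseteq> H"
        using r0(2) C(3) subset_int_span[OF C(1)] by (intro H.int_span_subset) (auto simp: v_def H0_def)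
      show "H \<subseteq> int_span (insert v C)"
      proof
        fix x assume x: "x \<in> H"
        then obtain k r where kr: "x = of_int k *\<^sub>R b + r" "r \<in> int_span B" "k \<in> I"
          using repr by blast
        then obtain m where m: "k = m * int g" using dvd by (metis dvd_def mult.commute)
        have "x - of_int m *\<^sub>R v = r - of_int m *\<^sub>R r0"
          by (simp add: kr(1) m v_def algebra_simps)
        moreover have "r - of_int m *\<^sub>R r0 \<in> int_span B"
          using kr r0 by (intro BB.diff_mem BB.of_int_mem)
        moreover have "x - of_int m *\<^sub>R v \<in> H"
          using x r0(2) unfolding v_def by (intro H.diff_mem H.of_int_mem)
        ultimately have "x - of_int m *\<^sub>R v \<in> int_span C"
          using C(3) by (auto simp: H0_def)
        then show "x \<in> int_span (insert v C)"
          unfolding int_span_insert[OF C(1) vC(1)] mem_Collect_eq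
          by (intro exI[of _ m] exI[of _ "x - of_int m *\<^sub>R v"]) simp
      qed
    qed
    with vC C(1) show ?thesis by (intro exI[of _ "insert v C"]) auto
  qed
qed

lemma finite_lattice_Int_bounded:
  fixes M :: "'a::euclidean_space set"
  assumes "is_lattice M" "bounded X"
  shows "finite (M \<inter> X)"
proof -
  obtain B where B: "finite B" "independent B" "M = int_span B"
    using assms(1) by (auto simp: is_lattice_iff)
  obtain K where K: "K \<ge> 0" "\<And>c i. i \<in> B \<Longrightarrow> \<bar>c i\<bar> \<le> K * norm (\<Sum>j\<in>B. c j *\<^sub>R j)"
    using independent_family_coordinate_bound[of B "\<lambda>x. x"] B by auto
  obtain R where R: "\<And>x. x \<in> X \<Longrightarrow> norm x \<le> R"
    using assms(2) by (auto simp: bounded_iff)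
  have "M \<inter> X \<subseteq> (\<lambda>c. \<Sum>b\<in>B. of_int (c b) *\<^sub>R b) ` (B \<rightarrow>\<^sub>E {- \<lceil>K * R\<rceil>..\<lceil>K * R\<rceil>})"
  proof
    fix x assume x: "x \<in> M \<inter> X"
    then obtain c where c: "x = (\<Sum>b\<in>B. of_int (c b) *\<^sub>R b)" by (auto simp: B(3) int_span_def)
    have "restrict c B \<in> B \<rightarrow>\<^sub>E {- \<lceil>K * R\<rceil>..\<lceil>K * R\<rceil>}"
    proof (rule restrict_PiE_iff[THEN iffD2], intro ballI)
      fix b assume "b \<in> B"
      then have "\<bar>of_int (c b)\<bar> \<le> K * norm x" using K(2)[of b "\<lambda>b. of_int (c b)"] c by simp
      also have "\<dots> \<le> K * R" using R x K(1) by (intro mult_left_mono) auto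
      finally show "c b \<in> {- \<lceil>K * R\<rceil>..\<lceil>K * R\<rceil>}" by simp linarith
    qed
    then show "x \<in> (\<lambda>c. \<Sum>b\<in>B. of_int (c b) *\<^sub>R b) ` (B \<rightarrow>\<^sub>E {- \<lceil>K * R\<rceil>..\<lceil>K * R\<rceil>})"
      using c by (intro image_eqI[of _ _ "restrict c B"]) auto
  qed
  then show ?thesis
    using B(1) by (meson finite_PiE finite_atLeastAtMost_int finite_imageI finite_subset)
qed

text \<open>\<open>H\<close> collects the lattice translations of the affine hull. As a subgroup of
  \<open>M\<close> it has a basis, and since \<open>C\<close> consists of lattice points it spans
  the whole direction space, so its rank is \<open>n\<close>.\<close>

lemma lattice_frame_exists:
  fixes M :: "'a::euclidean_space set"
  assumes M: "is_lattice M" and C: "C \<subseteq> M" "aff_dim C = int n" and p: "p \<in> affine hull C \<inter> M"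
  shows "\<exists>b. lattice_frame (affine hull C \<inter> M) n p b"
proof -
  interpret M: additive_subgroup M by (rule additive_subgroup_lattice[OF M])
  define H where "H = {v \<in> M. p + v \<in> affine hull C}"
  have "additive_subgroup H"
  proof
    show "0 \<in> H" using p M.zero_mem by (auto simp: H_def)
    fix x y assume xy: "x \<in> H" "y \<in> H"
    have "(p + x) - (p + y) + p \<in> affine hull C"
      using xy p mem_affine_3_minus[OF affine_affine_hull, of p C "p + x" "p + y" 1]
      by (auto simp: H_def algebra_simps)
    then show "x - y \<in> H"
      using xy M.diff_mem by (auto simp: H_def algebra_simps)
  qed
  then obtain D where D: "finite D" "independent D" "H = int_span D"
    using M subgroup_of_int_span[of _ H] by (auto simp: is_lattice_iff H_def)
  define V where "V = (\<lambda>x. - p + x) ` C"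
  have "V \<subseteq> H"
    using C(1) p M.diff_mem by (auto simp: V_def H_def hull_inc)
  have hull: "affine hull C = (\<lambda>x. p + x) ` span V"
  proof -
    have "affine hull C = affine hull (insert p C)"
      using p by (metis hull_redundant IntD1)
    also have "\<dots> = (\<lambda>x. p + x) ` span ((\<lambda>x. - p + x) ` (insert p C - {p}))"
      by (rule affine_hull_span2) simp
    also have "insert 0 ((\<lambda>x. - p + x) ` (insert p C - {p})) = insert 0 V"
      by (auto simp: V_def)
    then have "span ((\<lambda>x. - p + x) ` (insert p C - {p})) = span V"
      by (metis span_insert_0)
    finally show ?thesis .
  qed
  have "H \<subseteq> span V" by (auto simp: H_def hull)
  then have "span D = span V"
    using \<open>V \<subseteq> H\<close> D(3) subset_int_span[OF D(1)] int_span_subset_span[of D]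
    by (metis span_eq subset_trans)
  moreover have "int (dim V) = int n"
    using aff_dim_eq_dim[of p C] p C(2) by (simp add: V_def)
  ultimately have "card D = n"
    using dim_eq_card_independent[OF D(2)] by (metis dim_span of_nat_eq_iff)
  then obtain b where b: "bij_betw b {..<n} D"
    using ex_bij_betw_nat_finite[OF D(1)] by (metis atLeast0LessThan)
  then have bD: "inj_on b {..<n}" "b ` {..<n} = D" by (auto simp: bij_betw_def)
  have "affine hull C \<inter> M = {p + v | v. v \<in> H}"
  proof (intro equalityI subsetI)
    fix x assume x: "x \<in> affine hull C \<inter> M"
    then have "x - p \<in> H" using p M.diff_mem by (auto simp: H_def)
    then show "x \<in> {p + v | v. v \<in> H}" by (intro CollectI exI[of _ "x - p"]) simp
  qed (use p M.add_mem in \<open>auto simp: H_def\<close>)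
  also have "H = {\<Sum>i<n. of_int (z i) *\<^sub>R b i | z :: nat \<Rightarrow> int. True}"
  proof (intro equalityI subsetI)
    fix x assume "x \<in> H"
    then obtain c where "x = (\<Sum>d\<in>D. of_int (c d) *\<^sub>R d)" by (auto simp: D(3) int_span_def)
    then have "x = (\<Sum>i<n. of_int ((c \<circ> b) i) *\<^sub>R b i)"
      by (simp add: bD(2)[symmetric] sum.reindex[OF bD(1)])
    then show "x \<in> {\<Sum>i<n. of_int (z i) *\<^sub>R b i | z :: nat \<Rightarrow> int. True}" by blast
  next
    fix x assume "x \<in> {\<Sum>i<n. of_int (z i) *\<^sub>R b i | z :: nat \<Rightarrow> int. True}"
    then obtain z where z: "x = (\<Sum>i<n. of_int (z i) *\<^sub>R b i)" by blast
    interpret H: additive_subgroup H by fact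
    show "x \<in> H"
      unfolding z using bD subset_int_span[OF D(1)] D(3) by (intro H.sum_mem H.of_int_mem) auto
  qed
  finally have "affine hull C \<inter> M = {p + (\<Sum>i<n. of_int (z i) *\<^sub>R b i) | z :: nat \<Rightarrow> int. True}"
    by auto
  then show ?thesis
    unfolding lattice_frame_def using bD D(2) by (intro exI[of _ b]) auto
qed

section \<open>Standard pyramids\<close>

definition emb :: "nat \<Rightarrow> (nat \<Rightarrow> real) \<Rightarrow> vec" where
  "emb n x = (\<Sum>i<n. x i *\<^sub>R Poly_Mapping.single i 1)"

lemma lookup_scaleR: "Poly_Mapping.lookup (r *\<^sub>R x :: vec) i = r * Poly_Mapping.lookup x i"
proof -
  have "finite {i. r *\<^sub>R Poly_Mapping.lookup x i \<noteq> 0}"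
    by (rule finite_subset[OF _ finite_lookup[of x]]) auto
  then show ?thesis by (simp add: scaleR_poly_mapping_def)
qed

lemma lookup_emb: "Poly_Mapping.lookup (emb n x) i = (if i < n then x i else 0)"
  by (simp add: emb_def lookup_sum lookup_scaleR lookup_single when_def if_distrib[of "\<lambda>y. _ * y"] cong: if_cong)

lemma emb_in_int_lattice: "emb n x \<in> int_lattice m \<longleftrightarrow> (\<forall>i<n. x i \<in> \<int> \<and> (i < m \<or> x i = 0))"
  by (auto simp: int_lattice_def lookup_emb in_keys_iff subset_iff split: if_splits)

lemma vertices_convex_hull_subset: "vertices (convex hull X) \<subseteq> X"
  by (auto simp: vertices_def dest: extreme_point_of_convex_hull)

lemma convex_hull_vertices:
  fixes P :: "'a::euclidean_space set"
  assumes "polytope P"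
  shows "finite (vertices P)" "convex hull (vertices P) = P"
proof -
  show "convex hull (vertices P) = P"
    unfolding vertices_def
    by (rule Krein_Milman_Minkowski[OF polytope_imp_compact polytope_imp_convex, OF assms assms, symmetric])
  obtain X where "finite X" "P = convex hull X"
    using assms by (auto simp: polytope_def)
  then show "finite (vertices P)"
    using vertices_convex_hull_subset finite_subset by blast
qed

lemma vertices_affine_image:
  assumes g: "linear g" and inj: "inj_on f P" and P: "convex P"
    and f: "\<And>x. x \<in> P \<Longrightarrow> f x = g x + c"
  shows "f ` vertices P \<subseteq> vertices (f ` P)"
proof
  fix y assume "y \<in> f ` vertices P"
  then obtain x where x: "y = f x" "x \<in> P" and ext: "\<And>a b. a \<in> P \<Longrightarrow> b \<in> P \<Longrightarrow> x \<notin> open_segment a b"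
    by (auto simp: vertices_def extreme_point_of_def)
  have "f x \<notin> open_segment (f a) (f b)" if ab: "a \<in> P" "b \<in> P" for a b
  proof
    assume "f x \<in> open_segment (f a) (f b)"
    then obtain u where u: "f a \<noteq> f b" "0 < u" "u < 1" "f x = (1 - u) *\<^sub>R f a + u *\<^sub>R f b"
      by (auto simp: in_segment)
    define z where "z = (1 - u) *\<^sub>R a + u *\<^sub>R b"
    have zP: "z \<in> P"
      using P ab u unfolding z_def by (intro convexD) auto
    have "f z = (1 - u) *\<^sub>R f a + u *\<^sub>R f b"
      unfolding f[OF zP] f[OF ab(1)] f[OF ab(2)]
      by (simp add: z_def linear_add[OF g] linear_diff[OF g] linear_cmul[OF g] algebra_simps)
    then have "x = z" using inj_onD[OF inj, of x z] x(2) zP u(4) by simp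
    then have "x \<in> open_segment a b" using u by (auto simp: in_segment z_def)
    with ext[OF ab] show False by simp
  qed
  then show "y \<in> vertices (f ` P)"
    using x by (auto simp: vertices_def extreme_point_of_def)
qed

lemma lattice_polytope_empty: "lattice_polytope M {}"
  by (auto simp: lattice_polytope_def vertices_def extreme_point_of_def polytope_def intro: exI[of _ "{}"])

text \<open>Dimension zero follows the convention for the empty set: \<open>k = 0\<close> and
  \<open>B = {}\<close>, whose one-fold pyramid is the origin.\<close>

lemma lattice_pyramid_point:
  fixes P :: "'a::euclidean_space set"
  assumes P: "lattice_polytope M P" and dim: "aff_dim P = 0"
  shows "lattice_pyramid M P {}"
proof -
  obtain s where s: "P = {s}" using dim by (auto simp: aff_dim_eq_0)
  have v: "vertices {x} = {x}" for x :: "'b::real_vector"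
    by (auto simp: vertices_def extreme_point_of_def)
  then have "s \<in> M" using P by (auto simp: lattice_polytope_def s)
  have hull0: "affine hull {0 :: vec} = {0}"
    by (rule hull_same) (auto simp: affine_def)
  have "lattice_iso M P (int_lattice 1) {0} (\<lambda>_. 0)"
    unfolding lattice_iso_def s
    using \<open>s \<in> M\<close> by (auto simp: v hull0 int_lattice_def bij_betw_def intro!: exI[of _ "\<lambda>_. 0"] exI[of _ 0] module_hom_zero)
  moreover have "iterated_pyramid 0 1 {} = {0}" by (simp add: std_pyramid_def)
  moreover have "nat (aff_dim P - aff_dim ({} :: 'a set)) = 1" by (simp add: dim)
  ultimately have "lattice_polytope (int_lattice 0) {} \<and>
      lattice_iso M P (int_lattice (0 + nat (aff_dim P - aff_dim ({} :: 'a set))))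
        (iterated_pyramid 0 (nat (aff_dim P - aff_dim ({} :: 'a set))) {}) (\<lambda>_. 0) \<and>
      (\<lambda>_. 0) ` {} = base_copy 0 (nat (aff_dim P - aff_dim ({} :: 'a set))) {}"
    by (simp add: base_copy_def lattice_polytope_empty)
  then have "\<exists>k B f. lattice_polytope (int_lattice k) B \<and>
      lattice_iso M P (int_lattice (k + nat (aff_dim P - aff_dim ({} :: 'a set))))
        (iterated_pyramid k (nat (aff_dim P - aff_dim ({} :: 'a set))) B) f \<and>
      f ` {} = base_copy k (nat (aff_dim P - aff_dim ({} :: 'a set))) B"
    by (intro exI)
  then show ?thesis
    unfolding lattice_pyramid_def Let_def using P lattice_polytope_empty[of M]
    by (intro conjI empty_subsetI)
qed

text \<open>The frame vectors are independent, lie in the direction space and are as many as its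
  dimension, so real coefficients reach the whole hull.\<close>

lemma lattice_frame_affine_hull:
  fixes X :: "'a::euclidean_space set"
  assumes frame: "lattice_frame (affine hull X \<inter> M) n s b" and dim: "aff_dim X = int n"
  shows "affine hull X = {s + (\<Sum>i<n. c i *\<^sub>R b i) | c. True}"
proof -
  have inj: "inj_on b {..<n}" and indep: "independent (b ` {..<n})"
    and L: "affine hull X \<inter> M = {s + (\<Sum>i<n. of_int (z i) *\<^sub>R b i) | z :: nat \<Rightarrow> int. True}"
    using frame by (auto simp: lattice_frame_def)
  have "s + (\<Sum>i<n. of_int 0 *\<^sub>R b i) \<in> affine hull X \<inter> M"
    unfolding L by (intro CollectI exI[of _ "\<lambda>_. 0"] conjI refl TrueI)
  then have s: "s \<in> affine hull X" by simp
  define V where "V = (\<lambda>x. - s + x) ` (affine hull X)"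
  have sub: "subspace V"
    unfolding V_def by (rule affine_diffs_subspace[OF affine_affine_hull s])
  have bV: "b i \<in> V" if "i < n" for i
  proof -
    have "s + (\<Sum>j<n. of_int (if j = i then 1 else 0) *\<^sub>R b j) \<in> affine hull X \<inter> M"
      unfolding L by (intro CollectI exI[of _ "\<lambda>j. if j = i then 1 else 0"] conjI refl TrueI)
    also have "(\<Sum>j<n. of_int (if j = i then 1 else 0) *\<^sub>R b j) = b i"
      using that by (simp add: if_distrib[of of_int] if_distrib[of "\<lambda>r. r *\<^sub>R _"] cong: if_cong)
    finally show ?thesis unfolding V_def by (intro image_eqI[of _ _ "s + b i"]) auto
  qed
  have "int (dim V) = int n"
    using aff_dim_eq_dim[of s "affine hull X"] s dim by (simp add: V_def)
  then have V: "V \<subseteq> span (b ` {..<n})"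
    using bV indep card_image[OF inj] by (intro card_ge_dim_independent) auto
  show ?thesis
  proof (intro equalityI subsetI)
    fix x assume "x \<in> affine hull X"
    then have "- s + x \<in> span (b ` {..<n})" using V by (auto simp: V_def)
    then obtain u where "- s + x = (\<Sum>v\<in>b ` {..<n}. u v *\<^sub>R v)"
      by (auto simp: span_finite)
    then have "x = s + (\<Sum>i<n. (u \<circ> b) i *\<^sub>R b i)"
      by (simp add: sum.reindex[OF inj] algebra_simps)
    then show "x \<in> {s + (\<Sum>i<n. c i *\<^sub>R b i) | c. True}" by blast
  next
    fix x assume "x \<in> {s + (\<Sum>i<n. c i *\<^sub>R b i) | c. True}"
    then obtain c where c: "x = s + (\<Sum>i<n. c i *\<^sub>R b i)" by blast
    have "(\<Sum>i<n. c i *\<^sub>R b i) \<in> V"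
      using bV sub by (intro subspace_sum subspace_scale) auto
    then show "x \<in> affine hull X" by (auto simp: V_def c)
  qed
qed

text \<open>With the apex as origin of the frame and the base at last coordinate 1, the coordinate
  map itself is the isomorphism: a standard pyramid has its apex at 0 and its base at height 1 in
  coordinate \<open>k\<close>.\<close>

lemma lattice_pyramid_of_frame:
  fixes M P Q :: "'a::euclidean_space set"
  assumes P: "lattice_polytope M P" and Q: "lattice_polytope M Q"
    and dimP: "aff_dim P = int (Suc k)" and dimQ: "aff_dim Q = int k"
    and PQ: "P = convex hull (insert s Q)"
    and frame: "lattice_frame (affine hull P \<inter> M) (Suc k) s b"
    and base: "\<And>x. x \<in> Q \<Longrightarrow> \<exists>c. x = s + (\<Sum>i<Suc k. c i *\<^sub>R b i) \<and> c k = 1"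
  shows "lattice_pyramid M P Q"
proof -
  have inj: "inj_on b {..<Suc k}" and indep: "independent (b ` {..<Suc k})"
    and L: "affine hull P \<inter> M = {s + (\<Sum>i<Suc k. of_int (z i) *\<^sub>R b i) | z :: nat \<Rightarrow> int. True}"
    using frame by (auto simp: lattice_frame_def)
  obtain g0 where g0: "linear g0" "\<And>x. x \<in> b ` {..<Suc k} \<Longrightarrow> g0 x = (Poly_Mapping.single (inv_into {..<Suc k} b x) 1 :: vec)"
    using linear_independent_extend[OF indep, of "\<lambda>x. Poly_Mapping.single (inv_into {..<Suc k} b x) 1"] by blast
  have g0b: "g0 (b i) = Poly_Mapping.single i 1" if "i < Suc k" for i
    using g0(2)[of "b i"] inv_into_f_f[OF inj, of i] that by auto
  define f where "f x = g0 x + (- g0 s)" for x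
  have f_frame: "f (s + (\<Sum>i<Suc k. c i *\<^sub>R b i)) = emb (Suc k) c" for c
    unfolding f_def linear_add[OF g0(1)] linear_sum[OF g0(1)] linear_cmul[OF g0(1)] emb_def
    using g0b by (simp del: sum.lessThan_Suc)
  have affP: "\<exists>c. x = s + (\<Sum>i<Suc k. c i *\<^sub>R b i)" if "x \<in> affine hull P" for x
    using lattice_frame_affine_hull[OF frame dimP] that by blast
  have f_inj: "inj_on f (affine hull P)"
  proof (rule inj_onI)
    fix x y assume xy: "x \<in> affine hull P" "y \<in> affine hull P" "f x = f y"
    obtain c d where c: "x = s + (\<Sum>i<Suc k. c i *\<^sub>R b i)" and d: "y = s + (\<Sum>i<Suc k. d i *\<^sub>R b i)"
      using affP xy(1,2) by blast
    have "c i = d i" if "i < Suc k" for i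
      using arg_cong[OF xy(3), of "\<lambda>v. Poly_Mapping.lookup v i"] that unfolding c d f_frame by (simp add: lookup_emb)
    then show "x = y" unfolding c d by simp
  qed
  have PsubH: "P \<subseteq> affine hull P" by (rule hull_subset)
  have fX: "f ` Y = (\<lambda>v. - g0 s + v) ` (g0 ` Y)" for Y
    by (auto simp: f_def image_image algebra_simps)
  have f_conv: "f ` (convex hull X) = convex hull (f ` X)" and f_poly: "polytope X \<Longrightarrow> polytope (f ` X)" for X
  proof -
    show "f ` (convex hull X) = convex hull (f ` X)"
      by (simp only: fX convex_hull_translation convex_hull_linear_image[OF g0(1)])
    then show "polytope (f ` X)" if "polytope X"
      using that unfolding polytope_def by (metis fX convex_hull_linear_image[OF g0(1)] convex_hull_translation finite_imageI)
  qed
  have f_aff: "f ` (affine hull P) = affine hull (f ` P)"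
    using g0(1) by (simp only: fX affine_hull_translation affine_hull_linear_image linear_conv_bounded_linear)
  have vP: "f ` vertices P = vertices (f ` P)"
  proof
    show "f ` vertices P \<subseteq> vertices (f ` P)"
      using P inj_on_subset[OF f_inj PsubH]
      by (intro vertices_affine_image[OF g0(1), where c = "- g0 s"]) (auto simp: f_def lattice_polytope_def polytope_imp_convex)
    have "f ` P = convex hull (f ` vertices P)"
      using convex_hull_vertices(2)[of P] P f_conv[of "vertices P"] by (auto simp: lattice_polytope_def)
    then show "vertices (f ` P) \<subseteq> f ` vertices P"
      using vertices_convex_hull_subset by metis
  qed
  \<comment> \<open>Undoing the shift by \<open>e\<close> moves the image of the base into the
    coordinates below \<open>k\<close>.\<close>
  define e where "e = (Poly_Mapping.single k 1 :: vec)"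
  define B where "B = (\<lambda>x. f x - e) ` Q"
  have fQ: "f ` Q = (\<lambda>x. x + e) ` B"
    by (auto simp: B_def image_image)
  have Qemb: "\<exists>c. x = s + (\<Sum>i<Suc k. c i *\<^sub>R b i) \<and> f x - e = emb k c" if xQ: "x \<in> Q" for x
  proof -
    obtain c where c: "x = s + (\<Sum>i<Suc k. c i *\<^sub>R b i)" "c k = 1" using base[OF xQ] by blast
    have "f x = emb (Suc k) c" unfolding c(1) by (rule f_frame)
    also have "\<dots> = emb k c + e" using c(2) by (simp add: emb_def e_def)
    finally show ?thesis using c(1) by auto
  qed
  have Beq: "B = (\<lambda>v. - e + v) ` (f ` Q)" by (auto simp: B_def image_image)
  have Bpoly: "lattice_polytope (int_lattice k) B"
    unfolding lattice_polytope_def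
  proof
    have Qp: "polytope Q" using Q by (simp add: lattice_polytope_def)
    show "polytope B" unfolding Beq
      using f_poly[OF Qp] unfolding polytope_def by (metis convex_hull_translation finite_imageI)
    have "B = convex hull ((\<lambda>x. f x - e) ` vertices Q)"
    proof -
      have "B = (\<lambda>v. - e + v) ` (convex hull (f ` vertices Q))"
        using convex_hull_vertices(2)[OF Qp] f_conv[of "vertices Q"] Beq by simp
      also have "\<dots> = convex hull ((\<lambda>v. - e + v) ` f ` vertices Q)"
        by (simp only: convex_hull_translation)
      finally show ?thesis by (simp add: image_image)
    qed
    then have "vertices B \<subseteq> (\<lambda>x. f x - e) ` vertices Q"
      using vertices_convex_hull_subset by metis
    also have "\<dots> \<subseteq> int_lattice k"
    proof
      fix y assume "y \<in> (\<lambda>x. f x - e) ` vertices Q"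
      then obtain x where x: "y = f x - e" "x \<in> vertices Q" by blast
      have xQ: "x \<in> Q" "x \<in> M" using x(2) Q by (auto simp: vertices_def extreme_point_of_def lattice_polytope_def)
      have "x \<in> P" using xQ PQ by (simp add: hull_inc)
      then have "x \<in> affine hull P \<inter> M" using xQ PsubH by auto
      then obtain z :: "nat \<Rightarrow> int" where z: "x = s + (\<Sum>i<Suc k. of_int (z i) *\<^sub>R b i)"
        unfolding L by blast
      obtain c where c: "x = s + (\<Sum>i<Suc k. c i *\<^sub>R b i)" "f x - e = emb k c"
        using Qemb[OF xQ(1)] by blast
      have eq: "emb (Suc k) (\<lambda>i. of_int (z i)) = emb (Suc k) c"
        using f_frame[of "\<lambda>i. of_int (z i)"] f_frame[of c] z c(1) by simp
      have "c i = of_int (z i)" if "i < k" for i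
        using arg_cong[OF eq, of "\<lambda>v. Poly_Mapping.lookup v i"] that by (simp add: lookup_emb)
      then show "y \<in> int_lattice k"
        using x(1) c(2) by (auto simp: emb_in_int_lattice)
    qed
    finally show "vertices B \<subseteq> int_lattice k" .
  qed
  have f0: "f s = 0" by (simp add: f_def)
  have pyr: "iterated_pyramid k 1 B = f ` P"
    unfolding PQ f_conv by (simp add: std_pyramid_def f0 fQ e_def)
  have iso: "lattice_iso M P (int_lattice (Suc k)) (f ` P) f"
    unfolding lattice_iso_def
  proof (intro conjI exI[of _ g0] exI[of _ "- g0 s"] ballI vP)
    show "linear g0" by fact
    show "f x = g0 x + - g0 s" for x by (simp add: f_def)
    show "bij_betw f (affine hull P \<inter> M) (affine hull f ` P \<inter> int_lattice (Suc k))"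
      unfolding bij_betw_def
    proof
      show "inj_on f (affine hull P \<inter> M)" using f_inj by (rule inj_on_subset) auto
      show "f ` (affine hull P \<inter> M) = affine hull f ` P \<inter> int_lattice (Suc k)"
      proof (intro equalityI subsetI)
        fix y assume "y \<in> f ` (affine hull P \<inter> M)"
        then obtain x where x: "y = f x" "x \<in> affine hull P \<inter> M" by blast
        then obtain z :: "nat \<Rightarrow> int" where z: "x = s + (\<Sum>i<Suc k. of_int (z i) *\<^sub>R b i)"
          unfolding L by blast
        have "y = emb (Suc k) (\<lambda>i. of_int (z i))"
          unfolding x(1) z by (rule f_frame)
        then have "y \<in> int_lattice (Suc k)" by (simp add: emb_in_int_lattice)
        then show "y \<in> affine hull f ` P \<inter> int_lattice (Suc k)"
          using x f_aff by blast
      next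
        fix y assume y: "y \<in> affine hull f ` P \<inter> int_lattice (Suc k)"
        then obtain x where x: "y = f x" "x \<in> affine hull P" using f_aff by blast
        obtain c where c: "x = s + (\<Sum>i<Suc k. c i *\<^sub>R b i)" using affP[OF x(2)] by blast
        have "y = emb (Suc k) c" unfolding x(1) c by (rule f_frame)
        then have "c i \<in> \<int>" if "i < Suc k" for i
          using y that by (auto simp: emb_in_int_lattice)
        then have ci: "of_int \<lfloor>c i\<rfloor> = c i" if "i < Suc k" for i
          using that by (metis Ints_cases floor_of_int)
        have "(\<Sum>i<Suc k. of_int \<lfloor>c i\<rfloor> *\<^sub>R b i) = (\<Sum>i<Suc k. c i *\<^sub>R b i)"
          by (rule sum.cong) (simp_all only: lessThan_iff ci)
        then have "x = s + (\<Sum>i<Suc k. of_int \<lfloor>c i\<rfloor> *\<^sub>R b i)"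
          unfolding c by (rule arg_cong[OF sym])
        then have "x \<in> affine hull P \<inter> M"
          unfolding L by (intro CollectI exI[of _ "\<lambda>i. \<lfloor>c i\<rfloor>"] conjI TrueI)
        then show "y \<in> f ` (affine hull P \<inter> M)" using x(1) by blast
      qed
    qed
  qed
  show ?thesis
    unfolding lattice_pyramid_def Let_def
  proof (intro conjI exI[of _ k] exI[of _ B] exI[of _ f])
    have l: "nat (aff_dim P - aff_dim Q) = 1" using dimP dimQ by simp
    show "lattice_polytope (int_lattice k) B" by (rule Bpoly)
    show "Q \<subseteq> P" using PQ by (auto intro: hull_inc)
    show "lattice_iso M P (int_lattice (k + nat (aff_dim P - aff_dim Q))) (iterated_pyramid k (nat (aff_dim P - aff_dim Q)) B) f"
      unfolding l pyr using iso by simp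
    have e: "(\<Sum>i<1. Poly_Mapping.single (k + i) 1) = e"
      by (simp add: e_def)
    show "f ` Q = base_copy k (nat (aff_dim P - aff_dim Q)) B"
      unfolding l base_copy_def e by (rule fQ)
  qed (fact P Q)+
qed

section \<open>The cone over a lattice polytope\<close>

abbreviation homogenize :: "'a::real_vector set \<Rightarrow> ('a \<times> real) set" where
  "homogenize X \<equiv> (\<lambda>v. (v, 1)) ` X"

lemma inj_on_homogenize: "inj_on (\<lambda>v. (v, 1 :: real)) X"
  by (auto simp: inj_on_def)

lemma sum_homogenize:
  "(\<Sum>a\<in>homogenize X. c a *\<^sub>R a) = ((\<Sum>v\<in>X. c (v, 1) *\<^sub>R v), \<Sum>v\<in>X. c (v, 1))"
  by (simp add: sum.reindex[OF inj_on_homogenize] sum_prod)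

lemma independent_homogenize:
  assumes "finite C" "\<not> affine_dependent C"
  shows "independent (homogenize C)"
proof
  assume "dependent (homogenize C)"
  then obtain u v where u: "(\<Sum>a\<in>homogenize C. u a *\<^sub>R a) = 0" "v \<in> C" "u (v, 1) \<noteq> 0"
    using assms(1) by (auto simp: dependent_finite)
  then have "(\<Sum>v\<in>C. u (v, 1) *\<^sub>R v) = 0" "(\<Sum>v\<in>C. u (v, 1)) = 0"
    unfolding sum_homogenize by (simp_all add: zero_prod_def)
  with u(2,3) assms show False
    by (auto simp: affine_dependent_explicit_finite dest: spec[of _ "\<lambda>v. u (v, 1)"])
qed

lemma affine_hull_homogenize:
  assumes "finite X"
  shows "x \<in> affine hull X \<longleftrightarrow> (x, 1) \<in> span (homogenize X)"
proof
  assume "x \<in> affine hull X"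
  then obtain u where u: "sum u X = 1" "(\<Sum>v\<in>X. u v *\<^sub>R v) = x"
    using assms by (auto simp: affine_hull_finite)
  then have "(x, 1) = (\<Sum>a\<in>homogenize X. u (fst a) *\<^sub>R a)"
    by (simp add: sum_homogenize)
  also have "\<dots> \<in> span (homogenize X)"
    by (intro span_sum span_scale span_base)
  finally show "(x, 1) \<in> span (homogenize X)" .
next
  assume "(x, 1) \<in> span (homogenize X)"
  then obtain u where "(x, 1) = (\<Sum>a\<in>homogenize X. u a *\<^sub>R a)"
    using assms by (auto simp: span_finite)
  then show "x \<in> affine hull X"
    using assms by (auto simp: sum_homogenize affine_hull_finite intro!: exI[of _ "\<lambda>v. u (v, 1)"])
qed

lemma cone_of_homogenize:
  assumes X: "finite X" "X \<noteq> {}"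
  shows "(x, real k) \<in> cone_of (homogenize X) \<longleftrightarrow> x \<in> (\<lambda>x. real k *\<^sub>R x) ` (convex hull X)"
proof
  assume "(x, real k) \<in> cone_of (homogenize X)"
  then obtain c where "\<forall>a\<in>homogenize X. c a \<ge> 0" "(x, real k) = (\<Sum>a\<in>homogenize X. c a *\<^sub>R a)"
    unfolding cone_of_def by blast
  then have c: "\<And>v. v \<in> X \<Longrightarrow> c (v, 1) \<ge> 0" "x = (\<Sum>v\<in>X. c (v, 1) *\<^sub>R v)" "real k = (\<Sum>v\<in>X. c (v, 1))"
    by (auto simp: sum_homogenize)
  show "x \<in> (\<lambda>x. real k *\<^sub>R x) ` (convex hull X)"
  proof (cases "k = 0")
    \<comment> \<open>At height zero only the origin remains, and the dilate by 0 is exactly this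
      point because \<open>X\<close> is nonempty.\<close>
    case True
    then have "\<forall>v\<in>X. c (v, 1) = 0"
      using c(1,3) sum_nonneg_eq_0_iff[OF X(1), of "\<lambda>v. c (v, 1)"] by auto
    then have "x = 0" using c(2) by simp
    moreover obtain v where "v \<in> X" using X(2) by blast
    ultimately show ?thesis using True by (auto simp: hull_inc intro!: image_eqI[of _ _ v])
  next
    case False
    have "(\<Sum>v\<in>X. (c (v, 1) / real k) *\<^sub>R v) \<in> convex hull X"
      using False c(1,3) X(1)
      by (auto simp: convex_hull_finite sum_divide_distrib[symmetric] intro!: exI[of _ "\<lambda>v. c (v, 1) / real k"])
    moreover have "x = real k *\<^sub>R (\<Sum>v\<in>X. (c (v, 1) / real k) *\<^sub>R v)"
      using False c(2) by (simp add: scaleR_sum_right)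
    ultimately show ?thesis by blast
  qed
next
  assume "x \<in> (\<lambda>x. real k *\<^sub>R x) ` (convex hull X)"
  then obtain u where u: "\<And>v. v \<in> X \<Longrightarrow> u v \<ge> 0" "sum u X = 1" "x = real k *\<^sub>R (\<Sum>v\<in>X. u v *\<^sub>R v)"
    using X(1) by (auto simp: convex_hull_finite)
  then have "(x, real k) = (\<Sum>a\<in>homogenize X. (real k * u (fst a)) *\<^sub>R a)"
    by (simp add: sum_homogenize scaleR_sum_right sum_distrib_left[symmetric])
  then show "(x, real k) \<in> cone_of (homogenize X)"
    unfolding cone_of_def using u(1) by (intro CollectI exI[of _ "\<lambda>a. real k * u (fst a)"]) auto
qed

text \<open>At height 1 the span of \<open>homogenize X\<close> is the affine hull of
  \<open>X\<close>. Intersecting with it takes the lattice relative to that hull, also when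
  \<open>M\<close> has larger rank.\<close>

definition cone_lattice :: "'a::real_vector set \<Rightarrow> 'a set \<Rightarrow> ('a \<times> real) set" where
  "cone_lattice M X = (M \<times> \<int>) \<inter> span (homogenize X)"

lemma lattice_config_homogenize:
  fixes M X :: "'a::euclidean_space set"
  assumes M: "is_lattice M" and X: "finite X" "X \<subseteq> M"
  shows "lattice_config (homogenize X) snd (cone_lattice M X)"
proof -
  interpret M: additive_subgroup M by (rule additive_subgroup_lattice[OF M])
  show ?thesis
  proof (intro lattice_config.intro lattice_config_axioms.intro point_config.intro additive_subgroup.intro)
    show "finite (homogenize X)" using X by simp
    show "linear (snd :: 'a \<times> real \<Rightarrow> real)" by (rule linear_snd)
    show "homogenize X \<subseteq> cone_lattice M X"
      using X by (auto simp: cone_lattice_def intro: span_base)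
    show "0 \<in> cone_lattice M X"
      unfolding cone_lattice_def using M.zero_mem by (simp add: mem_Times_iff span_zero)
    show "x - y \<in> cone_lattice M X" if "x \<in> cone_lattice M X" "y \<in> cone_lattice M X" for x y
      using that unfolding cone_lattice_def by (auto simp: mem_Times_iff M.diff_mem span_diff)
    fix B assume B: "B \<in> bases (homogenize X)"
    then have finB: "finite B" "independent B" "span B = span (homogenize X)"
      using X finite_subset by (auto simp: bases_def)
    \<comment> \<open>Coordinates bounded by 1 over \<open>B\<close> bound the norm by
      \<open>R\<close>, and a lattice meets a bounded set in finitely many points.\<close>
    define R where "R = (\<Sum>b\<in>B. norm b)"
    have "{x \<in> cone_lattice M X. \<forall>b\<in>B. \<bar>representation B x b\<bar> \<le> 1} \<subseteq> (M \<inter> cball 0 R) \<times> (of_int ` {- \<lceil>R\<rceil>..\<lceil>R\<rceil>})"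
    proof
      fix x assume x: "x \<in> {x \<in> cone_lattice M X. \<forall>b\<in>B. \<bar>representation B x b\<bar> \<le> 1}"
      obtain y t where yt: "x = (y, t)" by (cases x)
      have "x = (\<Sum>b\<in>B. representation B x b *\<^sub>R b)"
        using x finB by (subst real_vector.sum_representation_eq) (auto simp: cone_lattice_def)
      then have "norm x = norm (\<Sum>b\<in>B. representation B x b *\<^sub>R b)" by simp
      also have "\<dots> \<le> R"
        unfolding R_def using x by (intro sum_norm_le) (auto intro!: mult_left_le_one_le)
      finally have "norm x \<le> R" .
      then have "norm y \<le> R" "\<bar>t\<bar> \<le> R"
        using norm_fst_le[of y t] norm_snd_le[of t y] by (auto simp: yt)
      moreover have "y \<in> M" "t \<in> \<int>" using x by (auto simp: yt cone_lattice_def)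
      moreover obtain m where "t = of_int m" using \<open>t \<in> \<int>\<close> by (auto simp: Ints_def)
      moreover have "m \<in> {- \<lceil>R\<rceil>..\<lceil>R\<rceil>}"
        using \<open>\<bar>t\<bar> \<le> R\<close> \<open>t = of_int m\<close> by simp linarith
      ultimately show "x \<in> (M \<inter> cball 0 R) \<times> (of_int ` {- \<lceil>R\<rceil>..\<lceil>R\<rceil>})"
        by (auto simp: yt)
    qed
    then show "finite {x \<in> cone_lattice M X. \<forall>b\<in>B. \<bar>representation B x b\<bar> \<le> 1}"
      by (rule finite_subset) (intro finite_cartesian_product finite_lattice_Int_bounded[OF M bounded_cball], simp)
  qed (auto simp: cone_lattice_def)
qed

lemma card_slice_homogenize:
  assumes X: "finite X" "X \<noteq> {}"
  shows "card {x \<in> cone_lattice M X \<inter> cone_of (homogenize X). snd x = real k}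
    = card ((\<lambda>x. real k *\<^sub>R x) ` (convex hull X) \<inter> M)"
proof -
  have "{x \<in> cone_lattice M X \<inter> cone_of (homogenize X). snd x = real k}
      = (\<lambda>x. (x, real k)) ` ((\<lambda>x. real k *\<^sub>R x) ` (convex hull X) \<inter> M)"
  proof (intro equalityI subsetI)
    fix x assume x: "x \<in> {x \<in> cone_lattice M X \<inter> cone_of (homogenize X). snd x = real k}"
    then have xk: "x = (fst x, real k)" by (cases x) auto
    then have "fst x \<in> (\<lambda>x. real k *\<^sub>R x) ` (convex hull X)"
      using x cone_of_homogenize[OF X, of "fst x" k] by auto
    moreover have "fst x \<in> M" using x by (auto simp: cone_lattice_def)
    ultimately show "x \<in> (\<lambda>x. (x, real k)) ` ((\<lambda>x. real k *\<^sub>R x) ` (convex hull X) \<inter> M)"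
      using xk by blast
  next
    fix x assume "x \<in> (\<lambda>x. (x, real k)) ` ((\<lambda>x. real k *\<^sub>R x) ` (convex hull X) \<inter> M)"
    then obtain y where y: "x = (y, real k)" "y \<in> (\<lambda>x. real k *\<^sub>R x) ` (convex hull X)" "y \<in> M" by blast
    have c: "x \<in> cone_of (homogenize X)" using cone_of_homogenize[OF X] y by blast
    have "cone_of (homogenize X) \<subseteq> span (homogenize X)"
      unfolding cone_of_def by (blast intro: span_sum span_scale span_base)
    with c y show "x \<in> {x \<in> cone_lattice M X \<inter> cone_of (homogenize X). snd x = real k}"
      by (auto simp: cone_lattice_def)
  qed
  then show ?thesis by (simp add: card_image inj_on_def)
qed

section \<open>From the number of tiles to the volume\<close>

lemma (in tiling_of_degree) card_slice_ge:
  assumes n: "card S = Suc n" and k: "d \<le> k"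
  shows "real (card tiles) * real (k - d) ^ n \<le> fact n * real (card {x \<in> L \<inter> cone_of A. h x = real k})"
proof -
  have "real (k - d) ^ n \<le> fact n * real (card (compositions (fst t) (k - ht t)))" if t: "t \<in> tiles" for t
  proof -
    have "fst t \<in> bases A" using t tilesD(2) by (cases t) auto
    then have c: "card (compositions (fst t) (k - ht t)) = (n + (k - ht t)) choose n"
      using basesD(4) card_bases_eq n by (intro card_compositions) auto
    \<comment> \<open>Heights of tiles are at most \<open>d\<close>, so \<open>k - d\<close> is a
      lower bound for the remaining height that is uniform in \<open>t\<close>.\<close>
    have "(k - d) ^ n \<le> (k - ht t) ^ n"
      using ht_le[OF t] by (intro power_mono) auto
    also have "\<dots> \<le> fact n * ((n + (k - ht t)) choose n)" by (rule power_le_fact_binomial)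
    finally have "real ((k - d) ^ n) \<le> real (fact n * ((n + (k - ht t)) choose n))"
      by (simp only: of_nat_le_iff)
    then show ?thesis by (simp add: c)
  qed
  then have "(\<Sum>t\<in>tiles. real (k - d) ^ n) \<le> (\<Sum>t\<in>tiles. fact n * real (card (compositions (fst t) (k - ht t))))"
    by (intro sum_mono)
  also have "\<dots> = fact n * real (\<Sum>t\<in>tiles. if ht t \<le> k then card (compositions (fst t) (k - ht t)) else 0)"
    unfolding sum_distrib_left[symmetric] of_nat_sum
    using ht_le k by (intro arg_cong2[of _ _ _ _ "(*)"] sum.cong refl) (auto dest: order_trans)
  finally show ?thesis unfolding card_slice by simp
qed

text \<open>Divided by \<open>k ^ n\<close>, the count gives the lower density
  \<open>c / fact n\<close> in frame coordinates, and \<open>fact n\<close> is the normalisation of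
  the volume. The argument works for whichever frame \<open>SOME\<close> picks, once a frame is
  known to exist.\<close>

lemma normalized_volume_ge:
  fixes M P :: "'a::euclidean_space set"
  assumes M: "is_lattice M" and P: "lattice_polytope M P" and dim: "aff_dim P = int n"
    and count: "\<And>k. d \<le> k \<Longrightarrow> c * real (k - d) ^ n \<le> fact n * real (card ((\<lambda>x. real k *\<^sub>R x) ` P \<inter> M))"
  shows "c \<le> normalized_volume M P"
proof -
  interpret M: additive_subgroup M by (rule additive_subgroup_lattice[OF M])
  have poly: "polytope P" and vM: "vertices P \<subseteq> M" using P by (auto simp: lattice_polytope_def)
  have hull: "affine hull vertices P = affine hull P"
    using convex_hull_vertices(2)[OF poly] affine_hull_convex_hull by metis
  have "P \<noteq> {}" using dim by auto
  then obtain v where v: "v \<in> vertices P"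
    using convex_hull_vertices(2)[OF poly] by (metis convex_hull_empty equals0I)
  have "\<exists>b. lattice_frame (affine hull vertices P \<inter> M) n v b"
  proof (rule lattice_frame_exists[OF M vM])
    show "aff_dim (vertices P) = int n" using dim hull by (metis aff_dim_affine_hull)
    show "v \<in> affine hull vertices P \<inter> M" using v vM by (auto intro: hull_inc)
  qed
  then have ex: "\<exists>pb. (case pb of (p, b) \<Rightarrow> lattice_frame (affine hull P \<inter> M) n p b)"
    by (auto simp: hull)
  obtain p b where pb: "(SOME (p, b). lattice_frame (affine hull P \<inter> M) n p b) = (p, b)"
    by (cases "SOME (p, b). lattice_frame (affine hull P \<inter> M) n p b")
  then have frame: "lattice_frame (affine hull P \<inter> M) n p b"
    using someI_ex[OF ex] by simp
  have inj: "inj_on b {..<n}" and indep: "independent (b ` {..<n})"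
    and L: "affine hull P \<inter> M = {p + (\<Sum>i<n. of_int (z i) *\<^sub>R b i) | z :: nat \<Rightarrow> int. True}"
    using frame by (auto simp: lattice_frame_def)
  have "p + (\<Sum>i<n. of_int 0 *\<^sub>R b i) \<in> affine hull P \<inter> M"
    unfolding L by (intro CollectI exI[of _ "\<lambda>_. 0"] conjI refl TrueI)
  then have p: "p \<in> affine hull P" "p \<in> M" by auto
  let ?G = "\<lambda>k. (\<lambda>x. real k *\<^sub>R x) ` P \<inter> M"
  have ex\<zeta>: "\<exists>z. z \<in> {..<n} \<rightarrow>\<^sub>E (UNIV :: int set) \<and> x = real k *\<^sub>R p + (\<Sum>i<n. of_int (z i) *\<^sub>R b i)" if x: "x \<in> ?G k" for x k
  proof -
    obtain y where y: "x = real k *\<^sub>R y" "y \<in> P" using x by blast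
    \<comment> \<open>The dilate of \<open>P\<close> lies in the dilated hull rather than in the
      hull itself. Adding \<open>(1 - k)\<close> times \<open>p\<close> brings its lattice points
      back, so \<open>k\<close> times \<open>p\<close> serves as their origin.\<close>
    have "(1 - real k) *\<^sub>R p + real k *\<^sub>R y \<in> affine hull P"
      using p y by (intro mem_affine[OF affine_affine_hull]) (auto intro: hull_inc)
    moreover have "of_int (1 - int k) *\<^sub>R p + x \<in> M"
      using x p by (intro M.add_mem M.of_int_mem) auto
    ultimately have "(1 - real k) *\<^sub>R p + x \<in> affine hull P \<inter> M"
      by (simp add: y(1))
    then obtain z :: "nat \<Rightarrow> int" where z: "(1 - real k) *\<^sub>R p + x = p + (\<Sum>i<n. of_int (z i) *\<^sub>R b i)"
      unfolding L by blast
    then have "x = real k *\<^sub>R p + (\<Sum>i<n. of_int (z i) *\<^sub>R b i)"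
      by (simp add: algebra_simps)
    then show ?thesis by (intro exI[of _ "restrict z {..<n}"]) auto
  qed
  define \<zeta> where "\<zeta> k x = (SOME z. z \<in> {..<n} \<rightarrow>\<^sub>E (UNIV :: int set) \<and> x = real k *\<^sub>R p + (\<Sum>i<n. of_int (z i) *\<^sub>R b i))" for k x
  have \<zeta>: "\<zeta> k x \<in> {..<n} \<rightarrow>\<^sub>E (UNIV :: int set)"
    "x = real k *\<^sub>R p + (\<Sum>i<n. of_int (\<zeta> k x i) *\<^sub>R b i)" if "x \<in> ?G k" for k x
    using someI_ex[OF ex\<zeta>[OF that]] unfolding \<zeta>_def by (rule conjunct1, rule conjunct2)
  define Z where "Z k = \<zeta> k ` ?G k" for k
  have cardZ: "card (Z k) = card (?G k)" for k
  proof -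
    have "inj_on (\<zeta> k) (?G k)"
    proof (rule inj_onI)
      fix x y assume xy: "x \<in> ?G k" "y \<in> ?G k" and eq: "\<zeta> k x = \<zeta> k y"
      have "x = real k *\<^sub>R p + (\<Sum>i<n. of_int (\<zeta> k x i) *\<^sub>R b i)" by (rule \<zeta>(2)[OF xy(1)])
      also have "\<dots> = real k *\<^sub>R p + (\<Sum>i<n. of_int (\<zeta> k y i) *\<^sub>R b i)" by (simp only: eq)
      also have "\<dots> = y" by (rule \<zeta>(2)[OF xy(2), symmetric])
      finally show "x = y" .
    qed
    then show ?thesis unfolding Z_def by (rule card_image)
  qed
  \<comment> \<open>The value 0 for \<open>k < d\<close> is a placeholder that satisfies the bound
    trivially; the limit is governed by large \<open>k\<close>.\<close>
  define f where "f k = (if k < d then 0 else c / fact n * (real (k - d) / real k) ^ n)" for k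
  have "c / fact n \<le> measure (Pi\<^sub>M {..<n} (\<lambda>_. lborel :: real measure))
      {x \<in> space (Pi\<^sub>M {..<n} (\<lambda>_. lborel :: real measure)). p + (\<Sum>i<n. x i *\<^sub>R b i) \<in> P}"
  proof (rule measure_ge_lattice_point_density[OF polytope_imp_compact[OF poly] inj indep])
    show "Z k \<subseteq> {..<n} \<rightarrow>\<^sub>E UNIV" for k using \<zeta>(1) by (auto simp: Z_def)
    show "p + (\<Sum>i<n. (of_int (z i) / real k) *\<^sub>R b i) \<in> P" if k0: "k > 0" and z: "z \<in> Z k" for k z
    proof -
      obtain x where x: "x \<in> ?G k" "z = \<zeta> k x" using z by (auto simp: Z_def)
      obtain y where y: "x = real k *\<^sub>R y" "y \<in> P" using x(1) by blast
      have "real k *\<^sub>R (p + (\<Sum>i<n. (of_int (z i) / real k) *\<^sub>R b i)) = real k *\<^sub>R p + (\<Sum>i<n. of_int (z i) *\<^sub>R b i)"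
        using k0 by (simp add: scaleR_add_right scaleR_sum_right)
      also have "\<dots> = real k *\<^sub>R y" using \<zeta>(2)[OF x(1)] x(2) y(1) by simp
      finally show ?thesis using k0 y(2) by simp
    qed
    show "f k \<le> real (card (Z k)) / real k ^ n" if "k > 0" for k
    proof (cases "k < d")
      case False
      then have "c * real (k - d) ^ n \<le> fact n * real (card (Z k))"
        using count[of k] cardZ by simp
      then have "c * real (k - d) ^ n / (fact n * real k ^ n) \<le> fact n * real (card (Z k)) / (fact n * real k ^ n)"
        using that by (intro divide_right_mono) auto
      then show ?thesis using False by (simp add: f_def power_divide)
    qed (simp add: f_def)
    show "f \<longlonglongrightarrow> c / fact n"
    proof (rule Lim_transform_eventually)
      show "\<forall>\<^sub>F k in sequentially. c / fact n * (1 - real d / real k) ^ n = f k"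
        using eventually_ge_at_top[of "Suc d"]
        by eventually_elim (auto simp: f_def of_nat_diff diff_divide_distrib)
      have "(\<lambda>k. real d / real k) \<longlonglongrightarrow> 0" by (rule lim_const_over_n)
      then have "(\<lambda>k. c / fact n * (1 - real d / real k) ^ n) \<longlonglongrightarrow> c / fact n * (1 - 0) ^ n"
        by (intro tendsto_intros)
      then show "(\<lambda>k. c / fact n * (1 - real d / real k) ^ n) \<longlonglongrightarrow> c / fact n" by simp
    qed
  qed
  then have "c \<le> fact n * measure (Pi\<^sub>M {..<n} (\<lambda>_. lborel :: real measure))
      {x \<in> space (Pi\<^sub>M {..<n} (\<lambda>_. lborel :: real measure)). p + (\<Sum>i<n. x i *\<^sub>R b i) \<in> P}"
    by (simp add: field_simps)
  then show ?thesis
    using pb by (simp add: normalized_volume_def Let_def dim)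
qed

theorem proposition1p5:
  fixes M P :: "'a::euclidean_space set"
    and n d :: nat
    and V :: real
  assumes "is_lattice M"
    and "lattice_polytope M P"
    and "aff_dim P = int n"
    and "normalized_volume M P = V"
    and "lattice_degree M P = d"
    and "real n \<ge> (V - 1) * (2 * real d + 1)"
  shows "\<exists>Q. lattice_polytope M Q \<and> aff_dim Q = int n - 1 \<and> lattice_pyramid M P Q"
proof -
  note M = assms(1) and P = assms(2) and dim = assms(3)
  interpret M: additive_subgroup M by (rule additive_subgroup_lattice[OF M])
  define X where "X = vertices P"
  have poly: "polytope P" and XM: "X \<subseteq> M"
    using P by (auto simp: lattice_polytope_def X_def)
  have finX: "finite X" and PX: "P = convex hull X"
    using convex_hull_vertices[OF poly] by (auto simp: X_def)
  have hullX: "affine hull X = affine hull P"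
    using PX by simp
  have "P \<noteq> {}" using dim by auto
  then have "X \<noteq> {}" using PX by auto
  \<comment> \<open>An affine basis consisting of vertices; its homogenisation is the distinguished
    basis \<open>S\<close>.\<close>
  obtain C where C: "\<not> affine_dependent C" "C \<subseteq> X" "affine hull C = affine hull X"
    using affine_basis_exists[of X] by metis
  have finC: "finite C" using C(2) finX finite_subset by blast
  have "int (card C) = int (Suc n)"
    using aff_dim_affine_independent[OF C(1)] C(3) hullX dim by (metis aff_dim_affine_hull of_nat_Suc diff_eq_eq add.commute)
  then have cardC: "card C = Suc n" by simp
  define A where "A = homogenize X"
  define S where "S = homogenize C"
  define L where "L = cone_lattice M X"
  interpret lattice_config A snd L
    unfolding A_def L_def by (rule lattice_config_homogenize[OF M finX XM])
  have spanS: "span S = span A"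
  proof
    show "span S \<subseteq> span A" using C(2) by (intro span_mono) (auto simp: S_def A_def)
    have "A \<subseteq> span S"
    proof
      fix a assume "a \<in> A"
      then obtain x where x: "a = (x, 1)" "x \<in> X" by (auto simp: A_def)
      then have "x \<in> affine hull C" using C(3) by (simp add: hull_inc)
      then show "a \<in> span S" using affine_hull_homogenize[OF finC] x by (simp add: S_def)
    qed
    then show "span A \<subseteq> span S" by (simp add: span_minimal)
  qed
  have SA: "S \<in> bases A"
    using independent_homogenize[OF finC C(1)] spanS C(2) by (auto simp: bases_def S_def A_def)
  obtain \<omega> where \<omega>: "S \<in> optimal_bases \<omega>" "\<forall>B\<in>bases A. \<forall>a\<in>A - B. height_ext \<omega> B a \<noteq> \<omega> a"
    using generic_heights[OF SA] by blast
  obtain q where q: "in_general_position q" "\<forall>s\<in>S. coord S q s > 0"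
    using generic_direction[OF SA] by blast
  interpret tiling A snd L S \<omega> q
    using \<omega> q by unfold_locales auto
  have cardS: "card S = Suc n"
    unfolding S_def using cardC by (simp add: card_image[OF inj_on_homogenize])
  have slices: "card {x \<in> L \<inter> cone_of A. snd x = real k} = card ((\<lambda>x. real k *\<^sub>R x) ` P \<inter> M)" for k
    unfolding L_def A_def PX by (rule card_slice_homogenize[OF finX \<open>X \<noteq> {}\<close>])
  have "h_star M P = Abs_fps (\<lambda>i. int (card {t \<in> tiles. ht t = i}))"
    using fps_slices unfolding slices h_star_def ehrhart_series_def dim cardS by simp
  \<comment> \<open>The coefficients count tiles and cannot cancel, so the degree is the largest
    height of a tile.\<close>
  then have "{i. fps_nth (h_star M P) i \<noteq> 0} = ht ` tiles"
    using finite_tiles by auto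
  then have d: "d = Max (ht ` tiles)"
    using assms(5) by (simp add: lattice_degree_def)
  interpret tiling_of_degree A snd L S \<omega> q d
    using finite_tiles by unfold_locales (simp add: d)
  have "real (card tiles) \<le> V"
  proof -
    have "real (card tiles) \<le> normalized_volume M P"
    proof (rule normalized_volume_ge[OF M P dim])
      show "real (card tiles) * real (k - d) ^ n \<le> fact n * real (card ((\<lambda>x. real k *\<^sub>R x) ` P \<inter> M))"
        if "d \<le> k" for k
        using card_slice_ge[OF cardS that] by (simp only: slices)
    qed
    then show ?thesis using assms(4) by simp
  qed
  then have "(real (card tiles) - 1) * (2 * real d + 1) \<le> (V - 1) * (2 * real d + 1)"
    by (intro mult_right_mono) auto
  then have le_n: "(real (card tiles) - 1) * (2 * real d + 1) \<le> real n"
    using assms(6) by linarith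
  \<comment> \<open>A vertex with nonnegative coordinates over \<open>S\<close> would lie in
    \<open>convex hull C\<close>, yet removing an extreme point from \<open>P\<close> leaves a
    convex set that still contains \<open>C\<close>.\<close>
  have ext: "\<exists>s\<in>S. coord S a s < 0" if a: "a \<in> A - S" for a
  proof (rule ccontr)
    assume "\<not> (\<exists>s\<in>S. coord S a s < 0)"
    then have nonneg: "coord S a s \<ge> 0" if "s \<in> S" for s using that by (auto simp: not_less)
    obtain v where v: "a = (v, 1)" "v \<in> X" "v \<notin> C" using a by (auto simp: A_def S_def)
    have "a = (\<Sum>s\<in>S. coord S a s *\<^sub>R s)"
      using sum_coord[OF SA] a by (simp add: span_base)
    then have vs: "v = (\<Sum>c\<in>C. coord S a (c, 1) *\<^sub>R c)" "1 = (\<Sum>c\<in>C. coord S a (c, 1))"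
      unfolding S_def sum_homogenize v(1) by simp_all
    then have "v \<in> convex hull C"
      using finC nonneg by (auto simp: convex_hull_finite S_def intro!: exI[of _ "\<lambda>c. coord S a (c, 1)"])
    moreover have "convex (P - {v})"
      using v(2) extreme_point_of_stillconvex[of P v] polytope_imp_convex[OF poly] by (simp add: X_def vertices_def)
    moreover have "C \<subseteq> P - {v}"
      using C(2) v(3) PX by (auto intro: hull_inc)
    ultimately show False by (metis DiffD2 hull_minimal insertI1 subsetD)
  qed
  have many: "(card tiles - 1) * (2 * d + 1) < card S"
  proof (cases "card tiles")
    case (Suc m)
    then have "real (m * (2 * d + 1)) \<le> real n" using le_n by (simp add: algebra_simps)
    then have "m * (2 * d + 1) \<le> n" by (simp only: of_nat_le_iff)
    then show ?thesis using Suc cardS by simp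
  qed (simp add: cardS)
  obtain c0 where c0: "c0 \<in> C" and int: "\<And>x. x \<in> L \<Longrightarrow> coord S x (c0, 1) \<in> \<int>"
    and zero: "\<And>a. a \<in> A - S \<Longrightarrow> coord S a (c0, 1) = 0"
    using apex_exists[OF ext many] by (auto simp: S_def)
  define Y where "Y = X - {c0}"
  define Q where "Q = convex hull Y"
  have finY: "finite Y" and YM: "Y \<subseteq> M" using finX XM by (auto simp: Y_def)
  have s0: "(c0, 1) \<in> S" and c0X: "c0 \<in> X" using c0 C(2) by (auto simp: S_def)
  have zeroY: "coord S (v, 1) (c0, 1) = 0" if "v \<in> Y" for v
  proof (cases "(v, 1) \<in> S")
    case True
    then show ?thesis using coord_basis[OF SA True] that by (auto simp: Y_def)
  next
    case False
    then show ?thesis using zero that by (auto simp: A_def Y_def)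
  qed
  have AY: "(v, 1) \<in> span A" if "v \<in> affine hull X" for v
    using that affine_hull_homogenize[OF finX] by (simp add: A_def)
  have coordY: "coord S (v, 1) (c0, 1) = 0" if v: "v \<in> affine hull Y" for v
  proof -
    obtain u where u: "sum u Y = 1" "v = (\<Sum>y\<in>Y. u y *\<^sub>R y)"
      using v finY by (auto simp: affine_hull_finite)
    then have eq: "(v, 1 :: real) = (\<Sum>y\<in>Y. u y *\<^sub>R (y, 1))"
      by (simp add: sum_prod)
    have "(y, 1) \<in> span A" if "y \<in> Y" for y
      using that by (intro span_base) (auto simp: A_def Y_def)
    then have "coord S (v, 1) (c0, 1) = (\<Sum>y\<in>Y. u y * coord S (y, 1) (c0, 1))"
      unfolding eq using SA by (subst coord_sum_fun) (auto simp del: scaleR_Pair intro!: span_scale simp: coord_scale)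
    then show ?thesis using zeroY by simp
  qed
  \<comment> \<open>Inside \<open>affine hull X\<close> the hull of the base is the zero set of the
    \<open>c0\<close>-coordinate: a point there uses only \<open>C - {c0}\<close>, which is part of
    \<open>Y\<close>.\<close>
  have hullY: "v \<in> affine hull Y" if v: "v \<in> affine hull X" "coord S (v, 1) (c0, 1) = 0" for v
  proof -
    have "(v, 1) = (\<Sum>a\<in>S. coord S (v, 1) a *\<^sub>R a)"
      using sum_coord[OF SA AY[OF v(1)]] by simp
    also have "\<dots> = (\<Sum>a\<in>homogenize (C - {c0}). coord S (v, 1) a *\<^sub>R a)"
      using v(2) finC by (intro sum.mono_neutral_right) (auto simp: S_def)
    also have "\<dots> \<in> span (homogenize (C - {c0}))"
      by (intro span_sum span_scale span_base)
    finally have "v \<in> affine hull (C - {c0})"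
      using affine_hull_homogenize[of "C - {c0}" v] finC by simp
    also have "\<dots> \<subseteq> affine hull Y"
      using C(2) by (intro hull_mono) (auto simp: Y_def)
    finally show ?thesis .
  qed
  have hullQ: "affine hull Q = affine hull Y" by (simp add: Q_def)
  have c0_notin: "c0 \<notin> affine hull Y"
    using coordY[of c0] coord_basis[OF SA s0] by auto
  have PQ: "P = convex hull (insert c0 Q)"
  proof -
    have "P = convex hull (insert c0 Y)" using c0X by (simp add: PX Y_def insert_absorb)
    then show ?thesis unfolding Q_def by (metis hull_insert)
  qed
  have "aff_dim P = aff_dim (insert c0 Q)" unfolding PQ by (rule aff_dim_convex_hull)
  then have dimQ: "aff_dim Q = int n - 1"
    using c0_notin dim hullQ by (simp add: aff_dim_insert)
  have "vertices Q \<subseteq> M"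
    using vertices_convex_hull_subset[of Y] YM by (auto simp: Q_def)
  then have Q: "lattice_polytope M Q"
    using finY by (auto simp: lattice_polytope_def Q_def polytope_def)
  have "lattice_pyramid M P Q"
  proof (cases n)
    case 0
    then have "Q = {}" using dimQ by (simp add: aff_dim_empty)
    then show ?thesis using lattice_pyramid_point[OF P] dim 0 by simp
  next
    case (Suc k)
    have dimQk: "aff_dim Q = int k" using dimQ Suc by simp
    then have dimYk: "aff_dim Y = int k" by (simp add: Q_def aff_dim_convex_hull)
    then have "Y \<noteq> {}" by auto
    then obtain p where p: "p \<in> Y" by blast
    have pY: "p \<in> affine hull Y" and pM: "p \<in> M" and c0M: "c0 \<in> M"
      using p YM c0X XM by (auto intro: hull_inc)
    have YP: "affine hull Y \<subseteq> affine hull P"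
      unfolding hullX[symmetric] by (intro hull_mono) (auto simp: Y_def)
    obtain b0 where frameY: "lattice_frame (affine hull Y \<inter> M) k p b0"
      using lattice_frame_exists[OF M YM dimYk] pY pM by blast
    have inj0: "inj_on b0 {..<k}" and indep0: "independent (b0 ` {..<k})"
      and LY: "affine hull Y \<inter> M = {p + (\<Sum>i<k. of_int (z i) *\<^sub>R b0 i) | z :: nat \<Rightarrow> int. True}"
      using frameY by (auto simp: lattice_frame_def)
    have affY: "affine hull Y = {p + (\<Sum>i<k. c i *\<^sub>R b0 i) | c. True}"
      by (rule lattice_frame_affine_hull[OF frameY dimYk])
    \<comment> \<open>The last frame vector leads from the apex to a lattice point of the base,
      along which the \<open>c0\<close>-coordinate drops from 1 to 0.\<close>
    define b where "b = b0(k := p - c0)"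
    have notin: "p - c0 \<notin> span (b0 ` {..<k})"
    proof
      assume "p - c0 \<in> span (b0 ` {..<k})"
      then obtain u where "p - c0 = (\<Sum>v\<in>b0 ` {..<k}. u v *\<^sub>R v)"
        by (auto simp: span_finite)
      then have "c0 = p + (\<Sum>i<k. (- u (b0 i)) *\<^sub>R b0 i)"
        by (simp add: sum.reindex[OF inj0] sum_negf algebra_simps)
      then have "c0 \<in> affine hull Y"
        unfolding affY by (intro CollectI exI[of _ "\<lambda>i. - u (b0 i)"] conjI TrueI)
      with c0_notin show False by simp
    qed
    have bsum: "(\<Sum>i<Suc k. c i *\<^sub>R b i) = (\<Sum>i<k. c i *\<^sub>R b0 i) + c k *\<^sub>R (p - c0)" for c
      by (simp add: b_def)
    have frame: "lattice_frame (affine hull P \<inter> M) (Suc k) c0 b"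
      unfolding lattice_frame_def
    proof (intro conjI)
      have img: "b ` {..<k} = b0 ` {..<k}" by (auto simp: b_def)
      show "inj_on b {..<Suc k}"
        using inj0 notin unfolding lessThan_Suc inj_on_insert
        by (auto simp: b_def inj_on_def intro: span_base)
      show "independent (b ` {..<Suc k})"
        unfolding lessThan_Suc image_insert img using indep0 notin
        by (simp add: b_def independent_insertI)
      show "affine hull P \<inter> M = {c0 + (\<Sum>i<Suc k. of_int (z i) *\<^sub>R b i) | z :: nat \<Rightarrow> int. True}"
      proof (intro equalityI subsetI)
        fix x assume x: "x \<in> affine hull P \<inter> M"
        then have xX: "x \<in> affine hull X" using hullX by simp
        then have "(x, 1) \<in> L"
          using x AY by (auto simp: L_def cone_lattice_def A_def)
        then obtain m where m: "coord S (x, 1) (c0, 1) = of_int m"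
          using int[of "(x, 1)"] by (auto simp: Ints_def)
        \<comment> \<open>The \<open>c0\<close>-coordinate \<open>m\<close> of \<open>x\<close> is
          an integer, so adding \<open>m\<close> times \<open>p - c0\<close> brings \<open>x\<close>
          to a lattice point of the hull of the base.\<close>
        define y where "y = x + of_int m *\<^sub>R (p - c0)"
        have pX: "p \<in> affine hull X" and c0h: "c0 \<in> affine hull X"
          using p c0X by (auto simp: Y_def intro: hull_inc)
        have "y \<in> M" unfolding y_def using x pM c0M by (intro M.add_mem M.of_int_mem M.diff_mem) auto
        have yX: "y \<in> affine hull X"
          unfolding y_def using mem_affine_3_minus[OF affine_affine_hull xX pX c0h] .
        have "(y, 1 :: real) = (x, 1) + of_int m *\<^sub>R ((p, 1) - (c0, 1))" by (simp add: y_def)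
        then have "coord S (y, 1) (c0, 1) = of_int m + of_int m * (coord S (p, 1) (c0, 1) - coord S (c0, 1) (c0, 1))"
          using AY[OF xX] AY[OF pX] AY[OF c0h] SA m
          by (simp del: diff_Pair scaleR_Pair add_Pair add: coord_add coord_scale coord_diff span_diff span_scale)
        then have "coord S (y, 1) (c0, 1) = 0"
          using zeroY[OF p] coord_basis[OF SA s0] by simp
        then have "y \<in> affine hull Y \<inter> M" using hullY[OF yX] \<open>y \<in> M\<close> by simp
        then obtain z :: "nat \<Rightarrow> int" where z: "y = p + (\<Sum>i<k. of_int (z i) *\<^sub>R b0 i)"
          unfolding LY by blast
        \<comment> \<open>The coefficient is \<open>1 - m\<close> instead of \<open>- m\<close>
          because the origin changes from \<open>p\<close> to \<open>c0\<close>, and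
          \<open>p = c0 + (p - c0)\<close>.\<close>
        have eq: "(\<Sum>i<Suc k. of_int ((z(k := 1 - m)) i) *\<^sub>R b i) = (\<Sum>i<k. of_int (z i) *\<^sub>R b0 i) + of_int (1 - m) *\<^sub>R (p - c0)"
          unfolding bsum by simp
        have "x = c0 + ((\<Sum>i<k. of_int (z i) *\<^sub>R b0 i) + of_int (1 - m) *\<^sub>R (p - c0))"
          using z unfolding y_def by (simp add: algebra_simps)
        then have "x = c0 + (\<Sum>i<Suc k. of_int ((z(k := 1 - m)) i) *\<^sub>R b i)"
          unfolding eq .
        then show "x \<in> {c0 + (\<Sum>i<Suc k. of_int (z i) *\<^sub>R b i) | z :: nat \<Rightarrow> int. True}"
          by (intro CollectI exI[of _ "z(k := 1 - m)"] conjI TrueI)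
      next
        fix x assume "x \<in> {c0 + (\<Sum>i<Suc k. of_int (z i) *\<^sub>R b i) | z :: nat \<Rightarrow> int. True}"
        then obtain z :: "nat \<Rightarrow> int" where z: "x = c0 + (\<Sum>i<Suc k. of_int (z i) *\<^sub>R b i)" by blast
        define y where "y = p + (\<Sum>i<k. of_int (z i) *\<^sub>R b0 i)"
        have y: "y \<in> affine hull Y \<inter> M" unfolding LY y_def by blast
        have xy: "x = y + of_int (z k - 1) *\<^sub>R (p - c0)"
          unfolding z bsum y_def by (simp add: algebra_simps)
        have "x \<in> affine hull P"
          unfolding xy using y YP pY c0X hullX
          by (intro mem_affine_3_minus affine_affine_hull) (auto intro: hull_inc)
        moreover have "x \<in> M"
          unfolding xy using y pM c0M by (intro M.add_mem M.of_int_mem M.diff_mem) auto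
        ultimately show "x \<in> affine hull P \<inter> M" by simp
      qed
    qed
    show ?thesis
    proof (rule lattice_pyramid_of_frame[OF P Q _ dimQk PQ frame])
      show "aff_dim P = int (Suc k)" using dim Suc by simp
      fix x assume "x \<in> Q"
      then have "x \<in> affine hull Y" using hull_subset[of Q affine] hullQ by blast
      then obtain c where c: "x = p + (\<Sum>i<k. c i *\<^sub>R b0 i)" unfolding affY by blast
      have eq: "(\<Sum>i<Suc k. (c(k := 1)) i *\<^sub>R b i) = (\<Sum>i<k. c i *\<^sub>R b0 i) + (p - c0)"
        unfolding bsum by simp
      then show "\<exists>c. x = c0 + (\<Sum>i<Suc k. c i *\<^sub>R b i) \<and> c k = 1"
        unfolding c by (intro exI[of _ "c(k := 1)"] conjI) (unfold eq, simp_all)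
    qed
  qed
  with Q dimQ show ?thesis by blast
qed

end
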